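(* Let $H$ be a transfer Krull monoid. If $H$ is length-factorial, then $H_{\mathrm{red}}$ is a Krull monoid, whence it fulfills the following structural description: $H_{\mathrm{red}}=\mathcal F(P_0)\times H^*$, where $P_0$ is the set of prime elements of $H_{\mathrm{red}}$ and $H^*$ is a reduced length-factorial Krull monoid without prime elements, with $\mathcal C(H_{\mathrm{red}})\cong\mathcal C(H^* )$; and if $H$ is not factorial, then, denoting by $G_{P^*}\subset\mathcal C(H^* )$ the set of classes containing prime divisors, every class of $G_{P^*}$ contains precisely one prime divisor, $H^*\cong\mathcal B(G_{P^*})$, and there exist $t\in\mathbb N_0$, $k,s_0,\ldots,s_t\in\mathbb N$ with $k+1\ne s_0+\ldots+s_t$ and $s_0+\ldots+s_t\ge 2$, independent elements $e_{i,j}\in\mathcal C(H^* )$ ($i\in[1,k]$, $j\in[1,t]$) of infinite order, and independent elements $g_1,\ldots,g_k\in\mathcal C(H^* )$, which are of infinite order in case $t>0$ and of finite order in case $t=0$, such that \[ G_{P^*}=\{e_{i,j}: i\in[0,k], j\in[1,t]\}\cup\{g_0,g_1,\ldots,g_k\}, \] \[ \mathcal C(H^* )=\langle e_{1,1},\ldots,e_{1,t},g_1 \rangle \oplus \ldots \oplus \langle e_{k,1},\ldots,e_{k,t},g_k \rangle\cong (\mathbb Z^t\oplus \mathbb Z/n\mathbb Z)^k, \] where, for every $i\in[1,k]$, $s_0$ is the smallest positive integer such that $s_0g_i\in\langle e_{i,1},\ldots,e_{i,t}\rangle$ and $-s_0g_i=s_1e_{i,1}+\ldots+s_te_{i,t}$,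 and where $e_{0,j}=-\sum_{i=1}^ke_{i,j}$ for all $j\in[1,t]$, $g_0=-\sum_{i=1}^kg_i$, and $n=\gcd(s_0,\ldots,s_t)$. Moreover, in this case $\mathcal C(H^* )$ is a torsion group if and only if $t=0$, and then $\mathcal C(H^* )\cong(\mathbb Z/n\mathbb Z)^k$ with $n\ge2$, $k+1\ne n$, and $\mathrm{ord}(g_i)=n$ for all $i\in[1,k]$.
   Context: A monoid means a commutative semigroup with identity that is unit-cancellative ($a=au$ implies that $u$ is invertible); it need not be cancellative. $\mathbb N=\{1,2,\ldots\}$, $\mathbb N_0=\mathbb N\cup\{0\}$, $[a,b]=\{x\in\mathbb Z: a\le x\le b\}$. For a monoid $H$: $H^\times$ is its group of invertible elements; $H$ is reduced if $H^\times=\{1\}$; $H_{\mathrm{red}}=\{aH^\times : a\in H\}$. An element $u\notin H^\times$ is prime if $u\mid ab$ implies $u\mid a$ or $u\mid b$; it is an atom if $u=ab$ implies $a\in H^\times$ or $b\in H^\times$. $\mathcal F(P)$ is the free abelian monoid with basis $P$. The factorization monoid is $\mathsf Z(H)=\mathcal F(\mathcal A(H_{\mathrm{red}}))$, where $\mathcal A(\cdot)$ is the set of atoms. Factorizations of $a\in H$ are the $z\in\mathsf Z(H)$ with product $aH^\times$ in $H_{\mathrm{red}}$; the length of $z$ is its number of atoms counted with multiplicity. $H$ is atomic if every element has a factorization, factorial if every element has exactly one, and length-factorial if it is atomic and any two distinct factorizations of any element have distinct lengths. A monoid homomorphism $\theta\colon H\to B$ is a transfer homomorphism if (T1) $B=\theta(H)B^\times$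 and $\theta^{-1}(B^\times)=H^\times$; and (T2) if $u\in H$, $b,c\in B$ and $\theta(u)=bc$, then there are $v,w\in H$ with $u=vw$, $\theta(v)\in bB^\times$ and $\theta(w)\in cB^\times$. $H$ is transfer Krull if there is a transfer homomorphism $\theta\colon H\to B$ to a Krull monoid $B$. A monoid homomorphism $\varphi\colon H\to D$ is a divisor homomorphism if $\varphi(a)\mid\varphi(b)$ in $D$ implies $a\mid b$ in $H$. It is a divisor theory if moreover $D$ is free abelian and every $a\in D$ is of the form $\gcd(\varphi(a_1),\ldots,\varphi(a_m))$ with $a_1,\ldots,a_m\in H$. A Krull monoid is a cancellative monoid having a divisor theory. If $H$ is Krull with divisor theory $H_{\mathrm{red}}\hookrightarrow F=\mathcal F(P)$ (unique up to isomorphism), its class group is $\mathcal C(H)=\mathsf q(F)/\mathsf q(H_{\mathrm{red}})$ (quotient groups), written additively. The elements of $P$ are the prime divisors, and $p\in P$ lies in the class $[p]=p\,\mathsf q(H_{\mathrm{red}})$. For an additive abelian group $G$ and $G_0\subset G$: $\langle G_0\rangle$ is the subgroup generated by $G_0$. Elements $e_1,\ldots,e_r$ are independent if all are nonzero and $\langle e_1,\ldots,e_r\rangle=\langle e_1\rangle\oplus\ldots\oplus\langle e_r\rangle$. $\mathcal B(G_0)=\{S=g_1\cdot\ldots\cdot g_\ell\in\mathcal F(G_0): g_1+\ldots+g_\ell=0\}$ is the monoid of zero-sum sequences over $G_0$. *)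

theory Defs
  imports "HOL-Algebra.Algebra" "HOL-Library.Multiset"
begin

section \<open>Monoids, factorizations and transfer homomorphisms\<close>

text \<open>Monoids are written multiplicatively and are commutative and unit-cancellative.\<close>

locale uc_monoid = comm_monoid G for G (structure) +
  assumes unit_cancel: "\<lbrakk>a \<in> carrier G; u \<in> carrier G; a = a \<otimes> u\<rbrakk> \<Longrightarrow> u \<in> Units G"

definition reduced :: "('a, 'm) monoid_scheme \<Rightarrow> bool" where
  "reduced G \<longleftrightarrow> Units G = {\<one>\<^bsub>G\<^esub>}"

text \<open>The elements of \<open>G Mod Units G\<close> are the cosets of the unit group, multiplied as sets;
  this construction makes sense although \<open>G\<close> is only a monoid.\<close>

definition red :: "('a, 'm) monoid_scheme \<Rightarrow> 'a set monoid" where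
  "red G = G Mod Units G"

definition atoms :: "('a, 'm) monoid_scheme \<Rightarrow> 'a set" where
  "atoms G = {u \<in> carrier G. u \<notin> Units G \<and>
     (\<forall>a\<in>carrier G. \<forall>b\<in>carrier G. u = a \<otimes>\<^bsub>G\<^esub> b \<longrightarrow> a \<in> Units G \<or> b \<in> Units G)}"

definition primes :: "('a, 'm) monoid_scheme \<Rightarrow> 'a set" where
  "primes G = {p \<in> carrier G. Divisibility.prime G p}"

definition free_monoid :: "'p set \<Rightarrow> 'p multiset monoid" where
  "free_monoid P = \<lparr>carrier = {M. set_mset M \<subseteq> P}, monoid.mult = (+), one = {#}\<rparr>"

definition mset_prod :: "('a, 'm) monoid_scheme \<Rightarrow> 'a multiset \<Rightarrow> 'a" where
  "mset_prod G M = (\<Otimes>\<^bsub>G\<^esub>x\<in>set_mset M. x [^]\<^bsub>G\<^esub> count M x)"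

text \<open>The length of a factorization \<open>z\<close> is \<open>size z\<close>.\<close>

definition factorizations :: "('a, 'm) monoid_scheme \<Rightarrow> 'a \<Rightarrow> 'a set multiset set" where
  "factorizations H a =
     {z \<in> carrier (free_monoid (atoms (red H))). mset_prod (red H) z = a <#\<^bsub>H\<^esub> Units H}"

definition atomic :: "('a, 'm) monoid_scheme \<Rightarrow> bool" where
  "atomic H \<longleftrightarrow> (\<forall>a\<in>carrier H. factorizations H a \<noteq> {})"

definition factorial :: "('a, 'm) monoid_scheme \<Rightarrow> bool" where
  "factorial H \<longleftrightarrow> (\<forall>a\<in>carrier H. \<exists>!z. z \<in> factorizations H a)"

definition length_factorial :: "('a, 'm) monoid_scheme \<Rightarrow> bool" where
  "length_factorial H \<longleftrightarrow> atomic H \<and>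
     (\<forall>a\<in>carrier H. \<forall>z\<in>factorizations H a. \<forall>z'\<in>factorizations H a.
        z \<noteq> z' \<longrightarrow> size z \<noteq> size z')"

definition monoid_hom ::
  "('a, 'm) monoid_scheme \<Rightarrow> ('b, 'n) monoid_scheme \<Rightarrow> ('a \<Rightarrow> 'b) \<Rightarrow> bool" where
  "monoid_hom H B f \<longleftrightarrow> f \<in> hom H B \<and> f \<one>\<^bsub>H\<^esub> = \<one>\<^bsub>B\<^esub>"

definition transfer_hom ::
  "('a, 'm) monoid_scheme \<Rightarrow> ('b, 'n) monoid_scheme \<Rightarrow> ('a \<Rightarrow> 'b) \<Rightarrow> bool" where
  "transfer_hom H B \<theta> \<longleftrightarrow> monoid_hom H B \<theta> \<and>
     carrier B = \<theta> ` carrier H <#>\<^bsub>B\<^esub> Units B \<and>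
     {a \<in> carrier H. \<theta> a \<in> Units B} = Units H \<and>
     (\<forall>u\<in>carrier H. \<forall>b\<in>carrier B. \<forall>c\<in>carrier B. \<theta> u = b \<otimes>\<^bsub>B\<^esub> c \<longrightarrow>
        (\<exists>v\<in>carrier H. \<exists>w\<in>carrier H. u = v \<otimes>\<^bsub>H\<^esub> w \<and>
           \<theta> v \<in> b <#\<^bsub>B\<^esub> Units B \<and> \<theta> w \<in> c <#\<^bsub>B\<^esub> Units B))"


section \<open>Krull monoids and class groups\<close>

definition divisor_hom ::
  "('a, 'm) monoid_scheme \<Rightarrow> ('b, 'n) monoid_scheme \<Rightarrow> ('a \<Rightarrow> 'b) \<Rightarrow> bool" where
  "divisor_hom H D \<phi> \<longleftrightarrow> monoid_hom H D \<phi> \<and>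
     (\<forall>a\<in>carrier H. \<forall>b\<in>carrier H. \<phi> a divides\<^bsub>D\<^esub> \<phi> b \<longrightarrow> a divides\<^bsub>H\<^esub> b)"

definition is_gcd_of :: "('a, 'm) monoid_scheme \<Rightarrow> 'a \<Rightarrow> 'a set \<Rightarrow> bool" where
  "is_gcd_of D d S \<longleftrightarrow> d \<in> carrier D \<and> (\<forall>x\<in>S. d divides\<^bsub>D\<^esub> x) \<and>
     (\<forall>c\<in>carrier D. (\<forall>x\<in>S. c divides\<^bsub>D\<^esub> x) \<longrightarrow> c divides\<^bsub>D\<^esub> d)"

definition divisor_theory ::
  "('a, 'm) monoid_scheme \<Rightarrow> 'p set \<Rightarrow> ('a \<Rightarrow> 'p multiset) \<Rightarrow> bool" where
  "divisor_theory H P \<phi> \<longleftrightarrow> divisor_hom H (free_monoid P) \<phi> \<and>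
     (\<forall>d\<in>carrier (free_monoid P).
        \<exists>A. finite A \<and> A \<noteq> {} \<and> A \<subseteq> carrier H \<and> is_gcd_of (free_monoid P) d (\<phi> ` A))"

text \<open>HOL cannot quantify over the type of the prime divisors inside a definition, so they are
  taken from \<open>'a set\<close>. This is no restriction, since a prime divisor \<open>p\<close> is determined by
  \<open>{a \<in> carrier H. p \<in># \<phi> a}\<close>; see \<open>krull_monoidI\<close> below.\<close>

definition krull_monoid :: "('a, 'm) monoid_scheme \<Rightarrow> bool" where
  "krull_monoid H \<longleftrightarrow> comm_monoid_cancel H \<and>
     (\<exists>(P :: 'a set set) \<phi>. divisor_theory H P \<phi>)"

lemma divides_free_monoid:
  assumes "set_mset M \<subseteq> P" "set_mset N \<subseteq> P"
  shows "M divides\<^bsub>free_monoid P\<^esub> N \<longleftrightarrow> M \<subseteq># N"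
proof
  assume "M divides\<^bsub>free_monoid P\<^esub> N"
  then show "M \<subseteq># N" by (auto simp: factor_def free_monoid_def)
next
  assume "M \<subseteq># N"
  then obtain K where "N = M + K" by (auto simp: subset_mset.le_iff_add)
  then show "M divides\<^bsub>free_monoid P\<^esub> N"
    using assms by (auto simp: factor_def free_monoid_def)
qed

lemma krull_monoidI:
  fixes H :: "('a, 'm) monoid_scheme" and P :: "'p set"
  assumes "comm_monoid_cancel H" and dt: "divisor_theory H P \<phi>"
  shows "krull_monoid H"
proof -
  define f where "f p = {a \<in> carrier H. p \<in># \<phi> a}" for p
  let ?F = "free_monoid P" and ?F' = "free_monoid (f ` P)"
  have hom: "\<phi> \<in> hom H ?F" and one: "\<phi> \<one>\<^bsub>H\<^esub> = {#}"
    and dvd: "\<And>a b. \<lbrakk>a \<in> carrier H; b \<in> carrier H; \<phi> a divides\<^bsub>?F\<^esub> \<phi> b\<rbrakk> \<Longrightarrow> a divides\<^bsub>H\<^esub> b"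
    and gcd: "\<And>d. d \<in> carrier ?F \<Longrightarrow>
      \<exists>A. finite A \<and> A \<noteq> {} \<and> A \<subseteq> carrier H \<and> is_gcd_of ?F d (\<phi> ` A)"
    using dt by (auto simp: divisor_theory_def divisor_hom_def monoid_hom_def free_monoid_def)
  have carr: "carrier (free_monoid Q) = {M. set_mset M \<subseteq> Q}" for Q :: "'x set"
    by (simp add: free_monoid_def)
  have im: "set_mset (\<phi> a) \<subseteq> P" if "a \<in> carrier H" for a
    using hom that by (auto simp: hom_def Pi_def free_monoid_def)
  have inj: "inj_on f P"
  proof (rule inj_onI)
    fix p q assume p: "p \<in> P" and q: "q \<in> P" and eq: "f p = f q"
    have "{#p#} \<in> carrier ?F" using p by (simp add: carr)
    from gcd[OF this] obtain A where A: "A \<subseteq> carrier H" "is_gcd_of ?F {#p#} (\<phi> ` A)" by blast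
    have "{#q#} divides\<^bsub>?F\<^esub> \<phi> a" if "a \<in> A" for a
    proof -
      have "a \<in> carrier H" using A(1) that by blast
      moreover have "{#p#} divides\<^bsub>?F\<^esub> \<phi> a" using A(2) that by (auto simp: is_gcd_of_def)
      ultimately have "a \<in> f p" using im p by (simp add: f_def divides_free_monoid)
      then have "q \<in># \<phi> a" using eq unfolding f_def by blast
      then show ?thesis using im[OF \<open>a \<in> carrier H\<close>] q by (simp add: divides_free_monoid)
    qed
    moreover have "{#q#} \<in> carrier ?F" using q by (simp add: carr)
    ultimately have "{#q#} divides\<^bsub>?F\<^esub> {#p#}" using A(2) by (auto simp: is_gcd_of_def)
    then show "p = q" using p q by (simp add: divides_free_monoid)
  qed
  have f_back: "image_mset (inv_into P f) (image_mset f M) = M" if "set_mset M \<subseteq> P" for M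
  proof -
    have "image_mset (\<lambda>x. inv_into P f (f x)) M = image_mset (\<lambda>x. x) M"
      by (rule image_mset_cong) (use that inj in auto)
    then show ?thesis by (simp add: image_mset.compositionality comp_def)
  qed
  have f_forth: "\<exists>M. set_mset M \<subseteq> P \<and> N = image_mset f M" if "set_mset N \<subseteq> f ` P" for N
  proof (intro exI conjI)
    show "set_mset (image_mset (inv_into P f) N) \<subseteq> P"
      using that by (auto intro: inv_into_into)
    have "image_mset (\<lambda>x. f (inv_into P f x)) N = image_mset (\<lambda>x. x) N"
      by (rule image_mset_cong) (use that in \<open>metis f_inv_into_f subsetD\<close>)
    then show "N = image_mset f (image_mset (inv_into P f) N)"
      by (simp add: image_mset.compositionality comp_def)
  qed
  have dvd_iff: "image_mset f M divides\<^bsub>?F'\<^esub> image_mset f N \<longleftrightarrow> M divides\<^bsub>?F\<^esub> N"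
    if "set_mset M \<subseteq> P" "set_mset N \<subseteq> P" for M N
  proof -
    have "image_mset f M divides\<^bsub>?F'\<^esub> image_mset f N \<longleftrightarrow> image_mset f M \<subseteq># image_mset f N"
      using that by (intro divides_free_monoid) auto
    also have "\<dots> \<longleftrightarrow> M \<subseteq># N"
      using f_back that by (metis image_mset_subseteq_mono)
    also have "\<dots> \<longleftrightarrow> M divides\<^bsub>?F\<^esub> N" using that by (simp add: divides_free_monoid)
    finally show ?thesis .
  qed
  have "divisor_theory H (f ` P) (image_mset f \<circ> \<phi>)"
    unfolding divisor_theory_def divisor_hom_def monoid_hom_def
  proof (intro conjI ballI impI)
    show "image_mset f \<circ> \<phi> \<in> hom H ?F'"
      using hom im by (auto simp: hom_def free_monoid_def Pi_def intro!: imageI dest: subsetD)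
    show "(image_mset f \<circ> \<phi>) \<one>\<^bsub>H\<^esub> = \<one>\<^bsub>?F'\<^esub>" by (simp add: one free_monoid_def)
  next
    fix a b assume "a \<in> carrier H" "b \<in> carrier H"
      "(image_mset f \<circ> \<phi>) a divides\<^bsub>?F'\<^esub> (image_mset f \<circ> \<phi>) b"
    then show "a divides\<^bsub>H\<^esub> b" using dvd im dvd_iff by simp
  next
    fix d assume d: "d \<in> carrier ?F'"
    then have "set_mset d \<subseteq> f ` P" by (simp add: carr)
    from f_forth[OF this] obtain M where M: "set_mset M \<subseteq> P" "d = image_mset f M" by blast
    have "M \<in> carrier ?F" using M(1) by (simp add: carr)
    from gcd[OF this] obtain A
      where A: "finite A" "A \<noteq> {}" "A \<subseteq> carrier H" "is_gcd_of ?F M (\<phi> ` A)" by blast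
    have "is_gcd_of ?F' d ((image_mset f \<circ> \<phi>) ` A)"
      unfolding is_gcd_of_def
    proof (intro conjI ballI impI)
      show "d \<in> carrier ?F'" by (rule d)
    next
      fix x assume "x \<in> (image_mset f \<circ> \<phi>) ` A"
      then obtain a where a: "a \<in> A" "x = image_mset f (\<phi> a)" by auto
      then have "M divides\<^bsub>?F\<^esub> \<phi> a" using A(4) by (simp add: is_gcd_of_def)
      moreover have "set_mset (\<phi> a) \<subseteq> P" using a A(3) im by blast
      ultimately show "d divides\<^bsub>?F'\<^esub> x"
        unfolding a(2) M(2) using dvd_iff[OF M(1)] by blast
    next
      fix c assume "c \<in> carrier ?F'"
      then have "set_mset c \<subseteq> f ` P" by (simp add: carr)
      from f_forth[OF this] obtain N where N: "set_mset N \<subseteq> P" "c = image_mset f N" by blast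
      assume c: "\<forall>x\<in>(image_mset f \<circ> \<phi>) ` A. c divides\<^bsub>?F'\<^esub> x"
      have "N divides\<^bsub>?F\<^esub> \<phi> a" if "a \<in> A" for a
      proof -
        have "set_mset (\<phi> a) \<subseteq> P" using that A(3) im by blast
        moreover have "image_mset f N divides\<^bsub>?F'\<^esub> image_mset f (\<phi> a)"
          using c that N(2) by simp
        ultimately show ?thesis using dvd_iff[OF N(1)] by blast
      qed
      moreover have "N \<in> carrier ?F" using N(1) by (simp add: carr)
      ultimately have "N divides\<^bsub>?F\<^esub> M" using A(4) by (simp add: is_gcd_of_def)
      then show "c divides\<^bsub>?F'\<^esub> d"
        unfolding N(2) M(2) using dvd_iff[OF N(1) M(1)] by blast
    qed
    with A show "\<exists>A. finite A \<and> A \<noteq> {} \<and> A \<subseteq> carrier H \<and>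
        is_gcd_of ?F' d ((image_mset f \<circ> \<phi>) ` A)" by blast
  qed
  with assms(1) show ?thesis unfolding krull_monoid_def by blast
qed

text \<open>The quotient group of \<open>free_monoid P\<close> is the group \<open>free_Abelian_group P\<close>, with the
  following embedding.\<close>

definition free_embed :: "'p multiset \<Rightarrow> 'p \<Rightarrow>\<^sub>0 int" where
  "free_embed M = (\<Sum>p\<in>#M. frag_of p)"

text \<open>Units of \<open>H\<close> are sent to the empty multiset, so \<open>H\<close> and \<open>red H\<close> have the same image
  in \<open>free_monoid P\<close>; this is the quotient group of that image.\<close>

definition principal_group ::
  "('a, 'm) monoid_scheme \<Rightarrow> ('a \<Rightarrow> 'p multiset) \<Rightarrow> ('p \<Rightarrow>\<^sub>0 int) set" where
  "principal_group H \<phi> =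
     {free_embed (\<phi> a) - free_embed (\<phi> b) | a b. a \<in> carrier H \<and> b \<in> carrier H}"

text \<open>The library's factor groups are multiplicative, so the class group is written
  multiplicatively.\<close>

definition class_group ::
  "('a, 'm) monoid_scheme \<Rightarrow> 'p set \<Rightarrow> ('a \<Rightarrow> 'p multiset) \<Rightarrow> ('p \<Rightarrow>\<^sub>0 int) set monoid" where
  "class_group H P \<phi> = free_Abelian_group P Mod principal_group H \<phi>"

definition divisor_class ::
  "('a, 'm) monoid_scheme \<Rightarrow> 'p set \<Rightarrow> ('a \<Rightarrow> 'p multiset) \<Rightarrow> 'p \<Rightarrow> ('p \<Rightarrow>\<^sub>0 int) set" where
  "divisor_class H P \<phi> p = principal_group H \<phi> #>\<^bsub>free_Abelian_group P\<^esub> frag_of p"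


section \<open>Abelian groups and zero-sum sequences\<close>

text \<open>\<open>T\<close> is the internal direct sum of the subgroups \<open>A i\<close>, for a finite index set \<open>I\<close>.\<close>

definition internal_direct_sum ::
  "('a, 'm) monoid_scheme \<Rightarrow> 'i set \<Rightarrow> ('i \<Rightarrow> 'a set) \<Rightarrow> 'a set \<Rightarrow> bool" where
  "internal_direct_sum G I A T \<longleftrightarrow> (\<forall>i\<in>I. subgroup (A i) G) \<and>
     bij_betw (\<lambda>x. \<Otimes>\<^bsub>G\<^esub>i\<in>I. x i) (\<Pi>\<^sub>E i\<in>I. A i) T"

definition independent_family ::
  "('a, 'm) monoid_scheme \<Rightarrow> 'i set \<Rightarrow> ('i \<Rightarrow> 'a) \<Rightarrow> bool" where
  "independent_family G I e \<longleftrightarrow> (\<forall>i\<in>I. e i \<in> carrier G \<and> e i \<noteq> \<one>\<^bsub>G\<^esub>) \<and>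
     internal_direct_sum G I (\<lambda>i. generate G {e i}) (generate G (e ` I))"

text \<open>By the convention of the library, \<open>group.ord G x = 0\<close> means that \<open>x\<close> has infinite order.\<close>

definition torsion_group :: "('a, 'm) monoid_scheme \<Rightarrow> bool" where
  "torsion_group G \<longleftrightarrow> (\<forall>x\<in>carrier G. group.ord G x \<noteq> 0)"

definition zero_sum_monoid :: "('a, 'm) monoid_scheme \<Rightarrow> 'a set \<Rightarrow> 'a multiset monoid" where
  "zero_sum_monoid G G\<^sub>0 = (free_monoid G\<^sub>0)
     \<lparr>carrier := {S \<in> carrier (free_monoid G\<^sub>0). mset_prod G S = \<one>\<^bsub>G\<^esub>}\<rparr>"

end

theory Submission
  imports Defs
begin

text \<open>A transfer homomorphism from \<open>H\<close> to a Krull monoid \<open>B\<close> preserves length-factoriality. In a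
  cancellative length-factorial monoid all relations between factorizations are powers of a single
  one, \<open>A = C\<close> with \<open>A\<close> and \<open>C\<close> disjoint multisets of atoms, and root closedness of \<open>B\<close> makes one
  side squarefree. Both sides have unique lifts to \<open>red H\<close>, so \<open>red H\<close> has a single generating
  relation \<open>u\<^sub>0 \<dots> u\<^sub>k = v\<^sub>0\<^bsup>s 0\<^esup> \<dots> v\<^sub>t\<^bsup>s t\<^esup>\<close> as well. The other atoms are the primes, and the
  monoid generated by the \<open>u\<^sub>i\<close> and \<open>v\<^sub>j\<close> has the divisor theory with prime divisors \<open>p\<^sub>i\<^sub>j\<close> in which
  \<open>u\<^sub>i\<close> is the product of the \<open>p\<^sub>i\<^sub>j\<^bsup>s j\<^esup>\<close> over \<open>j\<close> and \<open>v\<^sub>j\<close> the product of the \<open>p\<^sub>i\<^sub>j\<close> over \<open>i\<close>. Its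
  class group is the \<open>k\<close>-th power of the quotient of \<open>\<int>\<^bsup>t+1\<^esup>\<close> by \<open>(s 0, \<dots>, s t)\<close>; uniqueness of
  divisor theories carries this over to every other divisor theory.\<close>

section \<open>Products of multisets\<close>

text \<open>\<open>red H\<close> is not known to be cancellative at the start, so the relation is
  found in \<open>red B\<close>, where common factors cancel, and then carried back. Why one side is
  squarefree: if \<open>a = u u a'\<close> and \<open>b = v v b'\<close> have the same product
  \<open>x\<close>, then the square of \<open>u v\<close> divides \<open>x x\<close>, so
  \<open>u v\<close> divides \<open>x\<close>, and \<open>x\<close> has a factorization containing
  both \<open>u\<close> and \<open>v\<close>; no multiple of the relation leads from
  \<open>a\<close> to such a factorization. In the divisor theory both sides of the relation become
  the product of all \<open>p_ij\<close> to the power \<open>s_j\<close>. A divisor is thus a matrix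
  with k+1 rows and t+1 columns, and the principal divisors are the integer matrices with entries
  \<open>x_i s_j + y_j\<close>. The \<open>y_j\<close> serve to clear row 0; each of the rows 1 to k
  then counts modulo the vector \<open>s\<close>. The two sides have lengths k+1 and
  \<open>s_0 + ... + s_t\<close>. They differ because lengths separate factorizations, and in the
  case k = 1 this is what keeps the classes of the prime divisors distinct.\<close>

context comm_monoid
begin

lemma mset_prod_empty [simp]: "mset_prod G {#} = \<one>"
  by (simp add: mset_prod_def)

lemma mset_prod_closed [simp]: "set_mset M \<subseteq> carrier G \<Longrightarrow> mset_prod G M \<in> carrier G"
  unfolding mset_prod_def by (rule finprod_closed) auto

text \<open>Splitting off the whole power of \<open>x\<close>, even an empty one, turns the
  definition by a product over the support into the recursion \<open>mset_prod_add_mset\<close>;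
  later proofs only use induction on multisets.\<close>

lemma mset_prod_remove:
  assumes "x \<in> carrier G" "set_mset M \<subseteq> carrier G"
  shows "mset_prod G M = x [^] count M x \<otimes> (\<Otimes>y\<in>set_mset M - {x}. y [^] count M y)"
proof (cases "x \<in># M")
  case True
  then have *: "set_mset M = insert x (set_mset M - {x})" by blast
  have "mset_prod G M = (\<Otimes>y\<in>insert x (set_mset M - {x}). y [^] count M y)"
    unfolding mset_prod_def using * by simp
  also have "\<dots> = x [^] count M x \<otimes> (\<Otimes>y\<in>set_mset M - {x}. y [^] count M y)"
    by (rule finprod_insert) (use assms in auto)
  finally show ?thesis .
next
  case False
  then have "(\<Otimes>y\<in>set_mset M - {x}. y [^] count M y) = mset_prod G M"
    by (simp add: mset_prod_def)
  moreover have "count M x = 0" using False by (simp add: not_in_iff)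
  ultimately show ?thesis using assms by simp
qed

lemma mset_prod_add_mset [simp]:
  assumes "x \<in> carrier G" "set_mset M \<subseteq> carrier G"
  shows "mset_prod G (add_mset x M) = x \<otimes> mset_prod G M"
proof -
  have "(\<Otimes>y\<in>set_mset (add_mset x M) - {x}. y [^] count (add_mset x M) y) =
        (\<Otimes>y\<in>set_mset M - {x}. y [^] count M y)"
    by (rule finprod_cong') (use assms in auto)
  moreover have "(\<Otimes>y\<in>set_mset M - {x}. y [^] count M y) \<in> carrier G"
    by (rule finprod_closed) (use assms in auto)
  ultimately show ?thesis
    using mset_prod_remove[of x M] mset_prod_remove[of x "add_mset x M"] assms
    by (simp add: m_assoc m_lcomm nat_pow_mult del: nat_pow_Suc add: nat_pow_Suc2)
qed

lemma mset_prod_union [simp]: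
  assumes "set_mset M \<subseteq> carrier G" "set_mset N \<subseteq> carrier G"
  shows "mset_prod G (M + N) = mset_prod G M \<otimes> mset_prod G N"
  using assms by (induction M) (auto simp: m_assoc)

lemma mset_prod_submonoid:
  assumes "submonoid S G" "set_mset M \<subseteq> S"
  shows "mset_prod (G\<lparr>carrier := S\<rparr>) M = mset_prod G M"
proof -
  interpret S: comm_monoid "G\<lparr>carrier := S\<rparr>"
    by (rule submonoid_is_comm_monoid[OF assms(1)])
  have "S \<subseteq> carrier G" using assms(1) by (rule submonoid.subset)
  then show ?thesis
    using assms(2) by (induction M) (auto simp: subset_iff)
qed

lemma mset_prod_hom:
  assumes "comm_monoid K" "monoid_hom G K f" "set_mset M \<subseteq> carrier G"
  shows "f (mset_prod G M) = mset_prod K (image_mset f M)"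
proof -
  interpret K: comm_monoid K by fact
  have f: "f \<in> hom G K" "f \<one> = \<one>\<^bsub>K\<^esub>" using assms(2) by (auto simp: monoid_hom_def)
  have fc: "f x \<in> carrier K" if "x \<in> carrier G" for x using f(1) that by (auto simp: hom_def)
  show ?thesis using assms(3)
  proof (induction M)
    case (add x M)
    then have "set_mset (image_mset f M) \<subseteq> carrier K" by (auto intro!: fc)
    with add show ?case using hom_mult[OF f(1)] fc by simp
  qed (simp add: f)
qed

end

section \<open>The associated reduced monoid\<close>

context comm_monoid
begin

text \<open>Only the unit is ever inverted, so the argument works in a monoid. Equality in
  \<open>red G\<close> thereby becomes a concrete equation in \<open>G\<close>.\<close>

lemma Units_rcoset_iff:
  assumes "a \<in> carrier G" "b \<in> carrier G"
  shows "Units G #> a = Units G #> b \<longleftrightarrow> (\<exists>u\<in>Units G. a = u \<otimes> b)"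
proof
  assume "Units G #> a = Units G #> b"
  moreover have "a \<in> Units G #> a" using assms by (auto simp: r_coset_def intro!: bexI[of _ \<one>])
  ultimately show "\<exists>u\<in>Units G. a = u \<otimes> b" by (auto simp: r_coset_def)
next
  assume "\<exists>u\<in>Units G. a = u \<otimes> b"
  then obtain u where u: "u \<in> Units G" "a = u \<otimes> b" by blast
  have uc: "u \<in> carrier G" using u by auto
  have b: "b = inv u \<otimes> a" using u uc assms by (simp add: m_assoc[symmetric])
  show "Units G #> a = Units G #> b"
  proof (intro equalityI subsetI)
    fix x assume "x \<in> Units G #> a"
    then obtain v where v: "v \<in> Units G" "x = v \<otimes> a" by (auto simp: r_coset_def)
    then have "x = (v \<otimes> u) \<otimes> b" "v \<otimes> u \<in> Units G"
      using u uc assms by (auto simp: m_assoc)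
    then show "x \<in> Units G #> b" by (auto simp: r_coset_def)
  next
    fix x assume "x \<in> Units G #> b"
    then obtain v where v: "v \<in> Units G" "x = v \<otimes> b" by (auto simp: r_coset_def)
    then have "x = v \<otimes> (inv u \<otimes> a)" using b by metis
    then have "x = (v \<otimes> inv u) \<otimes> a"
      using u(1) v(1) uc assms by (simp add: m_assoc Units_closed)
    moreover have "v \<otimes> inv u \<in> Units G" using u v by auto
    ultimately show "x \<in> Units G #> a" by (auto simp: r_coset_def)
  qed
qed

lemma l_coset_Units: "a \<in> carrier G \<Longrightarrow> a <# Units G = Units G #> a"
  unfolding l_coset_def r_coset_def by (rule SUP_cong) (auto simp: m_comm Units_closed)

lemma Units_rcoset_mult:
  assumes "a \<in> carrier G" "b \<in> carrier G"
  shows "(Units G #> a) <#> (Units G #> b) = Units G #> (a \<otimes> b)"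
proof (intro equalityI subsetI)
  fix x assume "x \<in> (Units G #> a) <#> (Units G #> b)"
  then obtain u v where uv: "u \<in> Units G" "v \<in> Units G" and "x = (u \<otimes> a) \<otimes> (v \<otimes> b)"
    by (auto simp: set_mult_def r_coset_def)
  then have "x = (u \<otimes> v) \<otimes> (a \<otimes> b)"
    using assms Units_closed by (simp add: m_ac)
  with uv show "x \<in> Units G #> (a \<otimes> b)" unfolding r_coset_def by blast
next
  fix x assume "x \<in> Units G #> (a \<otimes> b)"
  then obtain u where "u \<in> Units G" "x = u \<otimes> (a \<otimes> b)" by (auto simp: r_coset_def)
  then have "x = (u \<otimes> a) \<otimes> (\<one> \<otimes> b)" "u \<in> Units G" "\<one> \<in> Units G"
    using assms Units_closed by (auto simp: m_ac)
  then show "x \<in> (Units G #> a) <#> (Units G #> b)" unfolding set_mult_def r_coset_def by blast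
qed

lemma carrier_red: "carrier (red G) = (\<lambda>a. Units G #> a) ` carrier G"
  by (auto simp: red_def carrier_FactGroup)

lemma mult_red:
  "\<lbrakk>a \<in> carrier G; b \<in> carrier G\<rbrakk> \<Longrightarrow>
    (Units G #> a) \<otimes>\<^bsub>red G\<^esub> (Units G #> b) = Units G #> (a \<otimes> b)"
  by (simp add: red_def Units_rcoset_mult)

lemma one_red: "\<one>\<^bsub>red G\<^esub> = Units G #> \<one>"
proof -
  have "Units G #> \<one> = Units G" by (auto simp: r_coset_def Units_closed)
  then show ?thesis by (simp add: red_def)
qed

lemma rcoset_closed_red [simp]: "a \<in> carrier G \<Longrightarrow> Units G #> a \<in> carrier (red G)"
  by (auto simp: carrier_red)

lemma comm_monoid_red: "comm_monoid (red G)"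
proof (rule comm_monoidI)
  fix x y z assume "x \<in> carrier (red G)" "y \<in> carrier (red G)" "z \<in> carrier (red G)"
  then show "(x \<otimes>\<^bsub>red G\<^esub> y) \<otimes>\<^bsub>red G\<^esub> z = x \<otimes>\<^bsub>red G\<^esub> (y \<otimes>\<^bsub>red G\<^esub> z)"
    by (auto simp: carrier_red mult_red m_assoc)
qed (auto simp: carrier_red mult_red m_comm one_red)

lemma monoid_hom_red: "monoid_hom G (red G) (\<lambda>a. Units G #> a)"
  by (auto simp: monoid_hom_def hom_def one_red mult_red)

lemma rcoset_eq_one_iff: "a \<in> carrier G \<Longrightarrow> Units G #> a = \<one>\<^bsub>red G\<^esub> \<longleftrightarrow> a \<in> Units G"
  using Units_closed by (auto simp: one_red Units_rcoset_iff intro!: bexI[of _ a])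

lemma reduced_red: "reduced (red G)"
proof -
  interpret R: comm_monoid "red G" by (rule comm_monoid_red)
  have "x = \<one>\<^bsub>red G\<^esub>" if "x \<in> Units (red G)" for x
  proof -
    from that obtain y where "x \<in> carrier (red G)" "y \<in> carrier (red G)"
      "x \<otimes>\<^bsub>red G\<^esub> y = \<one>\<^bsub>red G\<^esub>" by (auto simp: Units_def)
    then obtain a b where ab: "a \<in> carrier G" "b \<in> carrier G" "x = Units G #> a"
      "a \<otimes> b \<in> Units G"
      by (auto simp: carrier_red mult_red rcoset_eq_one_iff)
    then have "a \<in> Units G" using unit_factor by blast
    with ab show ?thesis by (simp add: rcoset_eq_one_iff)
  qed
  then show ?thesis by (auto simp: reduced_def)
qed

lemma divides_red_iff:
  assumes "a \<in> carrier G" "b \<in> carrier G"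
  shows "(Units G #> a) divides\<^bsub>red G\<^esub> (Units G #> b) \<longleftrightarrow> a divides b"
proof
  assume "(Units G #> a) divides\<^bsub>red G\<^esub> (Units G #> b)"
  then obtain c where "c \<in> carrier G" "Units G #> b = Units G #> (a \<otimes> c)"
    using assms by (auto simp: factor_def carrier_red mult_red)
  then obtain u where "u \<in> Units G" "b = u \<otimes> (a \<otimes> c)"
    using assms Units_rcoset_iff by auto
  then have "b = a \<otimes> (u \<otimes> c)" "u \<otimes> c \<in> carrier G"
    using \<open>c \<in> carrier G\<close> assms Units_closed by (auto simp: m_ac)
  then show "a divides b" by auto
next
  assume "a divides b"
  then obtain c where "c \<in> carrier G" "b = a \<otimes> c" by (auto simp: factor_def)
  then show "(Units G #> a) divides\<^bsub>red G\<^esub> (Units G #> b)"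
    using assms by (auto simp: factor_def mult_red[symmetric] intro!: bexI[of _ "Units G #> c"])
qed

end

text \<open>The element \<open>a\<close> can be eliminated because every product of atoms of
  \<open>red H\<close> is the coset of some \<open>a\<close>. What remains is two properties of
  \<open>red H\<close> alone, later called \<open>atomically_generated\<close> and
  \<open>size_separates\<close>.\<close>

lemma length_factorial_iff_red:
  assumes "comm_monoid H"
  shows "length_factorial H \<longleftrightarrow>
    (\<forall>x\<in>carrier (red H). \<exists>z. set_mset z \<subseteq> atoms (red H) \<and> mset_prod (red H) z = x) \<and>
    (\<forall>z z'. set_mset z \<subseteq> atoms (red H) \<and> set_mset z' \<subseteq> atoms (red H) \<and>
       mset_prod (red H) z = mset_prod (red H) z' \<and> size z = size z' \<longrightarrow> z = z')"
    (is "_ \<longleftrightarrow> ?A \<and> ?B")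
proof -
  interpret comm_monoid H by fact
  interpret R: comm_monoid "red H" by (rule comm_monoid_red)
  have fact: "factorizations H a =
      {z. set_mset z \<subseteq> atoms (red H) \<and> mset_prod (red H) z = Units H #>\<^bsub>H\<^esub> a}"
    if "a \<in> carrier H" for a
    using that by (auto simp: factorizations_def free_monoid_def l_coset_Units)
  have A: "atomic H \<longleftrightarrow> ?A"
    by (auto simp: atomic_def carrier_red fact)
  have B: "(\<forall>a\<in>carrier H. \<forall>z\<in>factorizations H a. \<forall>z'\<in>factorizations H a.
        z \<noteq> z' \<longrightarrow> size z \<noteq> size z') \<longleftrightarrow> ?B" (is "?C \<longleftrightarrow> _")
  proof
    assume C: ?C
    show ?B
    proof (intro allI impI)
      fix z z'
      assume z: "set_mset z \<subseteq> atoms (red H) \<and> set_mset z' \<subseteq> atoms (red H) \<and>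
        mset_prod (red H) z = mset_prod (red H) z' \<and> size z = size z'"
      then have "set_mset z \<subseteq> carrier (red H)" by (auto simp: atoms_def)
      then have "mset_prod (red H) z \<in> carrier (red H)" by simp
      then obtain a where "a \<in> carrier H" "mset_prod (red H) z = Units H #>\<^bsub>H\<^esub> a"
        by (auto simp: carrier_red)
      with C z show "z = z'" by (metis (mono_tags, lifting) fact mem_Collect_eq)
    qed
  next
    assume B: ?B
    show ?C
    proof (intro ballI impI notI)
      fix a z z' assume "a \<in> carrier H" "z \<in> factorizations H a" "z' \<in> factorizations H a"
        "z \<noteq> z'" "size z = size z'"
      with B show False by (auto simp: fact)
    qed
  qed
  show ?thesis unfolding length_factorial_def A B ..
qed

context comm_monoid
begin

text \<open>Length-factoriality is defined through \<open>red G\<close> even if \<open>G\<close> is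
  reduced already. This identification with singletons allows it to be checked in \<open>G\<close>
  itself, as is done for the direct factor of \<open>red H\<close> later.\<close>

lemma iso_red:
  assumes "reduced G"
  shows "(\<lambda>a. {a}) \<in> iso G (red G)"
proof -
  have *: "Units G #> a = {a}" if "a \<in> carrier G" for a
    using assms that by (auto simp: reduced_def r_coset_def)
  have "monoid_hom G (red G) (\<lambda>a. Units G #> a)" by (rule monoid_hom_red)
  then have "(\<lambda>a. {a}) \<in> hom G (red G)"
    using * by (auto simp: monoid_hom_def hom_def) (metis (mono_tags) rcoset_closed_red)
  moreover have "carrier (red G) = (\<lambda>a. {a}) ` carrier G" using * by (auto simp: carrier_red)
  ultimately show ?thesis by (auto simp: iso_def bij_betw_def)
qed

lemma atoms_red:
  assumes "reduced G"
  shows "atoms (red G) = (\<lambda>a. {a}) ` atoms G"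
proof -
  interpret R: comm_monoid "red G" by (rule comm_monoid_red)
  have iso: "(\<lambda>a. {a}) \<in> iso G (red G)" using iso_red[OF assms] .
  have c: "carrier (red G) = (\<lambda>a. {a}) ` carrier G" using iso by (auto simp: iso_def bij_betw_def)
  have m: "{a} \<otimes>\<^bsub>red G\<^esub> {b} = {a \<otimes> b}" if "a \<in> carrier G" "b \<in> carrier G" for a b
    using iso that by (auto simp: iso_def hom_def)
  have one: "\<one>\<^bsub>red G\<^esub> = {\<one>}" using hom_one iso_red[OF assms] assms by (simp add: one_red reduced_def r_coset_def)
  have U: "Units (red G) = {{\<one>}}" using reduced_red one by (simp add: reduced_def)
  have U': "Units G = {\<one>}" using assms by (simp add: reduced_def)
  show ?thesis
    by (auto simp: atoms_def U U' c m)
qed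

lemma length_factorial_reducedI:
  assumes "reduced G"
    and A: "\<And>x. x \<in> carrier G \<Longrightarrow> \<exists>z. set_mset z \<subseteq> atoms G \<and> mset_prod G z = x"
    and B: "\<And>z z'. \<lbrakk>set_mset z \<subseteq> atoms G; set_mset z' \<subseteq> atoms G;
        mset_prod G z = mset_prod G z'; size z = size z'\<rbrakk> \<Longrightarrow> z = z'"
  shows "length_factorial G"
  unfolding length_factorial_iff_red[OF comm_monoid_axioms]
proof (intro conjI ballI allI impI)
  interpret R: comm_monoid "red G" by (rule comm_monoid_red)
  have iso: "(\<lambda>a. {a}) \<in> iso G (red G)" using iso_red[OF assms(1)] .
  have c: "carrier (red G) = (\<lambda>a. {a}) ` carrier G" using iso by (auto simp: iso_def bij_betw_def)
  have hom: "monoid_hom G (red G) (\<lambda>a. {a})"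
    using iso assms(1) one_red by (simp add: monoid_hom_def iso_def reduced_def r_coset_def)
  have sub: "atoms G \<subseteq> carrier G" by (auto simp: atoms_def)
  have prod: "mset_prod (red G) (image_mset (\<lambda>a. {a}) z) = {mset_prod G z}"
    if "set_mset z \<subseteq> atoms G" for z
    using mset_prod_hom[OF comm_monoid_red hom] that sub by auto
  {
    fix x assume "x \<in> carrier (red G)"
    then obtain a where a: "a \<in> carrier G" "x = {a}" by (auto simp: c)
    obtain z where "set_mset z \<subseteq> atoms G" "mset_prod G z = a" using A a(1) by blast
    then show "\<exists>z. set_mset z \<subseteq> atoms (red G) \<and> mset_prod (red G) z = x"
      by (intro exI[of _ "image_mset (\<lambda>a. {a}) z"])
        (auto simp: atoms_red[OF assms(1)] prod a(2))
  }
  {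
    fix z z'
    assume z: "set_mset z \<subseteq> atoms (red G) \<and> set_mset z' \<subseteq> atoms (red G) \<and>
        mset_prod (red G) z = mset_prod (red G) z' \<and> size z = size z'"
    have *: "\<exists>w. set_mset w \<subseteq> atoms G \<and> z = image_mset (\<lambda>a. {a}) w"
      if "set_mset z \<subseteq> atoms (red G)" for z
    proof (intro exI[of _ "image_mset the_elem z"] conjI)
      show "set_mset (image_mset the_elem z) \<subseteq> atoms G"
        using that by (auto simp: atoms_red[OF assms(1)])
      have "image_mset (\<lambda>x. {the_elem x}) z = image_mset (\<lambda>x. x) z"
        by (rule image_mset_cong) (use that in \<open>auto simp: atoms_red[OF assms(1)]\<close>)
      then show "z = image_mset (\<lambda>a. {a}) (image_mset the_elem z)"
        by (simp add: image_mset.compositionality comp_def)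
    qed
    obtain w w' where w: "set_mset w \<subseteq> atoms G" "z = image_mset (\<lambda>a. {a}) w"
      "set_mset w' \<subseteq> atoms G" "z' = image_mset (\<lambda>a. {a}) w'" using z * by metis
    with z prod have "w = w'" by (intro B) auto
    with w show "z = z'" by simp
  }
qed

end

text \<open>Between the reduced monoids all units in (T1) and (T2) disappear: the map is onto, only
  the identity maps to the identity, and factorizations of images lift exactly instead of up to
  units.\<close>

lemma transfer_hom_red:
  assumes "comm_monoid H" "comm_monoid B" "transfer_hom H B \<theta>"
  obtains \<tau> where "monoid_hom (red H) (red B) \<tau>"
    "carrier (red B) = \<tau> ` carrier (red H)"
    "\<And>x. \<lbrakk>x \<in> carrier (red H); \<tau> x = \<one>\<^bsub>red B\<^esub>\<rbrakk> \<Longrightarrow> x = \<one>\<^bsub>red H\<^esub>"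
    "\<And>x b c. \<lbrakk>x \<in> carrier (red H); b \<in> carrier (red B); c \<in> carrier (red B);
        \<tau> x = b \<otimes>\<^bsub>red B\<^esub> c\<rbrakk> \<Longrightarrow>
      \<exists>v\<in>carrier (red H). \<exists>w\<in>carrier (red H). x = v \<otimes>\<^bsub>red H\<^esub> w \<and> \<tau> v = b \<and> \<tau> w = c"
proof -
  interpret H: comm_monoid H by fact
  interpret B: comm_monoid B by fact
  have hom: "\<theta> \<in> hom H B" and one: "\<theta> \<one>\<^bsub>H\<^esub> = \<one>\<^bsub>B\<^esub>"
    and T1: "carrier B = \<theta> ` carrier H <#>\<^bsub>B\<^esub> Units B" "{a \<in> carrier H. \<theta> a \<in> Units B} = Units H"
    and T2: "\<And>u b c. \<lbrakk>u \<in> carrier H; b \<in> carrier B; c \<in> carrier B; \<theta> u = b \<otimes>\<^bsub>B\<^esub> c\<rbrakk> \<Longrightarrow>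
        (\<exists>v\<in>carrier H. \<exists>w\<in>carrier H. u = v \<otimes>\<^bsub>H\<^esub> w \<and>
           \<theta> v \<in> b <#\<^bsub>B\<^esub> Units B \<and> \<theta> w \<in> c <#\<^bsub>B\<^esub> Units B)"
    using assms(3) by (auto simp: transfer_hom_def monoid_hom_def)
  have cl [simp]: "\<theta> a \<in> carrier B" if "a \<in> carrier H" for a using hom that by (auto simp: hom_def)
  have mult: "\<theta> (a \<otimes>\<^bsub>H\<^esub> b) = \<theta> a \<otimes>\<^bsub>B\<^esub> \<theta> b" if "a \<in> carrier H" "b \<in> carrier H" for a b
    using hom that by (auto simp: hom_def)
  have unit: "a \<in> carrier H \<Longrightarrow> \<theta> a \<in> Units B \<longleftrightarrow> a \<in> Units H" for a using T1(2) by blast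
  let ?r = "\<lambda>a. Units H #>\<^bsub>H\<^esub> a" and ?s = "\<lambda>b. Units B #>\<^bsub>B\<^esub> b"
  \<comment> \<open>A representative of the coset is chosen; the next fact shows that the choice is
    immaterial, since \<open>\<theta>\<close> maps units to units.\<close>
  define \<tau> where
    "\<tau> = (\<lambda>S. Units B #>\<^bsub>B\<^esub> \<theta> (SOME a. a \<in> carrier H \<and> Units H #>\<^bsub>H\<^esub> a = S))"
  have \<tau>: "\<tau> (?r a) = ?s (\<theta> a)" if a: "a \<in> carrier H" for a
  proof -
    define a' where "a' = (SOME a'. a' \<in> carrier H \<and> ?r a' = ?r a)"
    have a': "a' \<in> carrier H \<and> ?r a' = ?r a" unfolding a'_def by (rule someI[of _ a]) (use a in auto)
    then obtain u where "u \<in> Units H" "a' = u \<otimes>\<^bsub>H\<^esub> a" using a H.Units_rcoset_iff by blast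
    then have "\<theta> a' = \<theta> u \<otimes>\<^bsub>B\<^esub> \<theta> a" "\<theta> u \<in> Units B" using a mult unit by (auto simp: H.Units_closed)
    then have "?s (\<theta> a') = ?s (\<theta> a)" using a a' B.Units_rcoset_iff[of "\<theta> a'" "\<theta> a"] cl by blast
    then show ?thesis by (simp add: \<tau>_def a'_def)
  qed
  have assoc: "?s x = ?s b" if "x \<in> b <#\<^bsub>B\<^esub> Units B" "b \<in> carrier B" for x b
  proof -
    from that obtain u where "u \<in> Units B" "x = u \<otimes>\<^bsub>B\<^esub> b"
      by (auto simp: B.l_coset_Units r_coset_def)
    then show ?thesis using that B.Units_rcoset_iff[of x b] B.Units_closed by auto
  qed
  show thesis
  proof (rule that[of \<tau>])
    show "monoid_hom (red H) (red B) \<tau>"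
      unfolding monoid_hom_def hom_def
      by (auto simp: H.carrier_red \<tau> H.mult_red B.mult_red mult H.one_red B.one_red one)
    show "carrier (red B) = \<tau> ` carrier (red H)"
    proof (intro equalityI subsetI)
      fix x assume "x \<in> carrier (red B)"
      then obtain b where b: "b \<in> carrier B" "x = ?s b" by (auto simp: B.carrier_red)
      then obtain a u where "a \<in> carrier H" "u \<in> Units B" "b = \<theta> a \<otimes>\<^bsub>B\<^esub> u"
        using T1(1) by (auto simp: set_mult_def)
      then have "x = ?s (\<theta> a)"
        using b B.Units_rcoset_iff[of b "\<theta> a"] B.m_comm B.Units_closed by auto
      then show "x \<in> \<tau> ` carrier (red H)" using \<tau> \<open>a \<in> carrier H\<close> by (auto simp: H.carrier_red)
    qed (auto simp: H.carrier_red \<tau>)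
  next
    fix x assume x: "x \<in> carrier (red H)" "\<tau> x = \<one>\<^bsub>red B\<^esub>"
    then obtain a where a: "a \<in> carrier H" "x = ?r a" by (auto simp: H.carrier_red)
    with x(2) have "a \<in> Units H" by (simp add: \<tau> B.rcoset_eq_one_iff unit)
    with a show "x = \<one>\<^bsub>red H\<^esub>" by (simp add: H.rcoset_eq_one_iff)
  next
    fix x b c
    assume "x \<in> carrier (red H)" "b \<in> carrier (red B)" "c \<in> carrier (red B)" "\<tau> x = b \<otimes>\<^bsub>red B\<^esub> c"
    then obtain a b' c' where *: "a \<in> carrier H" "b' \<in> carrier B" "c' \<in> carrier B"
      "x = ?r a" "b = ?s b'" "c = ?s c'" "?s (\<theta> a) = ?s (b' \<otimes>\<^bsub>B\<^esub> c')"
      by (auto simp: H.carrier_red B.carrier_red \<tau> B.mult_red)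
    then obtain u where u: "u \<in> Units B" "\<theta> a = u \<otimes>\<^bsub>B\<^esub> (b' \<otimes>\<^bsub>B\<^esub> c')"
      using B.Units_rcoset_iff[of "\<theta> a" "b' \<otimes>\<^bsub>B\<^esub> c'"] by auto
    then have eq: "\<theta> a = (u \<otimes>\<^bsub>B\<^esub> b') \<otimes>\<^bsub>B\<^esub> c'" using * B.Units_closed by (simp add: B.m_assoc)
    have ub: "u \<otimes>\<^bsub>B\<^esub> b' \<in> carrier B" "?s (u \<otimes>\<^bsub>B\<^esub> b') = ?s b'"
      using u * B.Units_closed B.Units_rcoset_iff[of "u \<otimes>\<^bsub>B\<^esub> b'" b'] by auto
    from T2[OF *(1) ub(1) *(3) eq] obtain v w where vw: "v \<in> carrier H" "w \<in> carrier H"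
      "a = v \<otimes>\<^bsub>H\<^esub> w" "\<theta> v \<in> (u \<otimes>\<^bsub>B\<^esub> b') <#\<^bsub>B\<^esub> Units B" "\<theta> w \<in> c' <#\<^bsub>B\<^esub> Units B" by blast
    have "?s (\<theta> v) = b" "?s (\<theta> w) = c" using assoc[OF vw(4) ub(1)] assoc[OF vw(5) *(3)] ub(2) * by auto
    then show "\<exists>v\<in>carrier (red H). \<exists>w\<in>carrier (red H). x = v \<otimes>\<^bsub>red H\<^esub> w \<and> \<tau> v = b \<and> \<tau> w = c"
      using vw * by (intro bexI[of _ "?r v"] bexI[of _ "?r w"]) (auto simp: \<tau> H.mult_red)
  qed
qed

text \<open>The property of Krull monoids that the argument uses is root closedness, in this form.\<close>

lemma krull_monoid_red:
  assumes "krull_monoid B"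
  shows "comm_monoid_cancel (red B)"
    and "\<lbrakk>x \<in> carrier (red B); y \<in> carrier (red B);
      (x \<otimes>\<^bsub>red B\<^esub> x) divides\<^bsub>red B\<^esub> (y \<otimes>\<^bsub>red B\<^esub> y)\<rbrakk> \<Longrightarrow> x divides\<^bsub>red B\<^esub> y"
proof -
  interpret B: comm_monoid_cancel B using assms by (simp add: krull_monoid_def)
  obtain P and \<phi> :: "_ \<Rightarrow> 'a set multiset" where dt: "divisor_theory B P \<phi>" using assms by (auto simp: krull_monoid_def)
  interpret R: comm_monoid "red B" by (rule B.comm_monoid_red)
  show "comm_monoid_cancel (red B)"
  proof (rule comm_monoid_cancelI)
    fix x y z assume "x \<in> carrier (red B)" "y \<in> carrier (red B)" "z \<in> carrier (red B)"
      and eq: "x \<otimes>\<^bsub>red B\<^esub> z = y \<otimes>\<^bsub>red B\<^esub> z"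
    then obtain a b c where *: "a \<in> carrier B" "b \<in> carrier B" "c \<in> carrier B"
      "x = Units B #>\<^bsub>B\<^esub> a" "y = Units B #>\<^bsub>B\<^esub> b" "z = Units B #>\<^bsub>B\<^esub> c"
      by (auto simp: B.carrier_red)
    then obtain u where u: "u \<in> Units B" "a \<otimes>\<^bsub>B\<^esub> c = u \<otimes>\<^bsub>B\<^esub> (b \<otimes>\<^bsub>B\<^esub> c)"
      using eq B.Units_rcoset_iff[of "a \<otimes>\<^bsub>B\<^esub> c" "b \<otimes>\<^bsub>B\<^esub> c"] by (auto simp: B.mult_red)
    then have "a \<otimes>\<^bsub>B\<^esub> c = (u \<otimes>\<^bsub>B\<^esub> b) \<otimes>\<^bsub>B\<^esub> c" using * B.Units_closed by (simp add: B.m_assoc)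
    then have "a = u \<otimes>\<^bsub>B\<^esub> b" using * u B.r_cancel B.Units_closed by (meson B.m_closed)
    then show "x = y" using * u B.Units_rcoset_iff by blast
  qed (rule R.comm_monoid_axioms)
  assume xy: "x \<in> carrier (red B)" "y \<in> carrier (red B)"
    and d: "(x \<otimes>\<^bsub>red B\<^esub> x) divides\<^bsub>red B\<^esub> (y \<otimes>\<^bsub>red B\<^esub> y)"
  obtain a b where *: "a \<in> carrier B" "b \<in> carrier B"
      "x = Units B #>\<^bsub>B\<^esub> a" "y = Units B #>\<^bsub>B\<^esub> b" using xy by (auto simp: B.carrier_red)
  then have "(a \<otimes>\<^bsub>B\<^esub> a) divides\<^bsub>B\<^esub> (b \<otimes>\<^bsub>B\<^esub> b)"
    using d by (simp add: B.mult_red B.divides_red_iff)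
  then obtain c where c: "c \<in> carrier B" "b \<otimes>\<^bsub>B\<^esub> b = (a \<otimes>\<^bsub>B\<^esub> a) \<otimes>\<^bsub>B\<^esub> c" by (auto simp: factor_def)
  have hom: "\<phi> \<in> hom B (free_monoid P)"
    and dv: "\<phi> a divides\<^bsub>free_monoid P\<^esub> \<phi> b \<Longrightarrow> a divides\<^bsub>B\<^esub> b"
    using dt * by (auto simp: divisor_theory_def divisor_hom_def monoid_hom_def)
  have im: "set_mset (\<phi> a) \<subseteq> P" if "a \<in> carrier B" for a
    using hom that by (auto simp: hom_def Pi_def free_monoid_def)
  have mult: "\<phi> (a \<otimes>\<^bsub>B\<^esub> b) = \<phi> a + \<phi> b" if "a \<in> carrier B" "b \<in> carrier B" for a b
    using hom that by (auto simp: hom_def Pi_def free_monoid_def)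
  have "\<phi> b + \<phi> b = \<phi> a + \<phi> a + \<phi> c" using c * by (simp flip: mult)
  then have "\<phi> a \<subseteq># \<phi> b"
    by (intro mset_subset_eqI) (metis (no_types, lifting) count_union add_le_mono le_add1 linorder_not_le add_less_mono)
  then have "a divides\<^bsub>B\<^esub> b" using dv im * by (simp add: divides_free_monoid)
  then show "x divides\<^bsub>red B\<^esub> y" using * by (simp add: B.divides_red_iff)
qed

section \<open>The generating relation of a length-factorial monoid\<close>

locale reduced_monoid = comm_monoid +
  assumes Units_eq: "Units G = {\<one>}"
begin

lemma atoms_closed: "set_mset z \<subseteq> atoms G \<Longrightarrow> set_mset z \<subseteq> carrier G"
  by (auto simp: atoms_def)

lemma atom_closed: "u \<in> atoms G \<Longrightarrow> u \<in> carrier G"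
  by (auto simp: atoms_def)

lemma atom_not_one: "u \<in> atoms G \<Longrightarrow> u \<noteq> \<one>"
  by (auto simp: atoms_def Units_eq)

lemma atom_factor:
  "\<lbrakk>a \<otimes> b \<in> atoms G; a \<in> carrier G; b \<in> carrier G\<rbrakk> \<Longrightarrow> a = \<one> \<or> b = \<one>"
  by (auto simp: atoms_def Units_eq)

lemma mult_eq_one: "\<lbrakk>a \<otimes> b = \<one>; a \<in> carrier G; b \<in> carrier G\<rbrakk> \<Longrightarrow> a = \<one>"
  using unit_factor[of a b] Units_eq by auto

lemma mset_prod_atoms_eq_one:
  assumes "set_mset z \<subseteq> atoms G" "mset_prod G z = \<one>"
  shows "z = {#}"
proof (cases z)
  case (add u w)
  then have "u \<otimes> mset_prod G w = \<one>" "u \<in> carrier G" "mset_prod G w \<in> carrier G"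
    using assms atoms_closed[of z] by auto
  then have "u = \<one>" by (rule mult_eq_one)
  with add assms atom_not_one show ?thesis by auto
qed

text \<open>Since atoms have no other factorization, a nontrivial relation cannot have a single atom
  on one side. This gives the length bound 2 for both sides of the generating relation.\<close>

lemma mset_prod_atoms_eq_atom:
  assumes "set_mset z \<subseteq> atoms G" "mset_prod G z = u" "u \<in> atoms G"
  shows "z = {#u#}"
proof (cases z)
  case empty
  then show ?thesis using assms atom_not_one by auto
next
  case (add v w)
  then have *: "v \<otimes> mset_prod G w = u" "v \<in> carrier G" "mset_prod G w \<in> carrier G"
    using assms atoms_closed[of z] by auto
  then have "v = \<one> \<or> mset_prod G w = \<one>" using atom_factor assms(3) by metis
  then have "mset_prod G w = \<one>" using add assms atom_not_one by auto
  then have "w = {#}" using mset_prod_atoms_eq_one[of w] add assms by auto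
  then show ?thesis using add * by simp
qed

end

definition atomically_generated :: "('a, 'm) monoid_scheme \<Rightarrow> bool" where
  "atomically_generated G \<longleftrightarrow>
    (\<forall>x\<in>carrier G. \<exists>z. set_mset z \<subseteq> atoms G \<and> mset_prod G z = x)"

definition size_separates :: "('a, 'm) monoid_scheme \<Rightarrow> bool" where
  "size_separates G \<longleftrightarrow>
    (\<forall>z z'. set_mset z \<subseteq> atoms G \<and> set_mset z' \<subseteq> atoms G \<and>
       mset_prod G z = mset_prod G z' \<and> size z = size z' \<longrightarrow> z = z')"

text \<open>In the free abelian group on the atoms this is \<open>z - z' = m (A - B)\<close>.
  Integer counts admit negative \<open>m\<close>, that is, use of the relation in the other
  direction.\<close>

definition multiple_diff :: "'a multiset \<Rightarrow> 'a multiset \<Rightarrow> 'a multiset \<Rightarrow> 'a multiset \<Rightarrow> int \<Rightarrow> bool" where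
  "multiple_diff A B z z' m \<longleftrightarrow>
    (\<forall>x. int (count z x) - int (count z' x) = m * (int (count A x) - int (count B x)))"

text \<open>The group of differences of factorizations with equal product is cyclic, generated by
  \<open>A - B\<close>. The pair of empty multisets encodes unique factorization.\<close>

definition generating_relation ::
  "('a, 'm) monoid_scheme \<Rightarrow> 'a multiset \<Rightarrow> 'a multiset \<Rightarrow> bool" where
  "generating_relation G A B \<longleftrightarrow>
    A \<inter># B = {#} \<and> set_mset A \<subseteq> atoms G \<and> set_mset B \<subseteq> atoms G \<and>
    (\<forall>z z'. set_mset z \<subseteq> atoms G \<and> set_mset z' \<subseteq> atoms G \<longrightarrow>
       mset_prod G z = mset_prod G z' \<longleftrightarrow> (\<exists>m. multiple_diff A B z z' m))"

lemma multiple_diff_swap: "multiple_diff A B z z' m \<longleftrightarrow> multiple_diff B A z z' (- m)"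
  by (simp add: multiple_diff_def algebra_simps)

lemma multiple_diff_sym: "multiple_diff A B z z' m \<longleftrightarrow> multiple_diff A B z' z (- m)"
  by (auto simp: multiple_diff_def algebra_simps)

lemma multiple_diff_add_right [simp]:
  "multiple_diff A B (z + w) (z' + w) m \<longleftrightarrow> multiple_diff A B z z' m"
  by (simp add: multiple_diff_def)

lemma generating_relation_swap: "generating_relation G A B \<Longrightarrow> generating_relation G B A"
  unfolding generating_relation_def
  by (metis multiple_diff_swap subset_mset.inf_commute)

lemma disjoint_mset_count: "A \<inter># B = {#} \<Longrightarrow> count A x = 0 \<or> count B x = 0"
  by (metis count_empty count_inter_mset min_def)

text \<open>At an atom of \<open>A\<close> the count in \<open>B\<close> is 0, so \<open>z\<close>
  must contain \<open>m\<close> copies of it for each occurrence in \<open>A\<close>. Hence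
  \<open>z'\<close> really arises from \<open>z\<close> by replacing \<open>m\<close> copies of
  \<open>A\<close> by \<open>m\<close> copies of \<open>B\<close>.\<close>

lemma multiple_diff_disjointD:
  assumes "A \<inter># B = {#}" "multiple_diff A B z z' (int m)"
  obtains c where "z = c + repeat_mset m A" "z' = c + repeat_mset m B"
proof
  have *: "int (count z x) - int (count z' x) = int m * (int (count A x) - int (count B x))" for x
    using assms(2) by (simp add: multiple_diff_def)
  have sub: "repeat_mset m A \<subseteq># z"
  proof (rule mset_subset_eqI)
    fix x show "count (repeat_mset m A) x \<le> count z x"
      using *[of x] disjoint_mset_count[OF assms(1), of x]
      by (auto simp flip: of_nat_mult)
  qed
  then show "z = (z - repeat_mset m A) + repeat_mset m A" by simp
  show "z' = (z - repeat_mset m A) + repeat_mset m B"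
  proof (rule multiset_eqI)
    fix x
    have "count z x \<ge> m * count A x" using mset_subset_eq_count[OF sub, of x] by simp
    then show "count z' x = count (z - repeat_mset m A + repeat_mset m B) x"
      using *[of x] by (simp add: of_nat_diff algebra_simps) (simp flip: of_nat_mult of_nat_add)
  qed
qed

lemma set_mset_repeat_mset_subset: "set_mset (repeat_mset m C) \<subseteq> set_mset C"
  by (auto simp flip: count_greater_zero_iff)

lemma (in comm_monoid) mset_prod_repeat_cong:
  assumes "set_mset A \<subseteq> carrier G" "set_mset B \<subseteq> carrier G" "mset_prod G A = mset_prod G B"
  shows "mset_prod G (repeat_mset m A) = mset_prod G (repeat_mset m B)"
proof (induction m)
  case (Suc m)
  have *: "set_mset (repeat_mset m C) \<subseteq> carrier G" if "set_mset C \<subseteq> carrier G" for C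
    using that set_mset_repeat_mset_subset by fast
  show ?case using Suc assms *[of A] *[of B] by simp
qed simp

lemma (in comm_monoid) multiple_diff_imp_eq:
  assumes "A \<inter># B = {#}" "set_mset A \<subseteq> carrier G" "set_mset B \<subseteq> carrier G"
    "mset_prod G A = mset_prod G B" "set_mset z \<subseteq> carrier G" "set_mset z' \<subseteq> carrier G"
    "multiple_diff A B z z' m"
  shows "mset_prod G z = mset_prod G z'"
proof -
  have *: "mset_prod G z = mset_prod G z'"
    if md: "multiple_diff A B z z' (int n)" and "set_mset z \<subseteq> carrier G" "set_mset z' \<subseteq> carrier G" for n z z'
  proof -
    obtain c where c: "z = c + repeat_mset n A" "z' = c + repeat_mset n B"
      using multiple_diff_disjointD[OF assms(1) md] by metis
    have "set_mset (repeat_mset n C) \<subseteq> carrier G" if "set_mset C \<subseteq> carrier G" for C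
      using that set_mset_repeat_mset_subset by fast
    then show ?thesis using that c assms mset_prod_repeat_cong[of A B n] by simp
  qed
  show ?thesis
  proof (cases "m \<ge> 0")
    case True
    with assms * show ?thesis by (metis nonneg_int_cases)
  next
    case False
    obtain n where "- m = int n" by (rule nonneg_int_cases[of "- m"]) (use False in auto)
    with assms * multiple_diff_sym show ?thesis by metis
  qed
qed

text \<open>A pair of coprime factorizations with the least positive length difference generates all
  relations: lengths separate factorizations, so division with remainder applies to length
  differences.\<close>

lemma (in reduced_monoid) ex_generating_relation:
  assumes cancel: "comm_monoid_cancel G" and sep: "size_separates G"
    and gen: "atomically_generated G"
    and root: "\<And>x y. \<lbrakk>x \<in> carrier G; y \<in> carrier G; (x \<otimes> x) divides (y \<otimes> y)\<rbrakk> \<Longrightarrow> x divides y"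
  obtains A B where "generating_relation G A B" "\<And>u. count A u \<le> 1"
    "A = {#} \<and> B = {#} \<or> size A \<ge> 2 \<and> size B \<ge> 2 \<and> size A \<noteq> size B"
proof -
  interpret comm_monoid_cancel G by fact
  define eqv where "eqv y y' \<longleftrightarrow> set_mset y \<subseteq> atoms G \<and> set_mset y' \<subseteq> atoms G \<and>
    mset_prod G y = mset_prod G y'" for y y'
  have eqv_size: "y = y'" if "eqv y y'" "size y = size y'" for y y'
    using sep that by (auto simp: size_separates_def eqv_def)
  have eqv_sym: "eqv y' y" if "eqv y y'" for y y' using that by (auto simp: eqv_def)
  show thesis
  proof (cases "\<forall>y y'. eqv y y' \<longrightarrow> size y = size y'")
    case True
    \<comment> \<open>If no two factorizations of an element differ in length, then separation by
      length makes factorizations unique, and the empty relation generates.\<close>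
    have "mset_prod G z = mset_prod G z' \<longleftrightarrow> (\<exists>m. multiple_diff {#} {#} z z' m)"
      if "set_mset z \<subseteq> atoms G \<and> set_mset z' \<subseteq> atoms G" for z z'
    proof -
      have "mset_prod G z = mset_prod G z' \<longleftrightarrow> z = z'"
        using True eqv_size[of z z'] that by (auto simp: eqv_def)
      then show ?thesis by (simp add: multiple_diff_def multiset_eq_iff)
    qed
    then have "generating_relation G {#} {#}"
      by (simp add: generating_relation_def)
    then show ?thesis by (rule that) auto
  next
    case False
    define Q where "Q d \<longleftrightarrow> d > 0 \<and> (\<exists>y y'. eqv y y' \<and> size y = size y' + d)" for d
    have "\<exists>d. Q d"
    proof -
      obtain y y' where "eqv y y'" "size y \<noteq> size y'" using False by blast
      then have "Q (size y - size y') \<or> Q (size y' - size y)"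
        using eqv_sym[of y y'] unfolding Q_def
        by (metis add_diff_inverse_nat less_imp_not_less linorder_neqE_nat zero_less_diff)
      then show ?thesis by blast
    qed
    define d where "d = (LEAST d. Q d)"
    have "Q d" unfolding d_def using \<open>\<exists>d. Q d\<close> by (rule LeastI_ex)
    have least: "d \<le> d'" if "Q d'" for d' unfolding d_def using that by (rule Least_le)
    have "d > 0" using \<open>Q d\<close> by (simp add: Q_def)
    obtain y y' where y: "eqv y y'" "size y = size y' + d" using \<open>Q d\<close> by (auto simp: Q_def)
    \<comment> \<open>The common part \<open>c\<close> is cancelled; the remaining disjoint sides
      still differ in length by \<open>d\<close>.\<close>
    define a b c where "a = y - y'" and "b = y' - y" and "c = y \<inter># y'"
    have yc: "y = c + a" "y' = c + b"
      unfolding a_def b_def c_def by (auto simp: multiset_eq_iff)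
    have disj: "a \<inter># b = {#}" unfolding a_def b_def by (auto simp: multiset_eq_iff)
    have sub: "set_mset a \<subseteq> atoms G" "set_mset b \<subseteq> atoms G" "set_mset c \<subseteq> atoms G"
      using y(1) yc by (auto simp: eqv_def)
    have "mset_prod G c \<otimes> mset_prod G a = mset_prod G c \<otimes> mset_prod G b"
      using y(1) sub atoms_closed by (simp add: yc eqv_def)
    then have ab: "mset_prod G a = mset_prod G b"
      by (rule l_cancel) (use sub atoms_closed in auto)
    have sab: "size a = size b + d" using y(2) yc by simp
    have key: "\<exists>m. multiple_diff a b y y' (int m)" if "eqv y y'" "size y = size y' + n" for n y y'
      using that
    proof (induction n arbitrary: y y' rule: less_induct)
      case (less n)
      show ?case
      proof (cases "n = 0")
        case True
        then have "y = y'" using less eqv_size by auto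
        then show ?thesis by (intro exI[of _ 0]) (simp add: multiple_diff_def)
      next
        case False
        then have "d \<le> n" using least less.prems by (auto simp: Q_def)
        \<comment> \<open>Adding the shorter side \<open>b\<close> to the longer factorization and
          \<open>a\<close> to the shorter one lowers the length difference from \<open>n\<close> to
          \<open>n - d\<close>; a difference strictly between 0 and \<open>d\<close> is excluded by
          minimality.\<close>
        have "eqv (y + b) (y' + a)"
          using less.prems(1) ab sub by (auto simp: eqv_def atoms_closed)
        moreover have "size (y + b) = size (y' + a) + (n - d)" using less.prems(2) sab \<open>d \<le> n\<close> by simp
        ultimately obtain m where "multiple_diff a b (y + b) (y' + a) (int m)"
          using less.IH[of "n - d"] \<open>d > 0\<close> \<open>d \<le> n\<close> by fastforce
        then have "multiple_diff a b y y' (int (Suc m))"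
          by (simp add: multiple_diff_def algebra_simps)
        then show ?thesis by blast
      qed
    qed
    have rel: "generating_relation G a b"
      unfolding generating_relation_def
    proof (intro conjI disj sub allI impI iffI)
      fix z z' assume z: "set_mset z \<subseteq> atoms G \<and> set_mset z' \<subseteq> atoms G"
      {
        assume "mset_prod G z = mset_prod G z'"
        with z have *: "eqv z z'" "eqv z' z" by (auto simp: eqv_def)
        show "\<exists>m. multiple_diff a b z z' m"
        proof (cases "size z \<ge> size z'")
          case True
          then show ?thesis using key[OF *(1), of "size z - size z'"] by auto
        next
          case False
          then obtain m where "multiple_diff a b z' z (int m)"
            using key[OF *(2), of "size z' - size z"] by auto
          then show ?thesis using multiple_diff_sym by blast
        qed
      }
      assume "\<exists>m. multiple_diff a b z z' m"
      then show "mset_prod G z = mset_prod G z'"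
        using multiple_diff_imp_eq[OF disj _ _ ab] sub z atoms_closed by metis
    qed
    have bs: "size b \<ge> 2"
    proof (rule ccontr)
      assume "\<not> size b \<ge> 2"
      then have "size b = 0 \<or> size b = 1" by linarith
      then consider "b = {#}" | v where "b = {#v#}" using size_1_singleton_mset by auto
      then show False
      proof cases
        case 1
        then have "a = {#}" using ab sub mset_prod_atoms_eq_one by simp
        then show False using sab \<open>d > 0\<close> by simp
      next
        case 2
        then have "v \<in> atoms G" "mset_prod G a = v" using ab sub atom_closed by auto
        then have "a = {#v#}" using sub mset_prod_atoms_eq_atom by blast
        then show False using sab \<open>d > 0\<close> 2 by simp
      qed
    qed
    have sqfree: "(\<forall>u. count a u \<le> 1) \<or> (\<forall>u. count b u \<le> 1)"
    proof (rule ccontr)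
      assume "\<not> ?thesis"
      then obtain u v where uv: "count a u \<ge> 2" "count b v \<ge> 2"
        by (metis less_one linorder_not_less nat_less_le one_add_one plus_1_eq_Suc Suc_leI not_less_eq_eq)
      have "{#u, u#} \<subseteq># a" "{#v, v#} \<subseteq># b"
        using uv by (auto intro!: mset_subset_eqI)
      then obtain a' b' where a': "a = {#u, u#} + a'" and b': "b = {#v, v#} + b'"
        by (metis subset_mset.le_iff_add)
      have c: "u \<in> carrier G" "v \<in> carrier G" "set_mset a' \<subseteq> carrier G" "set_mset b' \<subseteq> carrier G"
        using sub atoms_closed[of a] atoms_closed[of b] a' b' by auto
      \<comment> \<open>The square of the common product of \<open>a\<close> and \<open>b\<close>
        contains the square of \<open>u \<otimes> v\<close>, so by \<open>root\<close> the product
        itself is divisible by \<open>u \<otimes> v\<close>, although \<open>u\<close> occurs only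
        in \<open>a\<close> and \<open>v\<close> only in \<open>b\<close>.\<close>
      have "mset_prod G a \<otimes> mset_prod G a = mset_prod G a \<otimes> mset_prod G b" using ab by simp
      also have "\<dots> = ((u \<otimes> v) \<otimes> (u \<otimes> v)) \<otimes> (mset_prod G a' \<otimes> mset_prod G b')"
        unfolding a' b' using c by (simp add: m_ac)
      finally have "((u \<otimes> v) \<otimes> (u \<otimes> v)) divides (mset_prod G a \<otimes> mset_prod G a)"
        using c by auto
      then have "(u \<otimes> v) divides mset_prod G a"
        using root[of "u \<otimes> v" "mset_prod G a"] c sub atoms_closed by simp
      then obtain x where "x \<in> carrier G" "mset_prod G a = (u \<otimes> v) \<otimes> x" by (auto simp: factor_def)
      moreover from this obtain w where w: "set_mset w \<subseteq> atoms G" "mset_prod G w = x"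
        using gen by (auto simp: atomically_generated_def)
      ultimately have eq: "mset_prod G a = mset_prod G ({#u, v#} + w)"
        using c atoms_closed[of w] by (simp add: m_assoc)
      have "set_mset ({#u, v#} + w) \<subseteq> atoms G" using a' b' sub w by auto
      then obtain m where m: "multiple_diff a b a ({#u, v#} + w) m"
        using eq rel sub unfolding generating_relation_def by blast
      have d: "count b u = 0" "count a v = 0" "u \<noteq> v"
        using disjoint_mset_count[OF disj] uv by (metis not_numeral_le_zero)+
      \<comment> \<open>The new factorization still contains \<open>u\<close>, which forces
        \<open>m < 1\<close>, and it contains \<open>v\<close>, which \<open>a\<close> does not,
        which forces \<open>m > 0\<close>.\<close>
      have "int (count a u) - int (1 + count w u) = m * int (count a u)"
        using m[unfolded multiple_diff_def, rule_format, of u] d by simp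
      then have "m * int (count a u) < 1 * int (count a u)" by simp
      then have "m < 1" unfolding mult_less_cancel_right by simp
      have "- int (1 + count w v) = m * (- int (count b v))"
        using m[unfolded multiple_diff_def, rule_format, of v] d by simp
      then have "m * int (count b v) > 0" by simp
      then have "m > 0" by (simp add: zero_less_mult_iff)
      with \<open>m < 1\<close> show False by simp
    qed
    show ?thesis
    proof (cases "\<forall>u. count a u \<le> 1")
      case True
      with rel bs sab \<open>d > 0\<close> show ?thesis by (intro that[of a b]) auto
    next
      case False
      with rel bs sab \<open>d > 0\<close> sqfree generating_relation_swap show ?thesis
        by (intro that[of b a]) auto
    qed
  qed
qed

text \<open>A preimage of a sum of multisets splits along the sum, so uniqueness of the lift of
  \<open>a\<close> passes to its multiples. Restricting the hypothesis to
  \<open>w \<subseteq># z\<close> lets it inherit side conditions on \<open>z\<close>, such as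
  consisting of atoms.\<close>

lemma image_mset_eq_repeatD:
  assumes "image_mset f z = repeat_mset m a" "\<And>w. \<lbrakk>image_mset f w = a; w \<subseteq># z\<rbrakk> \<Longrightarrow> w = A"
  shows "z = repeat_mset m A"
  using assms
proof (induction m arbitrary: z)
  case (Suc m)
  then have "image_mset f z = a + repeat_mset m a" by simp
  then obtain u v where uv: "z = u + v" "a = image_mset f u" "repeat_mset m a = image_mset f v"
    by (metis image_mset_eq_plusD)
  then have "u = A" using Suc.prems(2)[of u] by simp
  moreover have "v = repeat_mset m A"
  proof (rule Suc.IH)
    fix w assume "image_mset f w = a" "w \<subseteq># v"
    then show "w = A" using Suc.prems(2)[of w] uv subset_mset.order_trans[of w v z] by simp
  qed (use uv in simp)
  ultimately show ?case using uv by simp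
qed simp

section \<open>Lifting factorizations and relations along a transfer homomorphism\<close>

locale reduced_transfer = reduced_monoid R + S: reduced_monoid S
  for R (structure) and S (structure) +
  fixes \<tau>
  assumes hom: "monoid_hom R S \<tau>"
    and surj: "carrier S = \<tau> ` carrier R"
    and eq_oneD: "\<lbrakk>x \<in> carrier R; \<tau> x = \<one>\<^bsub>S\<^esub>\<rbrakk> \<Longrightarrow> x = \<one>\<^bsub>R\<^esub>"
    and lift_mult: "\<lbrakk>x \<in> carrier R; b \<in> carrier S; c \<in> carrier S; \<tau> x = b \<otimes>\<^bsub>S\<^esub> c\<rbrakk> \<Longrightarrow>
      \<exists>v\<in>carrier R. \<exists>w\<in>carrier R. x = v \<otimes>\<^bsub>R\<^esub> w \<and> \<tau> v = b \<and> \<tau> w = c"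
begin

lemma map_closed [simp]: "x \<in> carrier R \<Longrightarrow> \<tau> x \<in> carrier S"
  using hom by (auto simp: monoid_hom_def hom_def)

lemma map_mult: "\<lbrakk>x \<in> carrier R; y \<in> carrier R\<rbrakk> \<Longrightarrow> \<tau> (x \<otimes>\<^bsub>R\<^esub> y) = \<tau> x \<otimes>\<^bsub>S\<^esub> \<tau> y"
  using hom by (auto simp: monoid_hom_def hom_def)

lemma map_one: "\<tau> \<one>\<^bsub>R\<^esub> = \<one>\<^bsub>S\<^esub>"
  using hom by (auto simp: monoid_hom_def)

lemma atom_iff: "u \<in> carrier R \<Longrightarrow> \<tau> u \<in> atoms S \<longleftrightarrow> u \<in> atoms R"
proof
  assume u: "u \<in> carrier R" "\<tau> u \<in> atoms S"
  then have "u \<noteq> \<one>\<^bsub>R\<^esub>" using S.atom_not_one map_one by auto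
  moreover have "a = \<one>\<^bsub>R\<^esub> \<or> b = \<one>\<^bsub>R\<^esub>" if "a \<in> carrier R" "b \<in> carrier R" "u = a \<otimes>\<^bsub>R\<^esub> b" for a b
    using S.atom_factor[of "\<tau> a" "\<tau> b"] that u map_mult eq_oneD by auto
  ultimately show "u \<in> atoms R" using u by (auto simp: atoms_def Units_eq)
next
  assume u: "u \<in> carrier R" "u \<in> atoms R"
  then have "\<tau> u \<noteq> \<one>\<^bsub>S\<^esub>" using atom_not_one eq_oneD by auto
  moreover have "b = \<one>\<^bsub>S\<^esub> \<or> c = \<one>\<^bsub>S\<^esub>"
    if bc: "b \<in> carrier S" "c \<in> carrier S" "\<tau> u = b \<otimes>\<^bsub>S\<^esub> c" for b c
  proof -
    obtain v w where "v \<in> carrier R" "w \<in> carrier R" "u = v \<otimes>\<^bsub>R\<^esub> w" "\<tau> v = b" "\<tau> w = c"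
      using lift_mult[OF u(1) bc] by blast
    moreover from this have "v = \<one>\<^bsub>R\<^esub> \<or> w = \<one>\<^bsub>R\<^esub>" using atom_factor u by auto
    ultimately show ?thesis using map_one by auto
  qed
  ultimately show "\<tau> u \<in> atoms S" using u by (auto simp: atoms_def S.Units_eq)
qed

lemma map_prod: "set_mset z \<subseteq> carrier R \<Longrightarrow> \<tau> (mset_prod R z) = mset_prod S (image_mset \<tau> z)"
  by (rule mset_prod_hom[OF S.comm_monoid_axioms hom])

lemma map_atoms: "set_mset z \<subseteq> atoms R \<Longrightarrow> set_mset (image_mset \<tau> z) \<subseteq> atoms S"
  using atom_iff atom_closed by auto

text \<open>\<open>lift_mult\<close> is iterated, splitting off one atom at a time; by
  \<open>atom_iff\<close> the preimage of the atom split off is an atom.\<close>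

lemma lift_factorization:
  assumes "x \<in> carrier R" "\<tau> x = mset_prod S y" "set_mset y \<subseteq> atoms S"
  obtains z where "set_mset z \<subseteq> atoms R" "image_mset \<tau> z = y" "mset_prod R z = x"
proof -
  have "\<exists>z. set_mset z \<subseteq> atoms R \<and> image_mset \<tau> z = y \<and> mset_prod R z = x"
    using assms
  proof (induction y arbitrary: x)
    case empty
    then show ?case using eq_oneD by (intro exI[of _ "{#}"]) auto
  next
    case (add s y)
    have sy: "s \<in> carrier S" "set_mset y \<subseteq> carrier S" "set_mset y \<subseteq> atoms S" "s \<in> atoms S"
      using add.prems S.atoms_closed[of y] S.atom_closed by auto
    then have "\<tau> x = s \<otimes>\<^bsub>S\<^esub> mset_prod S y" using add.prems by simp
    then obtain v w where vw: "v \<in> carrier R" "w \<in> carrier R" "x = v \<otimes>\<^bsub>R\<^esub> w" "\<tau> v = s" "\<tau> w = mset_prod S y"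
      using lift_mult[of x s "mset_prod S y"] sy add.prems by auto
    then have "v \<in> atoms R" using atom_iff sy by blast
    obtain z where z: "set_mset z \<subseteq> atoms R" "image_mset \<tau> z = y" "mset_prod R z = w"
      using add.IH[OF vw(2,5) sy(3)] by blast
    show ?case
      using z vw \<open>v \<in> atoms R\<close> atoms_closed[of z] by (intro exI[of _ "add_mset v z"]) simp
  qed
  then show thesis using that by blast
qed

lemma ex_lift:
  assumes "set_mset y \<subseteq> atoms S"
  obtains z where "set_mset z \<subseteq> atoms R" "image_mset \<tau> z = y"
proof -
  have "mset_prod S y \<in> carrier S" using S.atoms_closed[OF assms] by simp
  then obtain x where "x \<in> carrier R" "\<tau> x = mset_prod S y" using surj by auto
  then show thesis using lift_factorization[OF _ _ assms] that by metis
qed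

text \<open>Factorizations of one element of \<open>S\<close> with equal length lift to
  factorizations of one element of \<open>R\<close>, again with equal length because the lifts are
  taken atom by atom.\<close>

lemma size_separates_image:
  assumes "size_separates R"
  shows "size_separates S"
  unfolding size_separates_def
proof (intro allI impI)
  fix y y'
  assume y: "set_mset y \<subseteq> atoms S \<and> set_mset y' \<subseteq> atoms S \<and>
       mset_prod S y = mset_prod S y' \<and> size y = size y'"
  obtain z where z: "set_mset z \<subseteq> atoms R" "image_mset \<tau> z = y" using ex_lift y by blast
  then have "\<tau> (mset_prod R z) = mset_prod S y'" "mset_prod R z \<in> carrier R"
    using map_prod atoms_closed y by auto
  then obtain z' where z': "set_mset z' \<subseteq> atoms R" "image_mset \<tau> z' = y'"
    "mset_prod R z' = mset_prod R z"
    using lift_factorization y by metis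
  have "size z = size z'" using y z z' by (metis size_image_mset)
  then have "z = z'" using assms z z' by (auto simp: size_separates_def)
  with z z' show "y = y'" by simp
qed

lemma atomically_generated_image:
  assumes "atomically_generated R"
  shows "atomically_generated S"
  unfolding atomically_generated_def
proof
  fix s assume "s \<in> carrier S"
  then obtain x where x: "x \<in> carrier R" "s = \<tau> x" using surj by auto
  then obtain z where "set_mset z \<subseteq> atoms R" "mset_prod R z = x"
    using assms by (auto simp: atomically_generated_def)
  then show "\<exists>z. set_mset z \<subseteq> atoms S \<and> mset_prod S z = s"
    using map_prod[of z] map_atoms[of z] atoms_closed[of z] x by metis
qed

text \<open>The two sides of the generating relation of the image have unique lifts: if \<open>A\<close>, \<open>A'\<close> lift one
  side and \<open>B\<close>, \<open>B'\<close> are the corresponding lifts of the other, then \<open>A + B'\<close> and \<open>A' + B\<close> are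
  factorizations of the same element of equal length, and \<open>A\<close> is disjoint from \<open>B\<close>.\<close>

lemma ex_generating_relation_lift:
  assumes sep: "size_separates R" and rel: "generating_relation S a b"
    and sq: "\<And>u. count a u \<le> 1"
  obtains A B where "generating_relation R A B" "\<And>u. count A u \<le> 1" "size A = size a" "size B = size b"
proof -
  have disj: "a \<inter># b = {#}" and ab: "set_mset a \<subseteq> atoms S" "set_mset b \<subseteq> atoms S"
    using rel by (auto simp: generating_relation_def)
  have eq: "mset_prod S a = mset_prod S b"
    using rel ab unfolding generating_relation_def
    by (metis (no_types, lifting) multiple_diff_def mult_1)
  have sepD: "z = z'" if "set_mset z \<subseteq> atoms R" "set_mset z' \<subseteq> atoms R"
    "mset_prod R z = mset_prod R z'" "image_mset \<tau> z = image_mset \<tau> z'" for z z'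
  proof -
    have "size z = size z'" using that(4) by (metis size_image_mset)
    then show ?thesis using sep that by (auto simp: size_separates_def)
  qed
  have other: "\<exists>z'. set_mset z' \<subseteq> atoms R \<and> image_mset \<tau> z' = y' \<and> mset_prod R z' = mset_prod R z"
    if "set_mset z \<subseteq> atoms R" "mset_prod S (image_mset \<tau> z) = mset_prod S y'" "set_mset y' \<subseteq> atoms S" for z y'
    using lift_factorization[of "mset_prod R z" y'] that map_prod[of z] atoms_closed[of z] by auto
  obtain A where A: "set_mset A \<subseteq> atoms R" "image_mset \<tau> A = a" using ex_lift ab by blast
  obtain B where B: "set_mset B \<subseteq> atoms R" "image_mset \<tau> B = b" "mset_prod R B = mset_prod R A"
    using other[of A b] A eq ab by auto
  have disj_lift: "count w x = 0" if "image_mset \<tau> w = a" "image_mset \<tau> w' = b" "x \<in># w'" for w w' x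
  proof -
    have "\<tau> x \<in># b" using that by auto
    then have "\<tau> x \<notin># a" using disj by (metis disjunct_not_in)
    then show ?thesis using that(1) by (metis count_eq_zero_iff image_eqI set_image_mset)
  qed
  have uniqA: "w = A" if w: "set_mset w \<subseteq> atoms R" "image_mset \<tau> w = a" for w
  proof -
    obtain w' where w': "set_mset w' \<subseteq> atoms R" "image_mset \<tau> w' = b" "mset_prod R w' = mset_prod R w"
      using other[of w b] w eq ab by auto
    have "A + w' = w + B"
      by (rule sepD) (use A B w w' atoms_closed in \<open>auto simp: m_comm\<close>)
    have "A \<subseteq># w"
    proof (rule mset_subset_eqI)
      fix x show "count A x \<le> count w x"
      proof (cases "x \<in># B")
        case True
        then show ?thesis using disj_lift A B by simp
      next
        case False
        then have "count B x = 0" by (simp add: not_in_iff)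
        then show ?thesis using arg_cong[OF \<open>A + w' = w + B\<close>, of "\<lambda>M. count M x"] by simp
      qed
    qed
    moreover have "size A = size w" using A w by (metis size_image_mset)
    ultimately show ?thesis by (metis mset_subset_size nat_neq_iff subset_mset.le_neq_trans)
  qed
  \<comment> \<open>The partner of \<open>w\<close> over \<open>a\<close> must be \<open>A\<close>,
    so \<open>w\<close> and \<open>B\<close> have the same product as well as the same
    image.\<close>
  have uniqB: "w = B" if w: "set_mset w \<subseteq> atoms R" "image_mset \<tau> w = b" for w
  proof -
    obtain w' where w': "set_mset w' \<subseteq> atoms R" "image_mset \<tau> w' = a" "mset_prod R w' = mset_prod R w"
      using other[of w a] w eq ab by auto
    then have "w' = A" using uniqA by blast
    then show ?thesis using sepD w w' B by metis
  qed
  have disjAB: "A \<inter># B = {#}"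
  proof (rule multiset_eqI)
    fix x show "count (A \<inter># B) x = count {#} x"
      using disj_lift[of A B x] A B by (cases "x \<in># B") (auto simp: not_in_iff)
  qed
  have key: "\<exists>m. multiple_diff A B z z' m"
    if z: "set_mset z \<subseteq> atoms R" "set_mset z' \<subseteq> atoms R" "mset_prod R z = mset_prod R z'"
      and m: "multiple_diff a b (image_mset \<tau> z) (image_mset \<tau> z') (int m)" for z z' m
  proof -
    obtain c where c: "image_mset \<tau> z = c + repeat_mset m a" "image_mset \<tau> z' = c + repeat_mset m b"
      using multiple_diff_disjointD[OF disj m] by blast
    obtain u v where uv: "z = u + v" "c = image_mset \<tau> u" "repeat_mset m a = image_mset \<tau> v"
      using image_mset_eq_plusD[OF c(1)] by blast
    have v: "v = repeat_mset m A"
      by (rule image_mset_eq_repeatD[OF uv(3)[symmetric]])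
        (use uniqA z uv set_mset_mono in \<open>metis le_sup_iff order_trans set_mset_union\<close>)
    have at: "set_mset u \<subseteq> atoms R" "set_mset (repeat_mset m A) \<subseteq> atoms R"
      "set_mset (repeat_mset m B) \<subseteq> atoms R"
      subgoal using z(1) uv(1) by auto
      subgoal using A(1) set_mset_repeat_mset_subset[of m A] by blast
      subgoal using B(1) set_mset_repeat_mset_subset[of m B] by blast
      done
    note cl = at[THEN atoms_closed]
    \<comment> \<open>Exchanging the lifted copies of \<open>A\<close> for copies of
      \<open>B\<close> yields a factorization with the product and the image of \<open>z'\<close>;
      equal images have equal length, so it is \<open>z'\<close>.\<close>
    have "z' = u + repeat_mset m B"
    proof (rule sepD)
      show "mset_prod R z' = mset_prod R (u + repeat_mset m B)"
        using z(3) uv(1) v cl mset_prod_repeat_cong[of A B m] A B atoms_closed by simp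
      have "image_mset \<tau> (repeat_mset m B) = repeat_mset m b"
        unfolding B(2)[symmetric] by (induction m) auto
      then show "image_mset \<tau> z' = image_mset \<tau> (u + repeat_mset m B)" using c(2) uv(2) by simp
    qed (use z at in auto)
    then have "multiple_diff A B z z' (int m)"
      using uv(1) v by (simp add: multiple_diff_def algebra_simps)
    then show ?thesis by blast
  qed
  have "generating_relation R A B"
    unfolding generating_relation_def
  proof (intro conjI disjAB A B allI impI iffI)
    fix z z' assume z: "set_mset z \<subseteq> atoms R \<and> set_mset z' \<subseteq> atoms R"
    {
      assume p: "mset_prod R z = mset_prod R z'"
      then have "mset_prod S (image_mset \<tau> z) = mset_prod S (image_mset \<tau> z')"
        using z map_prod atoms_closed by metis
      then obtain m where m: "multiple_diff a b (image_mset \<tau> z) (image_mset \<tau> z') m"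
        using rel z map_atoms unfolding generating_relation_def by blast
      show "\<exists>m. multiple_diff A B z z' m"
      proof (cases "m \<ge> 0")
        case True
        then show ?thesis using key z p m by (metis nonneg_int_cases)
      next
        case False
        obtain n where "- m = int n" by (rule nonneg_int_cases[of "- m"]) (use False in auto)
        then have "\<exists>m. multiple_diff A B z' z m"
          using key[of z' z n] z p m multiple_diff_sym[of a b] by metis
        then show ?thesis using multiple_diff_sym[of A B] by blast
      qed
    }
    assume "\<exists>m. multiple_diff A B z z' m"
    then show "mset_prod R z = mset_prod R z'"
      using multiple_diff_imp_eq[OF disjAB _ _ B(3)[symmetric]] A B z atoms_closed by metis
  qed
  moreover have "\<And>u. count A u \<le> 1"
  proof -
    fix u
    have "count A u \<le> count (image_mset \<tau> A) (\<tau> u)"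
      by (induction A) auto
    then show "count A u \<le> 1" using A(2) sq[of "\<tau> u"] by simp
  qed
  moreover have "size A = size a" "size B = size b" using A B by auto
  ultimately show thesis by (rule that)
qed

end

text \<open>Cancellation and root closedness are available in \<open>red B\<close> only, whereas
  separation by length is given in \<open>red H\<close>. So length separation is pushed down to
  \<open>red B\<close>, the relation is found there, and it is lifted back.\<close>

lemma ex_generating_relation_red:
  assumes "comm_monoid H" "krull_monoid B" "transfer_hom H B \<theta>" "length_factorial H"
  obtains A C where "generating_relation (red H) A C" "\<And>u. count A u \<le> 1"
    "A = {#} \<and> C = {#} \<or> size A \<ge> 2 \<and> size C \<ge> 2 \<and> size A \<noteq> size C"
proof -
  interpret H: comm_monoid H by fact
  interpret B: comm_monoid_cancel B using assms(2) by (simp add: krull_monoid_def)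
  obtain \<tau> where \<tau>: "monoid_hom (red H) (red B) \<tau>"
    "carrier (red B) = \<tau> ` carrier (red H)"
    "\<And>x. \<lbrakk>x \<in> carrier (red H); \<tau> x = \<one>\<^bsub>red B\<^esub>\<rbrakk> \<Longrightarrow> x = \<one>\<^bsub>red H\<^esub>"
    "\<And>x b c. \<lbrakk>x \<in> carrier (red H); b \<in> carrier (red B); c \<in> carrier (red B);
        \<tau> x = b \<otimes>\<^bsub>red B\<^esub> c\<rbrakk> \<Longrightarrow>
      \<exists>v\<in>carrier (red H). \<exists>w\<in>carrier (red H). x = v \<otimes>\<^bsub>red H\<^esub> w \<and> \<tau> v = b \<and> \<tau> w = c"
    by (rule transfer_hom_red[OF H.comm_monoid_axioms B.comm_monoid_axioms assms(3)]) (rule that)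
  interpret T: reduced_transfer "red H" "red B" \<tau>
  proof -
    interpret RH: comm_monoid "red H" by (rule H.comm_monoid_red)
    interpret RB: comm_monoid "red B" by (rule B.comm_monoid_red)
    show "reduced_transfer (red H) (red B) \<tau>"
      by unfold_locales (use \<tau> H.reduced_red B.reduced_red in \<open>auto simp: reduced_def\<close>)
  qed
  have sep: "size_separates (red H)" and gen: "atomically_generated (red H)"
    using assms(4) length_factorial_iff_red[OF H.comm_monoid_axioms]
    by (auto simp: size_separates_def atomically_generated_def)
  obtain a c where ac: "generating_relation (red B) a c" "\<And>u. count a u \<le> 1"
    "a = {#} \<and> c = {#} \<or> size a \<ge> 2 \<and> size c \<ge> 2 \<and> size a \<noteq> size c"
  proof (rule T.S.ex_generating_relation)
    show "comm_monoid_cancel (red B)" by (rule krull_monoid_red(1)[OF assms(2)])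
    show "size_separates (red B)" by (rule T.size_separates_image[OF sep])
    show "atomically_generated (red B)" by (rule T.atomically_generated_image[OF gen])
    show "x divides\<^bsub>red B\<^esub> y" if "x \<in> carrier (red B)" "y \<in> carrier (red B)"
      "(x \<otimes>\<^bsub>red B\<^esub> x) divides\<^bsub>red B\<^esub> (y \<otimes>\<^bsub>red B\<^esub> y)" for x y
      by (rule krull_monoid_red(2)[OF assms(2) that])
  qed (rule that)
  obtain A C where AC: "generating_relation (red H) A C" "\<And>u. count A u \<le> 1"
    "size A = size a" "size C = size c"
    by (rule T.ex_generating_relation_lift[OF sep ac(1,2)]) (rule that)
  have "A = {#} \<and> C = {#} \<or> size A \<ge> 2 \<and> size C \<ge> 2 \<and> size A \<noteq> size C"
    using ac(3) AC(3,4) by auto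
  with AC(1,2) show thesis by (rule that)
qed

section \<open>Divisor theories\<close>

lemma carrier_free_monoid [simp]: "carrier (free_monoid P) = {M. set_mset M \<subseteq> P}"
  and mult_free_monoid [simp]: "M \<otimes>\<^bsub>free_monoid P\<^esub> N = M + N"
  and one_free_monoid [simp]: "\<one>\<^bsub>free_monoid P\<^esub> = {#}"
  by (simp_all add: free_monoid_def)

text \<open>A greatest common divisor in a free monoid is the pointwise minimum of the counts, and a
  minimum of natural numbers is attained. Attainment is the form that can be combined with products
  and with changes of the divisor theory.\<close>

lemma is_gcd_of_free_monoid_iff:
  assumes "\<And>x. x \<in> S \<Longrightarrow> set_mset x \<subseteq> P"
  shows "is_gcd_of (free_monoid P) d S \<longleftrightarrow>
    set_mset d \<subseteq> P \<and> (\<forall>x\<in>S. d \<subseteq># x) \<and> (\<forall>p\<in>P. \<exists>x\<in>S. count x p = count d p)"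
    (is "_ \<longleftrightarrow> ?d \<and> ?lb \<and> ?att")
proof
  assume gcd: "is_gcd_of (free_monoid P) d S"
  have d: ?d using gcd by (simp add: is_gcd_of_def)
  have lb: ?lb using gcd d assms by (simp add: is_gcd_of_def divides_free_monoid)
  have ?att
  proof (rule ballI, rule ccontr)
    fix p assume p: "p \<in> P" and no: "\<not> (\<exists>x\<in>S. count x p = count d p)"
    \<comment> \<open>If the count at \<open>p\<close> were never attained, one more
      \<open>p\<close> could be added to \<open>d\<close>.\<close>
    have "add_mset p d \<subseteq># x" if "x \<in> S" for x
    proof (rule mset_subset_eqI)
      fix q
      have "count d q \<le> count x q" using lb that by (simp add: mset_subset_eq_count)
      moreover have "count x p \<noteq> count d p" using no that by blast
      ultimately show "count (add_mset p d) q \<le> count x q" by (cases "q = p") auto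
    qed
    then have "add_mset p d divides\<^bsub>free_monoid P\<^esub> d"
      using gcd p d assms by (simp add: is_gcd_of_def divides_free_monoid)
    then have "add_mset p d \<subseteq># d" using p d by (simp add: divides_free_monoid)
    then show False by (simp add: add_mset_subseteq_single_iff mset_subset_eq_insertD subset_mset.less_le)
  qed
  with d lb show "?d \<and> ?lb \<and> ?att" by blast
next
  assume *: "?d \<and> ?lb \<and> ?att"
  have "c \<subseteq># d" if c: "set_mset c \<subseteq> P" "\<forall>x\<in>S. c \<subseteq># x" for c
  proof (rule mset_subset_eqI)
    fix p show "count c p \<le> count d p"
    proof (cases "p \<in> P")
      case True
      then obtain x where "x \<in> S" "count x p = count d p" using * by blast
      then show ?thesis using c(2) by (metis mset_subset_eq_count)
    next
      case False
      then have "count c p = 0" using c(1) by (meson count_inI subsetD)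
      then show ?thesis by simp
    qed
  qed
  with * assms show "is_gcd_of (free_monoid P) d S"
    by (simp add: is_gcd_of_def divides_free_monoid)
qed

section \<open>Greatest common divisors and uniqueness of divisor theories\<close>

locale divisor_monoid = comm_monoid H for H (structure) +
  fixes P :: "'p set" and \<phi>
  assumes divisor_theory: "divisor_theory H P \<phi>"
begin

lemma map_closed: "a \<in> carrier H \<Longrightarrow> set_mset (\<phi> a) \<subseteq> P"
  using divisor_theory
  by (auto simp: divisor_theory_def divisor_hom_def monoid_hom_def hom_def Pi_def)

lemma map_mult: "\<lbrakk>a \<in> carrier H; b \<in> carrier H\<rbrakk> \<Longrightarrow> \<phi> (a \<otimes> b) = \<phi> a + \<phi> b"
  using divisor_theory
  by (auto simp: divisor_theory_def divisor_hom_def monoid_hom_def hom_def)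

lemma map_one: "\<phi> \<one> = {#}"
  using divisor_theory by (auto simp: divisor_theory_def divisor_hom_def monoid_hom_def)

lemma map_subset_iff:
  assumes "a \<in> carrier H" "b \<in> carrier H"
  shows "\<phi> a \<subseteq># \<phi> b \<longleftrightarrow> a divides b"
proof
  assume "\<phi> a \<subseteq># \<phi> b"
  then show "a divides b"
    using divisor_theory assms divides_free_monoid[OF map_closed map_closed, of a b]
    by (auto simp: divisor_theory_def divisor_hom_def)
qed (use assms map_mult in \<open>auto simp: factor_def\<close>)

definition is_gcd_set :: "'a set \<Rightarrow> 'p multiset \<Rightarrow> bool" where
  "is_gcd_set A d \<longleftrightarrow> finite A \<and> A \<noteq> {} \<and> A \<subseteq> carrier H \<and> set_mset d \<subseteq> P \<and>
     (\<forall>a\<in>A. d \<subseteq># \<phi> a) \<and> (\<forall>p\<in>P. \<exists>a\<in>A. count (\<phi> a) p = count d p)"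

lemma is_gcd_set_attained:
  "\<lbrakk>is_gcd_set A d; p \<in> P\<rbrakk> \<Longrightarrow> \<exists>a\<in>A. count (\<phi> a) p = count d p"
  by (simp add: is_gcd_set_def)

lemma is_gcd_set_alt:
  "is_gcd_set A d \<longleftrightarrow>
    finite A \<and> A \<noteq> {} \<and> A \<subseteq> carrier H \<and> is_gcd_of (free_monoid P) d (\<phi> ` A)"
proof (cases "A \<subseteq> carrier H")
  case True
  then have "set_mset x \<subseteq> P" if "x \<in> \<phi> ` A" for x using that map_closed by blast
  from is_gcd_of_free_monoid_iff[OF this] show ?thesis by (auto simp: is_gcd_set_def)
qed (auto simp: is_gcd_set_def)

lemma ex_is_gcd_set: "set_mset d \<subseteq> P \<Longrightarrow> \<exists>A. is_gcd_set A d"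
  using divisor_theory by (auto simp: divisor_theory_def is_gcd_set_alt)

lemma ex_gcd:
  assumes "finite A" "A \<noteq> {}" "A \<subseteq> carrier H"
  shows "\<exists>d. is_gcd_set A d"
  using assms
proof (induction rule: finite_ne_induct)
  case (singleton a)
  then show ?case by (intro exI[of _ "\<phi> a"]) (auto simp: is_gcd_set_def dest: map_closed)
next
  case (insert a A)
  then obtain d where d: "is_gcd_set A d" by auto
  have "\<exists>x\<in>insert a A. count (\<phi> x) p = count (\<phi> a \<inter># d) p" if p: "p \<in> P" for p
  proof -
    obtain x where "x \<in> A" "count (\<phi> x) p = count d p" using is_gcd_set_attained[OF d p] by blast
    then show ?thesis by (cases "count (\<phi> a) p \<le> count d p") (auto simp: min_def)
  qed
  then have "is_gcd_set (insert a A) (\<phi> a \<inter># d)"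
    using d insert map_closed[of a]
    by (auto simp: is_gcd_set_def intro: subset_mset.le_infI2)
  then show ?case by blast
qed

text \<open>The right-hand side does not mention the divisor theory; this gives uniqueness.\<close>

lemma gcd_subset_iff:
  assumes gcd: "is_gcd_set A d" and h: "h \<in> carrier H"
  shows "d \<subseteq># \<phi> h \<longleftrightarrow>
    (\<forall>x\<in>carrier H. \<forall>y\<in>carrier H. (\<forall>a\<in>A. x divides (y \<otimes> a)) \<longrightarrow> x divides (y \<otimes> h))"
proof
  have A: "A \<subseteq> carrier H" using gcd by (simp add: is_gcd_set_def)
  \<comment> \<open>In terms of fractional ideals, the right-hand side says that \<open>h\<close>
    lies in every principal fractional ideal containing \<open>A\<close>, that is, in the divisorial
    closure of \<open>A\<close>.\<close>
  assume d: "d \<subseteq># \<phi> h"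
  show "\<forall>x\<in>carrier H. \<forall>y\<in>carrier H. (\<forall>a\<in>A. x divides (y \<otimes> a)) \<longrightarrow> x divides (y \<otimes> h)"
  proof (intro ballI impI)
    fix x y assume x: "x \<in> carrier H" and y: "y \<in> carrier H" and dv: "\<forall>a\<in>A. x divides (y \<otimes> a)"
    have "\<phi> x \<subseteq># \<phi> y + \<phi> h"
    proof (rule mset_subset_eqI)
      fix p show "count (\<phi> x) p \<le> count (\<phi> y + \<phi> h) p"
      proof (cases "p \<in> P")
        case True
        then obtain a where a: "a \<in> A" "count (\<phi> a) p = count d p"
          using is_gcd_set_attained[OF gcd] by blast
        then have "\<phi> x \<subseteq># \<phi> y + \<phi> a"
          using dv x y A map_subset_iff[of x "y \<otimes> a"] map_mult[of y a] by auto
        then have "count (\<phi> x) p \<le> count (\<phi> y) p + count d p"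
          using a(2) by (metis count_union mset_subset_eq_count)
        moreover have "count d p \<le> count (\<phi> h) p" using d by (simp add: mset_subset_eq_count)
        ultimately show ?thesis by simp
      next
        case False
        then have "p \<notin># \<phi> x" using map_closed[OF x] by blast
        then show ?thesis by (simp add: not_in_iff)
      qed
    qed
    then show "x divides (y \<otimes> h)" using x y h map_subset_iff[of x "y \<otimes> h"] map_mult by simp
  qed
next
  have A: "A \<subseteq> carrier H" "A \<noteq> {}" using gcd by (auto simp: is_gcd_set_def)
  assume R: "\<forall>x\<in>carrier H. \<forall>y\<in>carrier H. (\<forall>a\<in>A. x divides (y \<otimes> a)) \<longrightarrow> x divides (y \<otimes> h)"
  obtain a0 where a0: "a0 \<in> A" using A by blast
  \<comment> \<open>The complement \<open>e\<close> of \<open>d\<close> in \<open>\<phi> a0\<close>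
    is itself the gcd of some set \<open>C\<close>. Testing the condition with the fractions of
    \<open>a0\<close> by \<open>c\<close>, for \<open>c\<close> in \<open>C\<close>, gives
    \<open>d + e \<subseteq># \<phi> c + \<phi> h\<close>; the minimum over \<open>c\<close> removes
    \<open>e\<close> at every prime divisor.\<close>
  define e where "e = \<phi> a0 - d"
  have "d \<subseteq># \<phi> a0" using gcd a0 by (auto simp: is_gcd_set_def)
  then have de: "\<phi> a0 = d + e" by (simp add: e_def)
  then have "set_mset e \<subseteq> P" using map_closed[of a0] a0 A by auto
  then obtain C where C: "is_gcd_set C e" using ex_is_gcd_set by blast
  then have CH: "C \<subseteq> carrier H" by (auto simp: is_gcd_set_def)
  have sub: "d + e \<subseteq># \<phi> c + \<phi> h" if c: "c \<in> C" for c
  proof -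
    have "a0 divides (c \<otimes> a)" if "a \<in> A" for a
    proof -
      have "d \<subseteq># \<phi> a" "e \<subseteq># \<phi> c" using gcd C c that by (auto simp: is_gcd_set_def)
      then have "\<phi> a0 \<subseteq># \<phi> (c \<otimes> a)"
        using de map_mult[of c a] c CH that A(1)
        by (metis add.commute subset_mset.add_mono subsetD)
      then show ?thesis using map_subset_iff[of a0 "c \<otimes> a"] a0 A c CH that by auto
    qed
    then have "a0 divides (c \<otimes> h)" using R a0 A c CH by blast
    then show ?thesis
      using map_subset_iff[of a0 "c \<otimes> h"] de map_mult[of c h] subsetD[OF A(1) a0] subsetD[OF CH c] h
      by simp
  qed
  show "d \<subseteq># \<phi> h"
  proof (rule mset_subset_eqI)
    fix p show "count d p \<le> count (\<phi> h) p"
    proof (cases "p \<in> P")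
      case True
      then obtain c where c: "c \<in> C" "count (\<phi> c) p = count e p"
        using is_gcd_set_attained[OF C] by blast
      have "count (d + e) p \<le> count (\<phi> c + \<phi> h) p" using sub[OF c(1)] by (rule mset_subset_eq_count)
      then show ?thesis using c(2) by simp
    next
      case False
      then have "p \<notin># d" using gcd by (auto simp: is_gcd_set_def)
      then show ?thesis by (simp add: not_in_iff)
    qed
  qed
qed

lemma is_gcd_set_mult:
  assumes "is_gcd_set A d" "is_gcd_set A' d'"
  shows "is_gcd_set ((\<lambda>(a, b). a \<otimes> b) ` (A \<times> A')) (d + d')"
  unfolding is_gcd_set_def
proof (intro conjI ballI)
  show "(\<lambda>(a, b). a \<otimes> b) ` (A \<times> A') \<subseteq> carrier H" "(\<lambda>(a, b). a \<otimes> b) ` (A \<times> A') \<noteq> {}"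
    "finite ((\<lambda>(a, b). a \<otimes> b) ` (A \<times> A'))"
    "set_mset (d + d') \<subseteq> P"
    using assms by (auto simp: is_gcd_set_def)
next
  fix x assume "x \<in> (\<lambda>(a, b). a \<otimes> b) ` (A \<times> A')"
  then obtain a b where "a \<in> A" "b \<in> A'" "x = a \<otimes> b" by auto
  moreover from this have "\<phi> x = \<phi> a + \<phi> b" using assms map_mult[of a b] by (auto simp: is_gcd_set_def)
  ultimately show "d + d' \<subseteq># \<phi> x"
    using assms by (auto simp: is_gcd_set_def intro: subset_mset.add_mono)
next
  fix p assume "p \<in> P"
  then obtain a b where ab: "a \<in> A" "b \<in> A'" "count (\<phi> a) p = count d p" "count (\<phi> b) p = count d' p"
    using assms by (meson is_gcd_set_def)
  moreover have "a \<in> carrier H" "b \<in> carrier H" using ab assms by (auto simp: is_gcd_set_def)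
  ultimately have "count (\<phi> (a \<otimes> b)) p = count (d + d') p" by (simp add: map_mult)
  with ab show "\<exists>x\<in>(\<lambda>(a, b). a \<otimes> b) ` (A \<times> A'). count (\<phi> x) p = count (d + d') p" by blast
qed

lemma is_gcd_set_one: "is_gcd_set {\<one>} {#}"
  by (simp add: is_gcd_set_def map_one)

text \<open>Distinct prime divisors are separated by elements of the monoid: as \<open>{#p#}\<close>
  is a gcd of elements, one of them is divisible by \<open>p\<close> but not by
  \<open>p'\<close>.\<close>

lemma prime_divisor_eqI:
  assumes "p \<in> P" and "p' \<in> P" and eq: "\<And>h. h \<in> carrier H \<Longrightarrow> count (\<phi> h) p = count (\<phi> h) p'"
  shows "p = p'"
proof (rule ccontr)
  assume "p \<noteq> p'"
  obtain A where A: "is_gcd_set A {#p#}" using ex_is_gcd_set[of "{#p#}"] assms by auto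
  then obtain a where "a \<in> A" "count (\<phi> a) p' = 0"
    using \<open>p \<noteq> p'\<close> assms(2) by (fastforce simp: is_gcd_set_def)
  moreover have "{#p#} \<subseteq># \<phi> a" "a \<in> carrier H" using A \<open>a \<in> A\<close> by (auto simp: is_gcd_set_def)
  ultimately show False using eq[of a] by (simp flip: count_greater_zero_iff)
qed

end

text \<open>Corresponding prime divisors of two divisor theories: \<open>{#p#}\<close> is the greatest common divisor
  of a set \<open>A\<close>, and so is a divisor \<open>e\<close> of the other theory. Since divisors are ordered in the
  same way in both theories, \<open>e\<close> is a single prime divisor \<open>q\<close>; multiplicities agree because powers
  of \<open>p\<close> and \<open>q\<close> are the greatest common divisors of the same sets of products.\<close>

lemma corresponding_prime_divisor:
  assumes D: "divisor_monoid H P \<phi>" and E: "divisor_monoid H Q \<psi>" and p: "p \<in> P"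
  shows "\<exists>q\<in>Q. \<forall>h\<in>carrier H. count (\<phi> h) p = count (\<psi> h) q"
proof -
  interpret D: divisor_monoid H P \<phi> by fact
  interpret E: divisor_monoid H Q \<psi> by fact
  have trans: "d \<subseteq># \<phi> h \<longleftrightarrow> e \<subseteq># \<psi> h"
    if "D.is_gcd_set A d" "E.is_gcd_set A e" "h \<in> carrier H" for A d e h
    using D.gcd_subset_iff[OF that(1,3)] E.gcd_subset_iff[OF that(2,3)] by blast
  obtain A where A: "D.is_gcd_set A {#p#}" using D.ex_is_gcd_set[of "{#p#}"] p by auto
  then have AH: "finite A" "A \<noteq> {}" "A \<subseteq> carrier H" by (auto simp: D.is_gcd_set_def)
  then obtain e where e: "E.is_gcd_set A e" using E.ex_gcd by blast
  have "e \<noteq> {#}"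
    using trans[OF A e, of "\<one>\<^bsub>H\<^esub>"] D.map_one by auto
  then obtain q where q: "q \<in># e" by blast
  \<comment> \<open>Any prime divisor \<open>q\<close> in \<open>e\<close> will do. Its own gcd set
    \<open>A'\<close> is translated back to a divisor \<open>e'\<close> of the first theory, which
    is nontrivial and lies below \<open>{#p#}\<close>, so that it equals
    \<open>{#p#}\<close>.\<close>
  then have "q \<in> Q" using e by (auto simp: E.is_gcd_set_def)
  obtain A' where A': "E.is_gcd_set A' {#q#}" using E.ex_is_gcd_set[of "{#q#}"] \<open>q \<in> Q\<close> by auto
  then have A'H: "finite A'" "A' \<noteq> {}" "A' \<subseteq> carrier H" by (auto simp: E.is_gcd_set_def)
  then obtain e' where e': "D.is_gcd_set A' e'" using D.ex_gcd by blast
  have e'h: "e' \<subseteq># \<phi> h \<longleftrightarrow> q \<in># \<psi> h" if "h \<in> carrier H" for h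
    using trans[OF e' A' that] by simp
  have "e' \<subseteq># {#p#}"
  proof (rule mset_subset_eqI)
    fix r show "count e' r \<le> count {#p#} r"
    proof (cases "r \<in> P")
      case True
      then obtain a where a: "a \<in> A" "count (\<phi> a) r = count {#p#} r"
        using A unfolding D.is_gcd_set_def by blast
      have "e \<subseteq># \<psi> a" using a e by (auto simp: E.is_gcd_set_def)
      then have "e' \<subseteq># \<phi> a" using e'h a AH q by (meson mset_subset_eqD subsetD)
      then show ?thesis using a(2) by (metis mset_subset_eq_count)
    next
      case False
      then have "r \<notin># e'" using e' by (auto simp: D.is_gcd_set_def)
      then show ?thesis by (simp add: not_in_iff)
    qed
  qed
  moreover have "e' \<noteq> {#}" using e'h[of "\<one>\<^bsub>H\<^esub>"] E.map_one by auto
  ultimately have "e' = {#p#}" by (rule nonempty_subseteq_mset_eq_single[rotated])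
  have pow: "\<exists>C. D.is_gcd_set C (replicate_mset n p) \<and> E.is_gcd_set C (replicate_mset n q)" for n
  proof (induction n)
    case 0
    then show ?case using D.is_gcd_set_one E.is_gcd_set_one by auto
  next
    case (Suc n)
    then obtain C where "D.is_gcd_set C (replicate_mset n p)" "E.is_gcd_set C (replicate_mset n q)" by blast
    then show ?case
      using D.is_gcd_set_mult[OF e', of C "replicate_mset n p"]
        E.is_gcd_set_mult[OF A', of C "replicate_mset n q"] \<open>e' = {#p#}\<close> by auto
  qed
  have "n \<le> count (\<phi> h) p \<longleftrightarrow> n \<le> count (\<psi> h) q" if "h \<in> carrier H" for h n
    using pow[of n] trans[OF _ _ that] by (auto simp: count_le_replicate_mset_subset_eq)
  then have "count (\<phi> h) p = count (\<psi> h) q" if "h \<in> carrier H" for h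
    using that by (meson dual_order.antisym order_refl)
  with \<open>q \<in> Q\<close> show ?thesis by blast
qed

text \<open>The prime divisors are matched in both directions; since equal multiplicity functions
  mean equal prime divisors, the two matchings are inverse to each other.\<close>

lemma divisor_theory_unique:
  assumes D: "divisor_monoid H P \<phi>" and E: "divisor_monoid H Q \<psi>"
  obtains \<beta> where "bij_betw \<beta> P Q"
    "\<And>h p. \<lbrakk>h \<in> carrier H; p \<in> P\<rbrakk> \<Longrightarrow> count (\<phi> h) p = count (\<psi> h) (\<beta> p)"
proof -
  obtain \<beta> where \<beta>: "\<And>p. p \<in> P \<Longrightarrow> \<beta> p \<in> Q \<and> (\<forall>h\<in>carrier H. count (\<phi> h) p = count (\<psi> h) (\<beta> p))"
    using corresponding_prime_divisor[OF D E] by metis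
  have "inj_on \<beta> P"
    by (rule inj_onI, rule divisor_monoid.prime_divisor_eqI[OF D]) (use \<beta> in auto)
  moreover have "q \<in> \<beta> ` P" if q: "q \<in> Q" for q
  proof -
    obtain p where p: "p \<in> P" "\<forall>h\<in>carrier H. count (\<psi> h) q = count (\<phi> h) p"
      using corresponding_prime_divisor[OF E D q] by blast
    have "q = \<beta> p"
      by (rule divisor_monoid.prime_divisor_eqI[OF E]) (use \<beta>[OF p(1)] p q in auto)
    with p show ?thesis by blast
  qed
  ultimately have "bij_betw \<beta> P Q" using \<beta> by (auto simp: bij_betw_def)
  with \<beta> that show thesis by blast
qed

text \<open>Only single prime divisors have to be realised as greatest common divisors: minima of
  counts add up when the sets of elements are multiplied.\<close>

lemma divisor_monoidI:
  fixes H :: "('a, 'm) monoid_scheme" (structure)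
  assumes "comm_monoid H" and im: "\<And>a. a \<in> carrier H \<Longrightarrow> set_mset (\<phi> a) \<subseteq> P"
    and mult: "\<And>a b. \<lbrakk>a \<in> carrier H; b \<in> carrier H\<rbrakk> \<Longrightarrow> \<phi> (a \<otimes> b) = \<phi> a + \<phi> b"
    and one: "\<phi> \<one> = {#}"
    and dvd: "\<And>a b. \<lbrakk>a \<in> carrier H; b \<in> carrier H; \<phi> a \<subseteq># \<phi> b\<rbrakk> \<Longrightarrow> a divides b"
    and gcd: "\<And>p. p \<in> P \<Longrightarrow> \<exists>A. finite A \<and> A \<noteq> {} \<and> A \<subseteq> carrier H \<and> (\<forall>a\<in>A. p \<in># \<phi> a) \<and>
      (\<forall>q\<in>P. \<exists>a\<in>A. count (\<phi> a) q = count {#p#} q)"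
  shows "divisor_monoid H P \<phi>"
proof -
  interpret comm_monoid H by fact
  have "\<exists>A. finite A \<and> A \<noteq> {} \<and> A \<subseteq> carrier H \<and> (\<forall>a\<in>A. d \<subseteq># \<phi> a) \<and>
      (\<forall>q\<in>P. \<exists>a\<in>A. count (\<phi> a) q = count d q)" if "set_mset d \<subseteq> P" for d
    using that
  proof (induction d)
    case empty
    then show ?case by (intro exI[of _ "{\<one>}"]) (simp add: one)
  next
    case (add p d)
    then obtain A where A: "finite A" "A \<noteq> {}" "A \<subseteq> carrier H" "\<forall>a\<in>A. d \<subseteq># \<phi> a"
      "\<forall>q\<in>P. \<exists>a\<in>A. count (\<phi> a) q = count d q" by auto
    obtain B where B: "finite B" "B \<noteq> {}" "B \<subseteq> carrier H" "\<forall>a\<in>B. p \<in># \<phi> a"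
      "\<forall>q\<in>P. \<exists>a\<in>B. count (\<phi> a) q = count {#p#} q" using gcd[of p] add.prems by auto
    show ?case
    proof (intro exI[of _ "(\<lambda>(a, b). a \<otimes> b) ` (B \<times> A)"] conjI ballI)
      fix x assume "x \<in> (\<lambda>(a, b). a \<otimes> b) ` (B \<times> A)"
      then obtain a b where ab: "a \<in> B" "b \<in> A" "x = a \<otimes> b" by auto
      then have "\<phi> x = \<phi> a + \<phi> b" using A(3) B(3) mult by (metis subsetD)
      moreover have "{#p#} \<subseteq># \<phi> a" "d \<subseteq># \<phi> b" using ab A B by auto
      ultimately have "{#p#} + d \<subseteq># \<phi> x" by (metis subset_mset.add_mono)
      then show "add_mset p d \<subseteq># \<phi> x" by simp
    next
      fix q assume "q \<in> P"
      then obtain a b where ab: "a \<in> B" "count (\<phi> a) q = count {#p#} q"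
        "b \<in> A" "count (\<phi> b) q = count d q" using A B by meson
      moreover have "a \<in> carrier H" "b \<in> carrier H" using ab A(3) B(3) by auto
      ultimately have "count (\<phi> (a \<otimes> b)) q = count (add_mset p d) q" by (simp add: mult)
      with ab show "\<exists>x\<in>(\<lambda>(a, b). a \<otimes> b) ` (B \<times> A). count (\<phi> x) q = count (add_mset p d) q" by blast
    qed (use A B in auto)
  qed
  note gcds = this
  have "divisor_theory H P \<phi>"
    unfolding divisor_theory_def divisor_hom_def monoid_hom_def
  proof (intro conjI ballI impI)
    show "\<phi> \<in> hom H (free_monoid P)" "\<phi> \<one> = \<one>\<^bsub>free_monoid P\<^esub>"
      using im mult one by (auto simp: hom_def)
  next
    fix a b assume "a \<in> carrier H" "b \<in> carrier H" "\<phi> a divides\<^bsub>free_monoid P\<^esub> \<phi> b"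
    then show "a divides b" using dvd im by (simp add: divides_free_monoid)
  next
    fix d assume "d \<in> carrier (free_monoid P)"
    then have d: "set_mset d \<subseteq> P" by simp
    obtain A where A: "finite A" "A \<noteq> {}" "A \<subseteq> carrier H" "\<forall>a\<in>A. d \<subseteq># \<phi> a"
      "\<forall>q\<in>P. \<exists>a\<in>A. count (\<phi> a) q = count d q" using gcds[OF d] by blast
    have "set_mset x \<subseteq> P" if "x \<in> \<phi> ` A" for x using that A(3) im by blast
    from is_gcd_of_free_monoid_iff[OF this] have "is_gcd_of (free_monoid P) d (\<phi> ` A)"
      using A d by simp
    with A show "\<exists>A. finite A \<and> A \<noteq> {} \<and> A \<subseteq> carrier H \<and> is_gcd_of (free_monoid P) d (\<phi> ` A)" by blast
  qed
  then show ?thesis by unfold_locales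
qed

section \<open>Adjoining primes to a divisor theory\<close>

lemma count_image_Inl_Inr [simp]:
  "count (image_mset Inl M + image_mset Inr N) (Inl x) = count M x"
  "count (image_mset Inl M + image_mset Inr N) (Inr y) = count N y"
proof -
  have "count (image_mset Inl M) (Inl x :: 'a + 'b) = count M x" for M by (induction M) auto
  moreover have "count (image_mset Inr N) (Inr y :: 'a + 'b) = count N y" for N by (induction N) auto
  moreover have "count (image_mset Inr N) (Inl x :: 'a + 'b) = 0" by (auto simp: count_eq_zero_iff)
  moreover have "count (image_mset Inl M) (Inr y :: 'a + 'b) = 0" by (auto simp: count_eq_zero_iff)
  ultimately show "count (image_mset Inl M + image_mset Inr N) (Inl x) = count M x"
    "count (image_mset Inl M + image_mset Inr N) (Inr y) = count N y" by simp_all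
qed

text \<open>A free generator is a prime divisor by itself, so the prime divisors of the product are
  the disjoint sum. Those in \<open>Q\<close> keep their gcd sets, with trivial free part.\<close>

lemma divisor_monoid_free_times:
  assumes K: "divisor_monoid (R\<lparr>carrier := K\<rparr>) Q \<psi>" and R: "comm_monoid R"
    and iso: "(\<lambda>(M, h). mset_prod R M \<otimes>\<^bsub>R\<^esub> h) \<in> iso (free_monoid P0 \<times>\<times> R\<lparr>carrier := K\<rparr>) R"
  obtains \<phi> where "divisor_monoid R (P0 <+> Q) \<phi>"
    "\<And>M h. \<lbrakk>set_mset M \<subseteq> P0; h \<in> K\<rbrakk> \<Longrightarrow>
      \<phi> (mset_prod R M \<otimes>\<^bsub>R\<^esub> h) = image_mset Inl M + image_mset Inr (\<psi> h)"
proof -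
  interpret R: comm_monoid R by fact
  interpret K: divisor_monoid "R\<lparr>carrier := K\<rparr>" Q \<psi> by fact
  let ?G = "free_monoid P0 \<times>\<times> R\<lparr>carrier := K\<rparr>"
  define f where "f = (\<lambda>(M, h). mset_prod R M \<otimes>\<^bsub>R\<^esub> h)"
  have f: "f \<in> hom ?G R" "bij_betw f (carrier ?G) (carrier R)" using iso by (auto simp: iso_def f_def)
  define g where "g = inv_into (carrier ?G) f"
  have gf: "g (f x) = x" if "x \<in> carrier ?G" for x
    using f(2) that by (simp add: g_def bij_betw_inv_into_left)
  have carr: "carrier ?G = {M. set_mset M \<subseteq> P0} \<times> K" by (simp add: DirProd_def)
  have surj: "\<exists>M h. set_mset M \<subseteq> P0 \<and> h \<in> K \<and> x = f (M, h)" if "x \<in> carrier R" for x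
  proof -
    have "x \<in> f ` carrier ?G" using f(2) that by (simp add: bij_betw_def)
    then show ?thesis by (auto simp: carr)
  qed
  have fc: "f (M, h) \<in> carrier R" if "set_mset M \<subseteq> P0" "h \<in> K" for M h
    using f(1) that by (auto simp: hom_def carr Pi_def)
  have fm: "f (M, h) \<otimes>\<^bsub>R\<^esub> f (N, k) = f (M + N, h \<otimes>\<^bsub>R\<^esub> k)"
    if "set_mset M \<subseteq> P0" "h \<in> K" "set_mset N \<subseteq> P0" "k \<in> K" for M N h k
    using hom_mult[OF f(1), of "(M, h)" "(N, k)"] that by (simp add: carr)
  define \<phi> where "\<phi> x = (case g x of (M, h) \<Rightarrow> image_mset Inl M + image_mset Inr (\<psi> h))" for x
  have \<phi>: "\<phi> (f (M, h)) = image_mset Inl M + image_mset Inr (\<psi> h)" if "set_mset M \<subseteq> P0" "h \<in> K" for M h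
    using gf[of "(M, h)"] that by (simp add: \<phi>_def carr)
  have one: "\<one>\<^bsub>R\<^esub> \<in> K" using K.one_closed by simp
  have f1: "f ({#}, \<one>\<^bsub>R\<^esub>) = \<one>\<^bsub>R\<^esub>" by (simp add: f_def)
  have "divisor_monoid R (P0 <+> Q) \<phi>"
  proof (rule divisor_monoidI[OF R])
    fix a assume "a \<in> carrier R"
    then obtain M h where "set_mset M \<subseteq> P0" "h \<in> K" "a = f (M, h)" using surj by blast
    then show "set_mset (\<phi> a) \<subseteq> P0 <+> Q" using K.map_closed[of h] by (auto simp: \<phi>)
  next
    fix a b assume "a \<in> carrier R" "b \<in> carrier R"
    then obtain M h N k where *: "set_mset M \<subseteq> P0" "h \<in> K" "a = f (M, h)"
       "set_mset N \<subseteq> P0" "k \<in> K" "b = f (N, k)" using surj by metis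
    moreover have "h \<otimes>\<^bsub>R\<^esub> k \<in> K" using K.m_closed[of h k] * by simp
    moreover have "\<psi> (h \<otimes>\<^bsub>R\<^esub> k) = \<psi> h + \<psi> k" using K.map_mult[of h k] * by simp
    ultimately show "\<phi> (a \<otimes>\<^bsub>R\<^esub> b) = \<phi> a + \<phi> b" by (simp add: fm \<phi>)
  next
    show "\<phi> \<one>\<^bsub>R\<^esub> = {#}" using \<phi>[of "{#}" "\<one>\<^bsub>R\<^esub>"] one K.map_one by (simp add: f1)
  next
    fix a b assume "a \<in> carrier R" "b \<in> carrier R" and sub: "\<phi> a \<subseteq># \<phi> b"
    then obtain M h N k where *: "set_mset M \<subseteq> P0" "h \<in> K" "a = f (M, h)"
       "set_mset N \<subseteq> P0" "k \<in> K" "b = f (N, k)" using surj by metis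
    have le: "count (\<phi> a) z \<le> count (\<phi> b) z" for z using sub by (rule mset_subset_eq_count)
    have "M \<subseteq># N" using le[of "Inl x" for x] * by (auto simp: \<phi> intro!: mset_subset_eqI simp del: count_union)
    then obtain L where L: "N = M + L" by (auto simp: subset_mset.le_iff_add)
    have "\<psi> h \<subseteq># \<psi> k" using le[of "Inr x" for x] * by (auto simp: \<phi> intro!: mset_subset_eqI simp del: count_union)
    then obtain l where l: "l \<in> K" "k = h \<otimes>\<^bsub>R\<^esub> l"
      using K.map_subset_iff[of h k] * by (auto simp: factor_def)
    have "b = a \<otimes>\<^bsub>R\<^esub> f (L, l)" using * L l by (simp add: fm)
    then show "a divides\<^bsub>R\<^esub> b" using fc[of L l] L l * by auto
  next
    fix p assume "p \<in> P0 <+> Q"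
    then consider u where "u \<in> P0" "p = Inl u" | q where "q \<in> Q" "p = Inr q" by auto
    then show "\<exists>A. finite A \<and> A \<noteq> {} \<and> A \<subseteq> carrier R \<and> (\<forall>a\<in>A. p \<in># \<phi> a) \<and>
      (\<forall>q\<in>P0 <+> Q. \<exists>a\<in>A. count (\<phi> a) q = count {#p#} q)"
    proof cases
      case 1
      then have "\<phi> (f ({#u#}, \<one>\<^bsub>R\<^esub>)) = {#p#}" "f ({#u#}, \<one>\<^bsub>R\<^esub>) \<in> carrier R"
        using \<phi>[of "{#u#}" "\<one>\<^bsub>R\<^esub>"] K.map_one one fc by auto
      then show ?thesis by (intro exI[of _ "{f ({#u#}, \<one>\<^bsub>R\<^esub>)}"]) auto
    next
      case 2
      then obtain A where A: "K.is_gcd_set A {#q#}" using K.ex_is_gcd_set[of "{#q#}"] by auto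
      then have AK: "finite A" "A \<noteq> {}" "A \<subseteq> K" by (auto simp: K.is_gcd_set_def)
      have \<phi>A: "\<phi> (f ({#}, a)) = image_mset Inr (\<psi> a)" "f ({#}, a) \<in> carrier R" if "a \<in> A" for a
        using \<phi>[of "{#}" a] fc[of "{#}" a] that AK by auto
      show ?thesis
      proof (intro exI[of _ "(\<lambda>a. f ({#}, a)) ` A"] conjI ballI)
        fix z assume "z \<in> (\<lambda>a. f ({#}, a)) ` A"
        then obtain a where a: "a \<in> A" "z = f ({#}, a)" by auto
        then have "q \<in># \<psi> a" using A by (auto simp: K.is_gcd_set_def)
        then show "p \<in># \<phi> z" using a 2 \<phi>A by simp
      next
        fix r assume "r \<in> P0 <+> Q"
        then consider u where "u \<in> P0" "r = Inl u" | q' where "q' \<in> Q" "r = Inr q'" by auto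
        then show "\<exists>z\<in>(\<lambda>a. f ({#}, a)) ` A. count (\<phi> z) r = count {#p#} r"
        proof cases
          case 1
          obtain a where "a \<in> A" using AK by blast
          then show ?thesis using 1 2 \<phi>A[of a] count_image_Inl_Inr(1)[of "{#}" "\<psi> a" u]
            by (intro bexI[of _ "f ({#}, a)"]) auto
        next
          case r: 2
          then obtain a where "a \<in> A" "count (\<psi> a) q' = count {#q#} q'"
            using K.is_gcd_set_attained[OF A] by blast
          then show ?thesis using r 2 \<phi>A[of a] count_image_Inl_Inr(2)[of "{#}" "\<psi> a" q']
            by (intro bexI[of _ "f ({#}, a)"]) auto
        qed
      qed (use AK \<phi>A in auto)
    qed
  qed
  then show thesis
    by (rule that) (use \<phi> in \<open>simp add: f_def\<close>)
qed

section \<open>Class groups\<close>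

lemma lookup_free_embed [simp]: "Poly_Mapping.lookup (free_embed M) p = int (count M p)"
  by (induction M) (auto simp: free_embed_def lookup_add lookup_frag_of)

lemma keys_free_embed [simp]: "Poly_Mapping.keys (free_embed M) = set_mset M"
  by (auto simp: in_keys_iff)

lemma free_embed_add: "free_embed (M + N) = free_embed M + free_embed N"
  by (simp add: free_embed_def)

lemma free_embed_empty [simp]: "free_embed {#} = 0"
  by (simp add: free_embed_def)

lemma free_embed_eq_iff: "free_embed M = free_embed N \<longleftrightarrow> M = N"
  by (metis lookup_free_embed multiset_eqI of_nat_eq_iff)

lemma ex_free_embed_diff:
  assumes "Poly_Mapping.keys c \<subseteq> S"
  shows "\<exists>M N. set_mset M \<subseteq> S \<and> set_mset N \<subseteq> S \<and> c = free_embed M - free_embed N"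
  using assms
proof (induction c rule: frag_induction)
  case zero
  then show ?case by (intro exI[of _ "{#}"]) simp
next
  case (one x)
  then show ?case by (intro exI[of _ "{#x#}"] exI[of _ "{#}"]) (simp add: free_embed_def)
next
  case (diff a b)
  then obtain M N M' N' where "set_mset M \<subseteq> S" "set_mset N \<subseteq> S" "a = free_embed M - free_embed N"
    "set_mset M' \<subseteq> S" "set_mset N' \<subseteq> S" "b = free_embed M' - free_embed N'" by blast
  then show ?case by (intro exI[of _ "M + N'"] exI[of _ "N + M'"]) (simp add: free_embed_add)
qed

text \<open>Composition with \<open>\<gamma>\<close>, cut off outside \<open>S\<close>. For
  injective \<open>\<gamma>\<close> the support stays finite, and the map projects onto the
  coordinates in the image of \<open>\<gamma>\<close> and renames them; it serves to forget the
  prime divisors that come from prime elements.\<close>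

definition pull :: "'q set \<Rightarrow> ('q \<Rightarrow> 'p) \<Rightarrow> ('p \<Rightarrow>\<^sub>0 int) \<Rightarrow> ('q \<Rightarrow>\<^sub>0 int)" where
  "pull S \<gamma> c = Abs_poly_mapping (\<lambda>q. if q \<in> S then Poly_Mapping.lookup c (\<gamma> q) else 0)"

lemma lookup_pull:
  assumes "inj_on \<gamma> S"
  shows "Poly_Mapping.lookup (pull S \<gamma> c) q = (if q \<in> S then Poly_Mapping.lookup c (\<gamma> q) else 0)"
proof -
  have "finite (\<gamma> -` Poly_Mapping.keys c \<inter> S)"
    by (rule finite_vimage_IntI[OF finite_keys assms])
  then have "finite {q. (if q \<in> S then Poly_Mapping.lookup c (\<gamma> q) else 0) \<noteq> 0}"
    by (rule rev_finite_subset) (auto simp: in_keys_iff)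
  then show ?thesis by (simp add: pull_def lookup_Abs_poly_mapping)
qed

lemma keys_pull: "inj_on \<gamma> S \<Longrightarrow> Poly_Mapping.keys (pull S \<gamma> c) \<subseteq> S"
  by (auto simp: in_keys_iff lookup_pull split: if_splits)

section \<open>The class group and zero-sum sequences\<close>

context divisor_monoid
begin

abbreviation "K \<equiv> principal_group H \<phi>"
abbreviation "C \<equiv> class_group H P \<phi>"
abbreviation "F \<equiv> free_Abelian_group P"
abbreviation "cl c \<equiv> K #>\<^bsub>F\<^esub> c"

lemma principal_group_iff:
  "c \<in> K \<longleftrightarrow> (\<exists>a\<in>carrier H. \<exists>b\<in>carrier H. c = free_embed (\<phi> a) - free_embed (\<phi> b))"
  by (auto simp: principal_group_def)

lemma principal_group_lookup_iff:
  "c \<in> K \<longleftrightarrow> (\<exists>a\<in>carrier H. \<exists>b\<in>carrier H.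
    \<forall>p. Poly_Mapping.lookup c p = int (count (\<phi> a) p) - int (count (\<phi> b) p))"
  unfolding principal_group_iff
  by (intro bex_cong refl) (auto simp: poly_mapping_eq_iff lookup_minus fun_eq_iff)

lemma keys_principal: "c \<in> K \<Longrightarrow> Poly_Mapping.keys c \<subseteq> P"
  using map_closed keys_diff unfolding principal_group_iff
  by (metis (no_types, lifting) keys_free_embed Un_least order_trans)

lemma zero_principal: "0 \<in> K"
  unfolding principal_group_iff by (intro bexI[of _ \<one>]) auto

lemma add_principal: "\<lbrakk>c \<in> K; d \<in> K\<rbrakk> \<Longrightarrow> c + d \<in> K"
proof -
  assume "c \<in> K" "d \<in> K"
  then obtain a b a' b' where *: "a \<in> carrier H" "b \<in> carrier H" "c = free_embed (\<phi> a) - free_embed (\<phi> b)"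
    "a' \<in> carrier H" "b' \<in> carrier H" "d = free_embed (\<phi> a') - free_embed (\<phi> b')"
    by (auto simp: principal_group_iff)
  then have "c + d = free_embed (\<phi> (a \<otimes> a')) - free_embed (\<phi> (b \<otimes> b'))"
    by (simp add: map_mult free_embed_add)
  then show ?thesis using * by (auto simp: principal_group_iff)
qed

lemma minus_principal: "c \<in> K \<Longrightarrow> - c \<in> K"
  by (force simp: principal_group_iff)

lemma normal_principal: "K \<lhd> F"
proof -
  have "subgroup K F"
    by (rule group.subgroupI)
      (use zero_principal keys_principal add_principal minus_principal in auto)
  then show ?thesis
    by (rule comm_group.normal_iff_subgroup[OF abelian_free_Abelian_group, THEN iffD2])
qed

lemma comm_group_class_group: "comm_group C"
  unfolding class_group_def
  by (rule comm_group.abelian_FactGroup[OF abelian_free_Abelian_group])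
    (use normal_principal normal_imp_subgroup in blast)

lemma carrier_class_group: "carrier C = cl ` {c. Poly_Mapping.keys c \<subseteq> P}"
  by (simp add: class_group_def carrier_FactGroup) auto

lemma cl_closed: "Poly_Mapping.keys c \<subseteq> P \<Longrightarrow> cl c \<in> carrier C"
  by (auto simp: carrier_class_group)

lemma cl_mult:
  assumes "Poly_Mapping.keys c \<subseteq> P" "Poly_Mapping.keys d \<subseteq> P"
  shows "cl c \<otimes>\<^bsub>C\<^esub> cl d = cl (c + d)"
  using normal.rcos_sum[OF normal_principal, of c d] assms by (simp add: class_group_def)

lemma cl_eq_one_iff: "Poly_Mapping.keys c \<subseteq> P \<Longrightarrow> cl c = \<one>\<^bsub>C\<^esub> \<longleftrightarrow> c \<in> K"
proof -
  assume c: "Poly_Mapping.keys c \<subseteq> P"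
  have sub: "subgroup K F" using normal_principal by (rule normal_imp_subgroup)
  have "cl c = K \<longleftrightarrow> c \<in> K"
    using group.coset_join1[OF group_free_Abelian_group _ _ sub, of c]
      group.coset_join2[OF group_free_Abelian_group _ sub, of c] c keys_principal
    by auto
  then show ?thesis by (simp add: class_group_def)
qed

lemma cl_zero: "cl 0 = \<one>\<^bsub>C\<^esub>"
  using cl_eq_one_iff[of 0] zero_principal by simp

lemma cl_eq_iff:
  assumes "Poly_Mapping.keys c \<subseteq> P" "Poly_Mapping.keys d \<subseteq> P"
  shows "cl c = cl d \<longleftrightarrow> c - d \<in> K"
proof -
  interpret C: comm_group C by (rule comm_group_class_group)
  have k: "Poly_Mapping.keys (c - d) \<subseteq> P" using assms keys_diff[of c d] by blast
  have "cl c = cl (c - d) \<otimes>\<^bsub>C\<^esub> cl d" using cl_mult[OF k assms(2)] by simp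
  then have "cl c = cl d \<longleftrightarrow> cl (c - d) = \<one>\<^bsub>C\<^esub>"
    using C.l_cancel_one cl_closed assms k by auto
  then show ?thesis using cl_eq_one_iff[OF k] by simp
qed

lemma divisor_class_eq: "divisor_class H P \<phi> p = cl (frag_of p)"
  by (simp add: divisor_class_def)

text \<open>If an effective divisor is a difference of images, then the subtracted one is contained
  in the other; the divisor homomorphism turns this into divisibility in \<open>H\<close>, and the
  quotient is the required element.\<close>

lemma free_embed_principal_iff:
  assumes "set_mset M \<subseteq> P"
  shows "free_embed M \<in> K \<longleftrightarrow> M \<in> \<phi> ` carrier H"
proof
  assume "free_embed M \<in> K"
  then obtain a b where ab: "a \<in> carrier H" "b \<in> carrier H" "free_embed M = free_embed (\<phi> a) - free_embed (\<phi> b)"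
    by (auto simp: principal_group_iff)
  then have "free_embed (\<phi> b + M) = free_embed (\<phi> a)" by (simp add: free_embed_add)
  then have eq: "\<phi> b + M = \<phi> a" by (simp add: free_embed_eq_iff)
  then have "b divides a" using ab map_subset_iff[of b a] by (metis mset_subset_eq_add_left)
  then obtain c where "c \<in> carrier H" "a = b \<otimes> c" by (auto simp: factor_def)
  then have "M = \<phi> c" using eq ab by (simp add: map_mult)
  with \<open>c \<in> carrier H\<close> show "M \<in> \<phi> ` carrier H" by blast
next
  assume "M \<in> \<phi> ` carrier H"
  then show "free_embed M \<in> K" by (force simp: principal_group_iff map_one intro: bexI[of _ \<one>])
qed

lemma mset_prod_class:
  assumes "set_mset M \<subseteq> P"
  shows "mset_prod C (image_mset (divisor_class H P \<phi>) M) = cl (free_embed M)"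
proof -
  interpret C: comm_group C by (rule comm_group_class_group)
  show ?thesis using assms
  proof (induction M)
    case empty
    then show ?case by (simp add: cl_zero)
  next
    case (add p M)
    have "set_mset (image_mset (divisor_class H P \<phi>) M) \<subseteq> carrier C"
      using add.prems by (auto simp: divisor_class_eq intro!: cl_closed)
    then have "mset_prod C (image_mset (divisor_class H P \<phi>) (add_mset p M)) =
        cl (frag_of p) \<otimes>\<^bsub>C\<^esub> cl (free_embed M)"
      using add by (simp add: divisor_class_eq[of p] cl_closed)
    also have "\<dots> = cl (frag_of p + free_embed M)"
      using add.prems by (intro cl_mult) auto
    finally show ?case by (simp add: free_embed_def)
  qed
qed

text \<open>With one prime divisor in each class, the free monoid on the prime divisors is the one
  on the classes, and the image of \<open>H\<close> consists of the divisors of trivial class. The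
  embedding is injective because elements with equal divisors are associated, hence equal in a
  reduced monoid.\<close>

lemma iso_zero_sum_monoid:
  assumes cancel: "comm_monoid_cancel H" and red: "Units H = {\<one>}"
    and inj: "inj_on (divisor_class H P \<phi>) P"
  shows "H \<cong> zero_sum_monoid C (divisor_class H P \<phi> ` P)"
proof -
  interpret comm_monoid_cancel H by fact
  let ?cls = "divisor_class H P \<phi>"
  let ?Z = "zero_sum_monoid C (?cls ` P)"
  have Z: "carrier ?Z = {S. set_mset S \<subseteq> ?cls ` P \<and> mset_prod C S = \<one>\<^bsub>C\<^esub>}"
    and Zm: "\<And>S T. S \<otimes>\<^bsub>?Z\<^esub> T = S + T"
    by (auto simp: zero_sum_monoid_def free_monoid_def)
  have inverse: "image_mset (inv_into P ?cls) (image_mset ?cls M) = M" if "set_mset M \<subseteq> P" for M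
  proof -
    have "image_mset (\<lambda>x. inv_into P ?cls (?cls x)) M = image_mset (\<lambda>x. x) M"
      by (rule image_mset_cong) (use that inj in auto)
    then show ?thesis by (simp add: image_mset.compositionality comp_def)
  qed
  define f where "f h = image_mset ?cls (\<phi> h)" for h
  have "f \<in> hom H ?Z"
  proof -
    have "f h \<in> carrier ?Z" if "h \<in> carrier H" for h
    proof -
      have "free_embed (\<phi> h) \<in> K" using that map_closed by (simp add: free_embed_principal_iff)
      then have "mset_prod C (f h) = \<one>\<^bsub>C\<^esub>"
        using that map_closed[of h] by (simp add: f_def mset_prod_class cl_eq_one_iff)
      then show ?thesis using that map_closed[of h] by (auto simp: Z f_def)
    qed
    then show ?thesis by (auto simp: hom_def Zm f_def map_mult)
  qed
  moreover have "inj_on f (carrier H)"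
  proof (rule inj_onI)
    fix x y assume xy: "x \<in> carrier H" "y \<in> carrier H" "f x = f y"
    then have "\<phi> x = \<phi> y" using inverse map_closed by (metis f_def)
    then have "x divides y" "y divides x" using xy map_subset_iff[of x y] map_subset_iff[of y x] by auto
    then have "x \<sim> y" by (simp add: associated_def)
    then obtain u where "u \<in> Units H" "x = y \<otimes> u" using xy by (elim associatedE2) auto
    then show "x = y" using red xy by simp
  qed
  moreover have "f ` carrier H = carrier ?Z"
  proof (intro equalityI subsetI)
    fix S assume "S \<in> f ` carrier H"
    then show "S \<in> carrier ?Z" using \<open>f \<in> hom H ?Z\<close> by (auto simp: hom_def)
  next
    fix S assume S: "S \<in> carrier ?Z"
    define M where "M = image_mset (inv_into P ?cls) S"
    have M: "set_mset M \<subseteq> P" using S by (auto simp: M_def Z intro: inv_into_into)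
    have "image_mset (\<lambda>x. ?cls (inv_into P ?cls x)) S = image_mset (\<lambda>x. x) S"
      by (rule image_mset_cong) (use S in \<open>auto simp: Z f_inv_into_f subset_iff\<close>)
    then have SM: "S = image_mset ?cls M" by (simp add: M_def image_mset.compositionality comp_def)
    then have "cl (free_embed M) = \<one>\<^bsub>C\<^esub>" using S M by (simp add: Z mset_prod_class)
    then have "M \<in> \<phi> ` carrier H" using M by (simp add: cl_eq_one_iff free_embed_principal_iff)
    then show "S \<in> f ` carrier H" by (auto simp: SM f_def)
  qed
  ultimately show ?thesis by (auto simp: is_iso_def iso_def bij_betw_def)
qed

end

text \<open>\<open>pull P' \<gamma>\<close> maps the first free abelian group onto the second, and
  \<open>principal\<close> says that the preimage of the second principal group is the first one;
  the isomorphism theorem does the rest.\<close>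

lemma class_group_iso:
  assumes D: "divisor_monoid H P \<phi>" and E: "divisor_monoid H' P' \<phi>'"
    and \<gamma>: "inj_on \<gamma> P'" "\<gamma> ` P' \<subseteq> P"
    and principal: "\<And>c. Poly_Mapping.keys c \<subseteq> P \<Longrightarrow>
      c \<in> principal_group H \<phi> \<longleftrightarrow> pull P' \<gamma> c \<in> principal_group H' \<phi>'"
  shows "class_group H P \<phi> \<cong> class_group H' P' \<phi>'"
proof -
  interpret D: divisor_monoid H P \<phi> by fact
  interpret E: divisor_monoid H' P' \<phi>' by fact
  interpret C': comm_group E.C by (rule E.comm_group_class_group)
  define h where "h c = E.cl (pull P' \<gamma> c)" for c
  have add: "pull P' \<gamma> (c + d) = pull P' \<gamma> c + pull P' \<gamma> d" for c d
    by (rule poly_mapping_eqI) (simp add: lookup_pull[OF \<gamma>(1)] lookup_add)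
  note k = keys_pull[OF \<gamma>(1)]
  have hom: "h \<in> hom D.F E.C"
    by (auto simp: hom_def h_def E.cl_closed E.cl_mult k add)
  interpret h: group_hom D.F E.C h
    by (intro group_hom.intro group_hom_axioms.intro hom) (auto intro: C'.is_group)
  have "h ` carrier D.F = carrier E.C"
  proof (intro equalityI subsetI)
    fix x assume "x \<in> carrier E.C"
    then obtain c where c: "Poly_Mapping.keys c \<subseteq> P'" "x = E.cl c"
      by (auto simp: E.carrier_class_group)
    \<comment> \<open>The preimage of \<open>c\<close> is its extension by zero along the inverse of
      \<open>\<gamma>\<close>.\<close>
    define d where "d = pull (\<gamma> ` P') (inv_into P' \<gamma>) c"
    have inj: "inj_on (inv_into P' \<gamma>) (\<gamma> ` P')" by (rule inj_on_inv_into) simp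
    have "pull P' \<gamma> d = c"
      by (rule poly_mapping_eqI)
        (use c(1) in \<open>auto simp: lookup_pull[OF \<gamma>(1)] d_def lookup_pull[OF inj] \<gamma>(1) in_keys_iff subset_iff\<close>)
    moreover have "Poly_Mapping.keys d \<subseteq> P" using keys_pull[OF inj, of c] \<gamma>(2) by (auto simp: d_def)
    ultimately show "x \<in> h ` carrier D.F" using c(2) by (auto simp: h_def image_iff)
  qed (use hom in \<open>auto simp: hom_def Pi_def\<close>)
  moreover have "kernel D.F E.C h = D.K"
  proof (rule Set.set_eqI)
    fix c
    have "c \<in> kernel D.F E.C h \<longleftrightarrow> Poly_Mapping.keys c \<subseteq> P \<and> pull P' \<gamma> c \<in> E.K"
      by (auto simp: kernel_def h_def E.cl_eq_one_iff k)
    then show "c \<in> kernel D.F E.C h \<longleftrightarrow> c \<in> D.K" using principal D.keys_principal by blast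
  qed
  ultimately show ?thesis using h.FactGroup_iso by (simp add: class_group_def)
qed

text \<open>The prime divisors belonging to \<open>P0\<close> are principal, so forgetting their
  coordinates does not change the quotient. The given divisor theory on \<open>P\<close> is first
  matched with the one on the disjoint sum.\<close>

lemma class_group_free_times:
  fixes P :: "'p set"
  assumes D: "divisor_monoid R P \<phi>" and K: "divisor_monoid (R\<lparr>carrier := S\<rparr>) Q \<psi>"
    and iso: "(\<lambda>(M, h). mset_prod R M \<otimes>\<^bsub>R\<^esub> h) \<in> iso (free_monoid P0 \<times>\<times> R\<lparr>carrier := S\<rparr>) R"
  shows "class_group R P \<phi> \<cong> class_group (R\<lparr>carrier := S\<rparr>) Q \<psi>"
proof -
  interpret D: divisor_monoid R P \<phi> by fact
  interpret K: divisor_monoid "R\<lparr>carrier := S\<rparr>" Q \<psi> by fact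
  let ?f = "\<lambda>M h. mset_prod R M \<otimes>\<^bsub>R\<^esub> h"
  obtain \<phi>' where D': "divisor_monoid R (P0 <+> Q) \<phi>'"
    and \<phi>': "\<And>M h. \<lbrakk>set_mset M \<subseteq> P0; h \<in> S\<rbrakk> \<Longrightarrow> \<phi>' (?f M h) = image_mset Inl M + image_mset Inr (\<psi> h)"
    by (rule divisor_monoid_free_times[OF K D.comm_monoid_axioms iso]) (rule that)
  obtain \<beta> where \<beta>: "bij_betw \<beta> (P0 <+> Q) P"
    "\<And>x p. \<lbrakk>x \<in> carrier R; p \<in> P0 <+> Q\<rbrakk> \<Longrightarrow> count (\<phi>' x) p = count (\<phi> x) (\<beta> p)"
    by (rule divisor_theory_unique[OF D' D]) (rule that)
  have fc: "?f M h \<in> carrier R" if "set_mset M \<subseteq> P0" "h \<in> S" for M h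
    using iso that by (auto simp: iso_def hom_def DirProd_def Pi_def)
  have surj: "\<exists>M h. set_mset M \<subseteq> P0 \<and> h \<in> S \<and> x = ?f M h" if "x \<in> carrier R" for x
  proof -
    have "x \<in> (\<lambda>(M, h). ?f M h) ` carrier (free_monoid P0 \<times>\<times> R\<lparr>carrier := S\<rparr>)"
      using iso that by (simp add: iso_def bij_betw_def)
    then show ?thesis by (auto simp: DirProd_def)
  qed
  have cl: "count M u = count (\<phi> (?f M h)) (\<beta> (Inl u))"
    if "set_mset M \<subseteq> P0" "h \<in> S" "u \<in> P0" for M h u
    using \<beta>(2)[OF fc[OF that(1,2)] InlI[OF that(3)]] that by (simp add: \<phi>' del: count_union)
  have cr: "count (\<psi> h) q = count (\<phi> (?f M h)) (\<beta> (Inr q))"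
    if "set_mset M \<subseteq> P0" "h \<in> S" "q \<in> Q" for M h q
    using \<beta>(2)[OF fc[OF that(1,2)] InrI[OF that(3)]] that by (simp add: \<phi>' del: count_union)
  have inj: "inj_on (\<lambda>q. \<beta> (Inr q)) Q" "inj_on (\<lambda>u. \<beta> (Inl u)) P0"
    using \<beta>(1) by (auto simp: bij_betw_def inj_on_def)
  have img: "\<beta> ` (P0 <+> Q) = P" using \<beta>(1) by (simp add: bij_betw_def)
  show ?thesis
  proof (rule class_group_iso[OF D K inj(1)])
    show "(\<lambda>q. \<beta> (Inr q)) ` Q \<subseteq> P" using img by auto
  next
    fix c :: "'p \<Rightarrow>\<^sub>0 int" assume c: "Poly_Mapping.keys c \<subseteq> P"
    let ?c = "pull Q (\<lambda>q. \<beta> (Inr q)) c"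
    show "c \<in> D.K \<longleftrightarrow> ?c \<in> K.K"
    proof
      assume "c \<in> D.K"
      then obtain a b where ab: "a \<in> carrier R" "b \<in> carrier R"
        "\<And>p. Poly_Mapping.lookup c p = int (count (\<phi> a) p) - int (count (\<phi> b) p)"
        by (auto simp: D.principal_group_lookup_iff)
      obtain M h where 1: "set_mset M \<subseteq> P0" "h \<in> S" "a = ?f M h" using surj ab by blast
      obtain N k where 2: "set_mset N \<subseteq> P0" "k \<in> S" "b = ?f N k" using surj ab by blast
      have "Poly_Mapping.lookup ?c q = int (count (\<psi> h) q) - int (count (\<psi> k) q)" for q
      proof (cases "q \<in> Q")
        case True
        then show ?thesis using cr[OF 1(1,2) True] cr[OF 2(1,2) True] 1(3) 2(3) ab(3) by (simp add: lookup_pull[OF inj(1)])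
      next
        case False
        then have "q \<notin># \<psi> h" "q \<notin># \<psi> k" using K.map_closed 1 2 by auto
        then show ?thesis using False by (simp add: lookup_pull[OF inj(1)] not_in_iff)
      qed
      then show "?c \<in> K.K" using 1 2 by (auto simp: K.principal_group_lookup_iff)
    next
      assume "?c \<in> K.K"
      then obtain h k where hk: "h \<in> S" "k \<in> S"
        "\<And>q. Poly_Mapping.lookup ?c q = int (count (\<psi> h) q) - int (count (\<psi> k) q)"
        by (auto simp: K.principal_group_lookup_iff)
      \<comment> \<open>The coordinates at \<open>P0\<close> are arbitrary integers; written as a
        difference of multisets \<open>M\<close> and \<open>N\<close> they are supplied by the free
        parts of the two elements.\<close>
      let ?d = "pull P0 (\<lambda>u. \<beta> (Inl u)) c"
      obtain M N where MN: "set_mset M \<subseteq> P0" "set_mset N \<subseteq> P0" "?d = free_embed M - free_embed N"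
        using ex_free_embed_diff[OF keys_pull[OF inj(2)]] by blast
      have "Poly_Mapping.lookup c p = int (count (\<phi> (?f M h)) p) - int (count (\<phi> (?f N k)) p)" for p
      proof (cases "p \<in> P")
        case True
        then consider u where "u \<in> P0" "p = \<beta> (Inl u)" | q where "q \<in> Q" "p = \<beta> (Inr q)"
          using img by auto
        then show ?thesis
        proof cases
          case 1
          then have "Poly_Mapping.lookup c p = Poly_Mapping.lookup ?d u" by (simp add: lookup_pull[OF inj(2)])
          then show ?thesis using cl[OF MN(1) hk(1) 1(1)] cl[OF MN(2) hk(2) 1(1)] 1(2)
            by (simp add: MN(3) lookup_minus)
        next
          case 2
          then have "Poly_Mapping.lookup c p = Poly_Mapping.lookup ?c q" by (simp add: lookup_pull[OF inj(1)])
          then show ?thesis using cr[OF MN(1) hk(1) 2(1)] cr[OF MN(2) hk(2) 2(1)] 2(2) hk(3) by simp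
        qed
      next
        case False
        then have "p \<notin># \<phi> (?f M h)" "p \<notin># \<phi> (?f N k)" "p \<notin> Poly_Mapping.keys c"
          using D.map_closed[OF fc] MN hk c by blast+
        then show ?thesis by (simp add: not_in_iff in_keys_iff)
      qed
      then show "c \<in> D.K"
        unfolding D.principal_group_lookup_iff using fc MN hk by blast
    qed
  qed
qed

section \<open>Finitely generated abelian groups\<close>

lemma (in comm_group) generate_finite_family:
  assumes "finite J" "f ` J \<subseteq> carrier G"
  shows "generate G (f ` J) = range (\<lambda>m :: _ \<Rightarrow> int. \<Otimes>j\<in>J. f j [^] m j)"
proof -
  have f: "f j \<in> carrier G" if "j \<in> J" for j using assms that by auto
  have sub: "subgroup (range (\<lambda>m :: _ \<Rightarrow> int. \<Otimes>j\<in>J. f j [^] m j)) G" (is "subgroup ?S G")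
  proof (rule subgroup.intro)
    show "?S \<subseteq> carrier G" using f by (auto intro!: finprod_closed)
    show "\<one> \<in> ?S"
    proof (rule range_eqI)
      show "\<one> = (\<Otimes>j\<in>J. f j [^] ((\<lambda>_. 0) j :: int))" by simp
    qed
  next
    fix x y assume "x \<in> ?S" "y \<in> ?S"
    then obtain m m' :: "_ \<Rightarrow> int" where "x = (\<Otimes>j\<in>J. f j [^] m j)" "y = (\<Otimes>j\<in>J. f j [^] m' j)" by blast
    then have "x \<otimes> y = (\<Otimes>j\<in>J. f j [^] m j \<otimes> f j [^] m' j)"
      using f by (subst finprod_multf) auto
    also have "\<dots> = (\<Otimes>j\<in>J. f j [^] (m j + m' j))"
      by (rule finprod_cong') (use f in \<open>auto simp: int_pow_mult\<close>)
    finally show "x \<otimes> y \<in> ?S" by (auto intro: range_eqI[of _ _ "\<lambda>j. m j + m' j"])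
  next
    fix x assume "x \<in> ?S"
    then obtain m :: "_ \<Rightarrow> int" where x: "x = (\<Otimes>j\<in>J. f j [^] m j)" by blast
    have "(\<Otimes>j\<in>J. f j [^] (- m j)) \<otimes> x = (\<Otimes>j\<in>J. f j [^] (- m j) \<otimes> f j [^] m j)"
      unfolding x using f by (subst finprod_multf) auto
    also have "\<dots> = (\<Otimes>j\<in>J. \<one>)"
      by (rule finprod_cong') (use f in \<open>auto simp: int_pow_mult[symmetric]\<close>)
    finally have "inv x = (\<Otimes>j\<in>J. f j [^] (- m j))"
      using f x by (intro inv_equality) (auto intro!: finprod_closed)
    then show "inv x \<in> ?S" by (auto intro: range_eqI[of _ _ "\<lambda>j. - m j"])
  qed
  show ?thesis
  proof (rule generateI[symmetric, OF sub])
    show "f ` J \<subseteq> ?S"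
    proof
      fix x assume "x \<in> f ` J"
      then obtain j where j: "j \<in> J" "x = f j" by blast
      have "(\<Otimes>i\<in>J. f i [^] (if i = j then 1 else 0 :: int)) = (\<Otimes>i\<in>J. if j = i then f i else \<one>)"
        by (rule finprod_cong') (use f in \<open>auto simp: int_pow_1\<close>)
      also have "\<dots> = f j" by (rule finprod_singleton) (use j assms f in auto)
      finally show "x \<in> ?S" using j by (auto intro: range_eqI[of _ _ "\<lambda>i. if i = j then 1 else 0"])
    qed
  next
    fix K assume K: "subgroup K G" "f ` J \<subseteq> K"
    show "?S \<subseteq> K"
    proof
      fix x assume "x \<in> ?S"
      then obtain m :: "_ \<Rightarrow> int" where x: "x = (\<Otimes>j\<in>J. f j [^] m j)" by blast
      have "(\<Otimes>j\<in>I. f j [^] m j) \<in> K" if "finite I" "I \<subseteq> J" for I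
        using that
      proof (induction I rule: finite_induct)
        case empty
        then show ?case using subgroup.one_closed[OF K(1)] by simp
      next
        case (insert i I)
        then have "f i [^] m i \<in> K" using subgroup_int_pow_closed[OF K(1)] K(2) by auto
        moreover have "(\<Otimes>j\<in>insert i I. f j [^] m j) = f i [^] m i \<otimes> (\<Otimes>j\<in>I. f j [^] m j)"
          using insert f by (intro finprod_insert) auto
        ultimately show ?case using insert subgroup.m_closed[OF K(1)] by auto
      qed
      then show "x \<in> K" using x assms by simp
    qed
  qed
qed

text \<open>Injectivity of the product map is reduced to a trivial kernel by dividing families
  pointwise. The condition \<open>triv\<close> ranges over \<open>Pi\<close>, since the quotient of
  two extensional families need not be extensional.\<close>

lemma (in comm_group) internal_direct_sumI:
  assumes "finite I" and sub: "\<And>i. i \<in> I \<Longrightarrow> subgroup (A i) G"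
    and T: "T = (\<lambda>x. \<Otimes>i\<in>I. x i) ` (\<Pi>\<^sub>E i\<in>I. A i)"
    and triv: "\<And>x i. \<lbrakk>x \<in> (\<Pi> i\<in>I. A i); (\<Otimes>i\<in>I. x i) = \<one>; i \<in> I\<rbrakk> \<Longrightarrow> x i = \<one>"
  shows "internal_direct_sum G I A T"
proof -
  have "inj_on (\<lambda>x. \<Otimes>i\<in>I. x i) (\<Pi>\<^sub>E i\<in>I. A i)"
  proof (rule inj_onI)
    fix x y assume x: "x \<in> (\<Pi>\<^sub>E i\<in>I. A i)" and y: "y \<in> (\<Pi>\<^sub>E i\<in>I. A i)"
      and eq: "(\<Otimes>i\<in>I. x i) = (\<Otimes>i\<in>I. y i)"
    define z where "z i = x i \<otimes> inv y i" for i
    have xi: "x i \<in> A i" "y i \<in> A i" "x i \<in> carrier G" "y i \<in> carrier G" if "i \<in> I" for i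
      using x y subgroup.subset[OF sub[OF that]] that by auto
    have zA: "z \<in> (\<Pi> i\<in>I. A i)" 
      unfolding z_def
      by (intro Pi_I subgroup.m_closed[OF sub] subgroup.m_inv_closed[OF sub] xi)
    have zc: "z i \<in> carrier G" if "i \<in> I" for i using xi that by (simp add: z_def)
    have "(\<Otimes>i\<in>I. z i) \<otimes> (\<Otimes>i\<in>I. y i) = (\<Otimes>i\<in>I. z i \<otimes> y i)"
      using zc xi by (subst finprod_multf) auto
    also have "\<dots> = (\<Otimes>i\<in>I. x i)"
      by (rule finprod_cong') (use xi in \<open>auto simp: z_def m_assoc\<close>)
    finally have "(\<Otimes>i\<in>I. z i) \<otimes> (\<Otimes>i\<in>I. y i) = (\<Otimes>i\<in>I. y i)" using eq by simp
    moreover have "(\<Otimes>i\<in>I. z i) \<in> carrier G" "(\<Otimes>i\<in>I. y i) \<in> carrier G"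
      using xi zc by (auto intro!: finprod_closed)
    ultimately have "(\<Otimes>i\<in>I. z i) = \<one>" by (metis l_one one_closed r_cancel)
    then have "z i = \<one>" if "i \<in> I" for i using triv[OF zA] that by blast
    then have "x i = y i" if "i \<in> I" for i
      using xi[OF that] that by (metis inv_solve_right l_one one_closed z_def)
    then show "x = y" using x y by (rule_tac PiE_ext) auto
  qed
  then show ?thesis using sub T by (simp add: internal_direct_sum_def bij_betw_def)
qed

lemma (in comm_group) independent_familyI:
  assumes "finite I" and f: "\<And>i. i \<in> I \<Longrightarrow> f i \<in> carrier G" "\<And>i. i \<in> I \<Longrightarrow> f i \<noteq> \<one>"
    and triv: "\<And>(m :: _ \<Rightarrow> int) i. \<lbrakk>(\<Otimes>i\<in>I. f i [^] m i) = \<one>; i \<in> I\<rbrakk> \<Longrightarrow> f i [^] m i = \<one>"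
  shows "independent_family G I f"
proof -
  have gen1: "generate G {f i} = range (\<lambda>m :: int. f i [^] m)" if "i \<in> I" for i
    using generate_pow[OF f(1)[OF that]] by auto
  have "internal_direct_sum G I (\<lambda>i. generate G {f i}) (generate G (f ` I))"
  proof (rule internal_direct_sumI[OF assms(1)])
    fix i assume "i \<in> I"
    then show "subgroup (generate G {f i}) G" using f by (intro generate_is_subgroup) auto
  next
    have "generate G (f ` I) = range (\<lambda>m :: _ \<Rightarrow> int. \<Otimes>j\<in>I. f j [^] m j)"
      using f by (intro generate_finite_family assms(1)) auto
    also have "\<dots> = (\<lambda>x. \<Otimes>i\<in>I. x i) ` (\<Pi>\<^sub>E i\<in>I. generate G {f i})"
    proof (intro equalityI subsetI)
      fix x assume "x \<in> range (\<lambda>m :: _ \<Rightarrow> int. \<Otimes>j\<in>I. f j [^] m j)"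
      then obtain m :: "_ \<Rightarrow> int" where x: "x = (\<Otimes>j\<in>I. f j [^] m j)" by blast
      have "x = (\<Otimes>i\<in>I. (\<lambda>i\<in>I. f i [^] m i) i)"
        unfolding x by (rule finprod_cong') (use f in auto)
      moreover have "(\<lambda>i\<in>I. f i [^] m i) \<in> (\<Pi>\<^sub>E i\<in>I. generate G {f i})" using gen1 by auto
      ultimately show "x \<in> (\<lambda>x. \<Otimes>i\<in>I. x i) ` (\<Pi>\<^sub>E i\<in>I. generate G {f i})" by (rule image_eqI)
    next
      fix x assume "x \<in> (\<lambda>x. \<Otimes>i\<in>I. x i) ` (\<Pi>\<^sub>E i\<in>I. generate G {f i})"
      then obtain y where y: "y \<in> (\<Pi>\<^sub>E i\<in>I. generate G {f i})" "x = (\<Otimes>i\<in>I. y i)" by blast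
      then have "\<forall>i\<in>I. \<exists>m :: int. y i = f i [^] m" using gen1 by (auto simp: PiE_iff)
      then obtain m :: "_ \<Rightarrow> int" where m: "\<And>i. i \<in> I \<Longrightarrow> y i = f i [^] m i" by metis
      have "x = (\<Otimes>i\<in>I. f i [^] m i)" unfolding y(2) by (rule finprod_cong') (use f m in auto)
      then show "x \<in> range (\<lambda>m :: _ \<Rightarrow> int. \<Otimes>j\<in>I. f j [^] m j)" by blast
    qed
    finally show "generate G (f ` I) = (\<lambda>x. \<Otimes>i\<in>I. x i) ` (\<Pi>\<^sub>E i\<in>I. generate G {f i})" .
  next
    fix x i assume x: "x \<in> (\<Pi> i\<in>I. generate G {f i})" "(\<Otimes>i\<in>I. x i) = \<one>" and i: "i \<in> I"
    then have "\<forall>i\<in>I. \<exists>m :: int. x i = f i [^] m" using gen1 by (metis Pi_mem imageE)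
    then obtain m :: "_ \<Rightarrow> int" where m: "\<And>i. i \<in> I \<Longrightarrow> x i = f i [^] m i" by metis
    have "(\<Otimes>i\<in>I. f i [^] m i) = (\<Otimes>i\<in>I. x i)" by (rule finprod_cong') (use f m in auto)
    then show "x i = \<one>" using triv[of m i] x(2) i m by simp
  qed
  then show ?thesis using f by (simp add: independent_family_def)
qed

text \<open>An automorphism of the integer vectors with indices 0 to \<open>t\<close>, encoded on
  all functions; the third conjunct keeps entries beyond \<open>t\<close> from influencing the
  relevant coordinates. The last two conjuncts prescribe the image of the vector
  \<open>s\<close>.\<close>

definition unimodular_for :: "(nat \<Rightarrow> nat) \<Rightarrow> nat \<Rightarrow> ((nat \<Rightarrow> int) \<Rightarrow> nat \<Rightarrow> int) \<Rightarrow> bool" where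
  "unimodular_for s t f \<longleftrightarrow>
    (\<forall>a b. f (\<lambda>j. a j + b j) = (\<lambda>j. f a j + f b j)) \<and>
    (\<forall>c a. f (\<lambda>j. c * a j) = (\<lambda>j. c * f a j)) \<and>
    (\<forall>a b. (\<forall>j\<le>t. a j = b j) \<longrightarrow> (\<forall>j\<le>t. f a j = f b j)) \<and>
    (\<forall>a. (\<forall>j\<le>t. f a j = 0) \<longrightarrow> (\<forall>j\<le>t. a j = 0)) \<and>
    (\<forall>b. \<exists>a. \<forall>j\<le>t. f a j = b j) \<and>
    f (\<lambda>j. int (s j)) 0 = int (Gcd (s ` {0..t})) \<and>
    (\<forall>j\<in>{1..t}. f (\<lambda>j. int (s j)) j = 0)"

lemma unimodular_forD:
  assumes "unimodular_for s t f"
  shows "f (\<lambda>j. a j + b j) = (\<lambda>j. f a j + f b j)"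
    and "f (\<lambda>j. c * a j) = (\<lambda>j. c * f a j)"
    and "\<lbrakk>\<And>j. j \<le> t \<Longrightarrow> a j = b j; i \<le> t\<rbrakk> \<Longrightarrow> f a i = f b i"
    and "\<lbrakk>\<And>j. j \<le> t \<Longrightarrow> f a j = 0; i \<le> t\<rbrakk> \<Longrightarrow> a i = 0"
    and "\<exists>a. \<forall>j\<le>t. f a j = b j"
    and "f (\<lambda>j. int (s j)) 0 = int (Gcd (s ` {0..t}))"
    and "i \<in> {1..t} \<Longrightarrow> f (\<lambda>j. int (s j)) i = 0"
proof -
  note f = assms[unfolded unimodular_for_def]
  show "f (\<lambda>j. a j + b j) = (\<lambda>j. f a j + f b j)" using f by simp
  show "f (\<lambda>j. c * a j) = (\<lambda>j. c * f a j)" using f by simp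
  show "\<lbrakk>\<And>j. j \<le> t \<Longrightarrow> a j = b j; i \<le> t\<rbrakk> \<Longrightarrow> f a i = f b i" using f by blast
  show "\<lbrakk>\<And>j. j \<le> t \<Longrightarrow> f a j = 0; i \<le> t\<rbrakk> \<Longrightarrow> a i = 0" using f by blast
  show "\<exists>a. \<forall>j\<le>t. f a j = b j" using f by simp
  show "f (\<lambda>j. int (s j)) 0 = int (Gcd (s ` {0..t}))" using f by simp
  show "i \<in> {1..t} \<Longrightarrow> f (\<lambda>j. int (s j)) i = 0" using f by simp
qed

text \<open>A unimodular change of coordinates of \<open>\<int>\<^bsup>t+1\<^esup>\<close> that maps \<open>(s 0, \<dots>, s t)\<close> to
  \<open>(n, 0, \<dots>, 0)\<close>, by Bezout's identity applied to one further coordinate at a time.\<close>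

lemma ex_unimodular:
  assumes "s 0 > 0"
  shows "\<exists>f. unimodular_for s t f"
proof (induction t)
  case 0
  show ?case by (rule exI[of _ "\<lambda>a. a"]) (auto simp: unimodular_for_def)
next
  case (Suc t)
  then obtain f where f: "unimodular_for s t f" by blast
  note add = unimodular_forD(1)[OF f] and scale = unimodular_forD(2)[OF f]
    and dep = unimodular_forD(3)[OF f] and inj = unimodular_forD(4)[OF f]
    and surj = unimodular_forD(5)[OF f] and s0 = unimodular_forD(6)[OF f]
    and sj = unimodular_forD(7)[OF f]
  define n where "n = int (Gcd (s ` {0..t}))"
  define r where "r = int (s (Suc t))"
  have "Gcd (s ` {0..t}) dvd s 0" by (rule Gcd_dvd) auto
  then have n: "n > 0" using assms dvd_pos_nat[of "s 0"] unfolding n_def by simp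
  define d where "d = gcd n r"
  have d: "d > 0" using n by (simp add: d_def)
  obtain \<alpha> \<beta> where bez: "\<alpha> * n + \<beta> * r = d" using bezout_int[of n r] by (auto simp: d_def)
  obtain \<nu> where \<nu>: "n = d * \<nu>" by (metis d_def dvdE gcd_dvd1)
  obtain \<sigma> where \<sigma>: "r = d * \<sigma>" by (metis d_def dvdE gcd_dvd2)
  have "d * (\<alpha> * \<nu> + \<beta> * \<sigma>) = d * 1" using bez by (simp add: \<nu> \<sigma> algebra_simps)
  then have det: "\<alpha> * \<nu> + \<beta> * \<sigma> = 1" using d by simp
  have Gcd: "int (Gcd (s ` {0..Suc t})) = d"
  proof -
    have "s ` {0..Suc t} = insert (s (Suc t)) (s ` {0..t})" by (auto simp: atLeast0_atMost_Suc)
    then have "Gcd (s ` {0..Suc t}) = gcd (Gcd (s ` {0..t})) (s (Suc t))"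
      by (simp only: Gcd_insert gcd.commute)
    then show ?thesis unfolding d_def n_def r_def by (simp only: gcd_int_int_eq)
  qed
  \<comment> \<open>On the coordinates 0 and \<open>Suc t\<close> this is the matrix with rows
    \<open>\<alpha>, \<beta>\<close> and \<open>- \<sigma>, \<nu>\<close>. It has determinant 1 by
    \<open>det\<close> and maps the pair \<open>n, r\<close> to \<open>d, 0\<close>.\<close>
  define g :: "(nat \<Rightarrow> int) \<Rightarrow> nat \<Rightarrow> int" where
    "g a = (f a)(0 := \<alpha> * f a 0 + \<beta> * a (Suc t), Suc t := - \<sigma> * f a 0 + \<nu> * a (Suc t))" for a
  have "unimodular_for s (Suc t) g"
    unfolding unimodular_for_def
  proof (intro conjI allI impI ballI)
    show "g (\<lambda>j. a j + b j) = (\<lambda>j. g a j + g b j)" for a b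
      by (auto simp: g_def add fun_eq_iff algebra_simps)
    show "g (\<lambda>j. c * a j) = (\<lambda>j. c * g a j)" for c a
      by (auto simp: g_def scale fun_eq_iff algebra_simps)
  next
    fix a b :: "nat \<Rightarrow> int" and j assume "\<forall>j\<le>Suc t. a j = b j" "j \<le> Suc t"
    then show "g a j = g b j" using dep[of a b 0] dep[of a b j] by (auto simp: g_def le_Suc_eq)
  next
    fix a :: "nat \<Rightarrow> int" and j assume z: "\<forall>j\<le>Suc t. g a j = 0" and j: "j \<le> Suc t"
    have 1: "\<alpha> * f a 0 + \<beta> * a (Suc t) = 0" using z[rule_format, of 0] by (simp add: g_def)
    have 2: "- \<sigma> * f a 0 + \<nu> * a (Suc t) = 0" using z[rule_format, of "Suc t"] by (simp add: g_def)
    have "f a 0 = (\<alpha> * \<nu> + \<beta> * \<sigma>) * f a 0" using det by simp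
    also have "\<dots> = \<nu> * (\<alpha> * f a 0 + \<beta> * a (Suc t)) - \<beta> * (- \<sigma> * f a 0 + \<nu> * a (Suc t))"
      by (simp add: algebra_simps)
    finally have f0: "f a 0 = 0" using 1 2 by simp
    have "a (Suc t) = (\<alpha> * \<nu> + \<beta> * \<sigma>) * a (Suc t)" using det by simp
    also have "\<dots> = \<sigma> * (\<alpha> * f a 0 + \<beta> * a (Suc t)) + \<alpha> * (- \<sigma> * f a 0 + \<nu> * a (Suc t))"
      by (simp add: algebra_simps)
    finally have a: "a (Suc t) = 0" using 1 2 by simp
    have "f a i = 0" if "i \<le> t" for i
      using z[rule_format, of i] f0 that by (cases "i = 0") (auto simp: g_def)
    then show "a j = 0" using inj[of a j] a j by (auto simp: le_Suc_eq)
  next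
    fix b :: "nat \<Rightarrow> int"
    obtain a where a: "\<And>j. j \<le> t \<Longrightarrow> f a j = (b(0 := \<nu> * b 0 - \<beta> * b (Suc t))) j" using surj by blast
    \<comment> \<open>The inverse matrix has rows \<open>\<nu>, - \<beta>\<close> and
      \<open>\<sigma>, \<alpha>\<close>.\<close>
    define a' where "a' = a(Suc t := \<sigma> * b 0 + \<alpha> * b (Suc t))"
    have fa: "f a' j = f a j" if "j \<le> t" for j using dep[of a' a j] that by (simp add: a'_def)
    have f0: "f a' 0 = \<nu> * b 0 - \<beta> * b (Suc t)" using fa[of 0] a[of 0] by simp
    have at: "a' (Suc t) = \<sigma> * b 0 + \<alpha> * b (Suc t)" by (simp add: a'_def)
    have "g a' j = b j" if j: "j \<le> Suc t" for j
    proof -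
      consider "j = 0" | "j = Suc t" | "j \<noteq> 0" "j \<le> t" using j by linarith
      then show ?thesis
      proof cases
        case 1
        have "g a' 0 = (\<alpha> * \<nu> + \<beta> * \<sigma>) * b 0"
          by (simp add: g_def f0 at algebra_simps)
        then show ?thesis using det 1 by simp
      next
        case 2
        have "g a' (Suc t) = (\<alpha> * \<nu> + \<beta> * \<sigma>) * b (Suc t)"
          by (simp add: g_def f0 at algebra_simps)
        then show ?thesis using det 2 by simp
      next
        case 3
        then show ?thesis using fa[of j] a[of j] by (simp add: g_def)
      qed
    qed
    then show "\<exists>a. \<forall>j\<le>Suc t. g a j = b j" by blast
  next
    show "g (\<lambda>j. int (s j)) 0 = int (Gcd (s ` {0..Suc t}))"
      using bez s0 unfolding Gcd by (simp add: g_def n_def r_def)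
  next
    fix j assume "j \<in> {1..Suc t}"
    then consider "j = Suc t" | "j \<in> {1..t}" by fastforce
    then show "g (\<lambda>j. int (s j)) j = 0"
    proof cases
      case 1
      then show ?thesis using s0 \<nu> \<sigma> by (simp add: g_def flip: n_def r_def)
    next
      case 2
      then show ?thesis using sj by (simp add: g_def)
    qed
  qed
  then show ?case by blast
qed

lemma restrict_eq_iff: "restrict f I = restrict g I \<longleftrightarrow> (\<forall>x\<in>I. f x = g x)"
  by (metis restrict_apply' restrict_ext)

section \<open>Powers of the quotient of \<open>\<int>\<^bsup>t+1\<^esup>\<close> by a single vector\<close>

text \<open>\<open>C\<close> is the quotient of \<open>(\<int>\<^bsup>t+1\<^esup>)\<^bsup>k\<^esup>\<close> by the \<open>k\<close>-th power of the subgroup generated by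
  \<open>(s 0, \<dots>, s t)\<close>, with quotient map \<open>w\<close>; only the entries \<open>m i j\<close> with \<open>i \<in> {1..k}\<close> and
  \<open>j \<in> {0..t}\<close> matter. The classes of the prime divisors are the unit vectors and, for \<open>i = 0\<close>, the
  negatives of their sums over \<open>i\<close>; the conditions on the sum of \<open>s\<close> keep these classes distinct.\<close>

locale row_quotient = comm_group C for C (structure) +
  fixes w :: "(nat \<Rightarrow> nat \<Rightarrow> int) \<Rightarrow> _" and t k :: nat and s :: "nat \<Rightarrow> nat"
  assumes w_add: "w (\<lambda>i j. m i j + m' i j) = w m \<otimes> w m'"
    and w_surj: "range w = carrier C"
    and w_eq_one_iff: "w m = \<one> \<longleftrightarrow> (\<forall>i\<in>{1..k}. \<exists>x. \<forall>j\<in>{0..t}. m i j = x * int (s j))"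
    and k_pos: "k \<ge> 1" and s_pos: "j \<le> t \<Longrightarrow> s j \<ge> 1"
    and s_sum: "(\<Sum>j=0..t. s j) \<ge> 2" "k + 1 \<noteq> (\<Sum>j=0..t. s j)"
begin

lemma w_closed [simp]: "w m \<in> carrier C"
  using w_surj by blast

lemma w_zero: "w (\<lambda>i j. 0) = \<one>"
  unfolding w_eq_one_iff by (auto intro!: exI[of _ 0])

lemma w_minus: "w (\<lambda>i j. - m i j) = inv (w m)"
proof -
  have "w (\<lambda>i j. - m i j) \<otimes> w m = w (\<lambda>i j. - m i j + m i j)" by (simp only: w_add)
  then show ?thesis by (intro inv_equality[symmetric]) (simp_all add: w_zero)
qed

lemma w_eq_iff:
  "w m = w m' \<longleftrightarrow> (\<forall>i\<in>{1..k}. \<exists>x. \<forall>j\<in>{0..t}. m i j - m' i j = x * int (s j))"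
proof -
  have "w m = w (\<lambda>i j. (m i j - m' i j) + m' i j)" by simp
  also have "\<dots> = w (\<lambda>i j. m i j - m' i j) \<otimes> w m'" by (rule w_add)
  finally have "w m = w m' \<longleftrightarrow> w (\<lambda>i j. m i j - m' i j) = \<one>" by simp
  then show ?thesis by (simp add: w_eq_one_iff)
qed

lemma w_eqI: "(\<And>i j. \<lbrakk>i \<in> {1..k}; j \<in> {0..t}\<rbrakk> \<Longrightarrow> m i j = m' i j) \<Longrightarrow> w m = w m'"
  unfolding w_eq_iff by (auto intro!: exI[of _ 0])

lemma w_nat_pow: "w m [^] (n :: nat) = w (\<lambda>i j. int n * m i j)"
proof (induction n)
  case (Suc n)
  have "w m [^] Suc n = w (\<lambda>i j. int n * m i j + m i j)" by (simp only: nat_pow_Suc Suc w_add)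
  then show ?case by (simp add: algebra_simps)
qed (simp add: w_zero)

lemma w_int_pow: "w m [^] (n :: int) = w (\<lambda>i j. n * m i j)"
proof (cases "n \<ge> 0")
  case True
  then obtain l where "n = int l" by (rule nonneg_int_cases)
  then show ?thesis by (simp add: int_pow_int w_nat_pow)
next
  case False
  then obtain l where l: "n = - int l" by (cases n rule: int_cases2) auto
  then have "w m [^] n = inv w (\<lambda>i j. int l * m i j)" by (simp add: int_pow_neg int_pow_int w_nat_pow)
  then show ?thesis by (simp add: l flip: w_minus)
qed

lemma w_finprod: "finite I \<Longrightarrow> (\<Otimes>x\<in>I. w (f x)) = w (\<lambda>i j. \<Sum>x\<in>I. f x i j)"
proof (induction I rule: finite_induct)
  case (insert x I)
  then have "(\<Otimes>x\<in>insert x I. w (f x)) = w (f x) \<otimes> w (\<lambda>i j. \<Sum>x\<in>I. f x i j)" by simp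
  then show ?case using insert by (simp add: w_add)
qed (simp add: w_zero)

definition unit_vec :: "nat \<Rightarrow> nat \<Rightarrow> nat \<Rightarrow> nat \<Rightarrow> int" where
  "unit_vec i j i' j' = (if j' = j then if i = 0 then - 1 else if i' = i then 1 else 0 else 0)"

definition E :: "nat \<Rightarrow> nat \<Rightarrow> _" where
  "E i j = w (unit_vec i j)"

lemma E_closed [simp]: "E i j \<in> carrier C"
  by (simp add: E_def)

text \<open>A unit vector, up to sign, that is a multiple of the positive vector \<open>s\<close>
  leaves room for one column only, with entry 1; but the entries of \<open>s\<close> sum to at least
  2.\<close>

lemma not_multiple:
  assumes "j \<in> {0..t}" "\<And>j'. j' \<in> {0..t} \<Longrightarrow> c * (if j' = j then 1 else 0) = x * int (s j')" "\<bar>c\<bar> = 1"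
  shows False
proof -
  have "c = x * int (s j)" using assms(2)[OF assms(1)] by simp
  then have x: "x \<noteq> 0" "int (s j) dvd c" using assms(3) by auto
  then have "s j = 1" using assms(3) by (metis dvd_abs_iff of_nat_1_eq_iff zdvd1_eq abs_of_nat)
  have "j' = j" if "j' \<in> {0..t}" for j'
    using assms(2)[OF that] x s_pos[of j'] that by (auto split: if_splits)
  then have "{0..t} = {j}" using assms(1) by blast
  then show False using s_sum(1) \<open>s j = 1\<close> by auto
qed

text \<open>The difference of two unit vectors has entries of both signs, while a multiple of the
  positive vector \<open>s\<close> does not.\<close>

lemma not_multiple_diff:
  assumes "j \<in> {0..t}" "l \<in> {0..t}" "j \<noteq> l"
    "\<And>j'. j' \<in> {0..t} \<Longrightarrow> (if j' = j then 1 else 0) - (if j' = l then 1 else 0) = x * int (s j')"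
  shows False
proof -
  have "x * int (s j) = 1" "x * int (s l) = - 1" using assms(4)[of j] assms(4)[of l] assms(1-3) by auto
  then show False
    by (metis less_le_not_le mult_less_0_iff neg_less_0_iff_less of_nat_0_le_iff zero_less_mult_iff zero_less_one not_less_iff_gr_or_eq)
qed

text \<open>A row other than \<open>i\<close> would contain a negative unit vector as a multiple of
  \<open>s\<close>, so \<open>k = 1\<close>. In the remaining row the sum of two unit vectors is a
  multiple of \<open>s\<close>; then \<open>s\<close> is \<open>(2)\<close> or
  \<open>(1, 1)\<close>, and its sum 2 equals \<open>k + 1\<close>, which is excluded.\<close>

lemma E_zero_neq:
  assumes "i \<in> {1..k}" "j \<in> {0..t}" "l \<in> {0..t}"
  shows "E 0 l \<noteq> E i j"
proof
  assume "E 0 l = E i j"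
  then have "\<exists>x. \<forall>j'\<in>{0..t}. unit_vec 0 l i' j' - unit_vec i j i' j' = x * int (s j')"
    if "i' \<in> {1..k}" for i' using that unfolding E_def w_eq_iff by blast
  note row = this
  have "i' = i" if i': "i' \<in> {1..k}" for i'
  proof (rule ccontr)
    assume "i' \<noteq> i"
    obtain x where x: "\<And>j'. j' \<in> {0..t} \<Longrightarrow> unit_vec 0 l i' j' - unit_vec i j i' j' = x * int (s j')"
      using row[OF i'] by blast
    show False
      by (rule not_multiple[of l "- 1" x]) (use assms \<open>i' \<noteq> i\<close> in \<open>simp_all flip: x add: unit_vec_def\<close>)
  qed
  then have "k = 1" using k_pos assms(1) by (metis atLeastAtMost_iff le_antisym order_refl)
  obtain x where x: "\<And>j'. j' \<in> {0..t} \<Longrightarrow> unit_vec 0 l i j' - unit_vec i j i j' = x * int (s j')"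
    using row[OF assms(1)] by blast
  have xl: "x * int (s l) \<noteq> 0" 
    using assms by (simp flip: x add: unit_vec_def del: mult_eq_0_iff)
  have mem: "j' = l \<or> j' = j" if "j' \<in> {0..t}" for j'
  proof (rule ccontr)
    assume "\<not> ?thesis"
    then have "x * int (s j') = 0" using x[OF that] assms(1) by (auto simp: unit_vec_def)
    then show False using xl s_pos[of j'] that by auto
  qed
  then have set: "{0..t} = {l, j}" using assms by blast
  show False
  proof (cases "l = j")
    case True
    then have "x * int (s j) = - 2" using x[of j] assms by (simp add: unit_vec_def)
    then have "int (s j) dvd 2" by (metis dvd_minus_iff dvd_triv_right)
    then have "s j dvd 2" by (metis int_dvd_int_iff of_nat_numeral)
    then have "s j \<le> 2" by (rule dvd_imp_le) simp
    then show False using s_sum \<open>k = 1\<close> set True by auto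
  next
    case False
    then have "x * int (s j) = - 1" "x * int (s l) = - 1"
      using x[of j] x[of l] assms by (auto simp: unit_vec_def)
    then have "int (s j) dvd 1" "int (s l) dvd 1" by (metis dvd_minus_iff dvd_triv_right)+
    then have "s j = 1" "s l = 1" by simp_all
    then show False using s_sum \<open>k = 1\<close> set False by simp
  qed
qed

lemma E_inj:
  assumes "i \<in> {0..k}" "i' \<in> {0..k}" "j \<in> {0..t}" "j' \<in> {0..t}" "E i j = E i' j'"
  shows "i = i' \<and> j = j'"
proof (cases "i = 0 \<or> i' = 0")
  case True
  then have i: "i = 0" "i' = 0"
    using E_zero_neq[of i j j'] E_zero_neq[of i' j' j] assms by (cases "i = 0"; cases "i' = 0"; force)+
  have "1 \<in> {1..k}" using k_pos by simp
  then obtain x where x: "\<And>l. l \<in> {0..t} \<Longrightarrow> unit_vec 0 j 1 l - unit_vec 0 j' 1 l = x * int (s l)"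
    using assms(5) i unfolding E_def w_eq_iff by blast
  have "j = j'"
  proof (rule ccontr)
    assume "j \<noteq> j'"
    show False
      by (rule not_multiple_diff[of j j' "- x"])
        (use assms \<open>j \<noteq> j'\<close> in \<open>simp_all flip: x add: unit_vec_def\<close>)
  qed
  with i show ?thesis by simp
next
  case False
  then have ii: "i \<in> {1..k}" "i' \<in> {1..k}" using assms by auto
  obtain x where x: "\<And>l. l \<in> {0..t} \<Longrightarrow> unit_vec i j i l - unit_vec i' j' i l = x * int (s l)"
    using assms(5) ii unfolding E_def w_eq_iff by blast
  have "i = i'"
  proof (rule ccontr)
    assume "i \<noteq> i'"
    show False
      by (rule not_multiple[of j 1 x]) (use ii assms \<open>i \<noteq> i'\<close> in \<open>simp_all flip: x add: unit_vec_def\<close>)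
  qed
  moreover have "j = j'"
  proof (rule ccontr)
    assume "j \<noteq> j'"
    show False
      by (rule not_multiple_diff[of j j' x])
        (use ii assms \<open>j \<noteq> j'\<close> \<open>i = i'\<close> in \<open>simp_all flip: x add: unit_vec_def\<close>)
  qed
  ultimately show ?thesis by blast
qed

lemma E_pow: "E i j [^] (n :: int) = w (\<lambda>i' j'. n * unit_vec i j i' j')"
  by (simp add: E_def w_int_pow)

lemma E_pow_nat: "E i j [^] (n :: nat) = w (\<lambda>i' j'. int n * unit_vec i j i' j')"
  by (simp add: E_def w_nat_pow)

lemma E_ne_one:
  assumes "i \<in> {1..k}" "j \<in> {0..t}"
  shows "E i j \<noteq> \<one>"
proof
  assume "E i j = \<one>"
  then obtain x where x: "\<And>l. l \<in> {0..t} \<Longrightarrow> unit_vec i j i l = x * int (s l)"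
    using assms unfolding E_def w_eq_one_iff by blast
  show False
    by (rule not_multiple[of j 1 x]) (use assms in \<open>simp_all flip: x add: unit_vec_def\<close>)
qed

lemma E_ord_infinite:
  assumes "i \<in> {1..k}" "j \<in> {0..t}" "t > 0"
  shows "ord (E i j) = 0"
  unfolding ord_unique[OF E_closed]
proof (intro allI iffI)
  fix n :: nat assume "E i j [^] n = \<one>"
  then obtain x where x: "\<And>l. l \<in> {0..t} \<Longrightarrow> int n * unit_vec i j i l = x * int (s l)"
    using assms unfolding E_pow_nat w_eq_one_iff by blast
  \<comment> \<open>As \<open>t > 0\<close> there is a second column; there the entry is 0 and
    forces the factor \<open>x\<close> to vanish.\<close>
  obtain l where l: "l \<in> {0..t}" "l \<noteq> j"
    using assms(3) by (cases "j = 0") (auto intro: that[of 0] that[of 1])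
  have "x = 0" using x[OF l(1)] l s_pos[of l] by (auto simp: unit_vec_def)
  then have "n = 0" using x[OF assms(2)] assms(1) by (auto simp: unit_vec_def split: if_splits)
  then show "0 dvd n" by simp
qed simp

lemma E_ord_finite:
  assumes "i \<in> {1..k}" "t = 0"
  shows "ord (E i 0) = s 0"
  unfolding ord_unique[OF E_closed]
proof (intro allI iffI)
  fix n :: nat assume "E i 0 [^] n = \<one>"
  then obtain x where x: "\<And>l. l \<in> {0..t} \<Longrightarrow> int n * unit_vec i 0 i l = x * int (s l)"
    using assms unfolding E_pow_nat w_eq_one_iff by blast
  have "int n = x * int (s 0)" using x[of 0] assms(1) by (simp add: unit_vec_def)
  then have "int (s 0) dvd int n" by simp
  then show "s 0 dvd n" by simp
next
  fix n :: nat assume "s 0 dvd n"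
  then obtain m where m: "n = s 0 * m" by blast
  show "E i 0 [^] n = \<one>"
    unfolding E_pow_nat w_eq_one_iff
  proof
    fix i' assume "i' \<in> {1..k}"
    have "int n * unit_vec i 0 i' j = (if i' = i then int m else 0) * int (s j)" if "j \<in> {0..t}" for j
      using that assms m by (simp add: unit_vec_def)
    then show "\<exists>x. \<forall>j\<in>{0..t}. int n * unit_vec i 0 i' j = x * int (s j)" by blast
  qed
qed

lemma E_prod:
  "finite I \<Longrightarrow> (\<Otimes>p\<in>I. (\<lambda>(i, j). E i j) p [^] (m p :: int)) = w (\<lambda>i' j'. \<Sum>(i, j)\<in>I. m (i, j) * unit_vec i j i' j')"
  using w_finprod[of I "\<lambda>p i' j'. m p * unit_vec (fst p) (snd p) i' j'"]
  by (simp add: E_pow case_prod_beta)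

lemma sum_unit_vec:
  assumes "finite I" "I \<subseteq> {1..} \<times> UNIV"
  shows "(\<Sum>(i, j)\<in>I. m (i, j) * unit_vec i j i' j') = (if (i', j') \<in> I then m (i', j') else 0)"
proof -
  have "(\<Sum>(i, j)\<in>I. m (i, j) * unit_vec i j i' j') = (\<Sum>p\<in>I. if p = (i', j') then m p else 0)"
    by (rule sum.cong) (use assms(2) in \<open>auto simp: unit_vec_def split: if_splits\<close>)
  then show ?thesis using assms by simp
qed

lemma independent_e: "independent_family C ({1..k} \<times> {1..t}) (\<lambda>(i, j). E i j)"
proof (rule independent_familyI)
  let ?I = "{1..k} \<times> {1..t}"
  fix p assume "p \<in> ?I"
  then show "(\<lambda>(i, j). E i j) p \<in> carrier C" "(\<lambda>(i, j). E i j) p \<noteq> \<one>"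
    using E_ne_one by auto
next
  let ?I = "{1..k} \<times> {1..t}"
  fix m :: "nat \<times> nat \<Rightarrow> int" and p
  assume eq: "(\<Otimes>p\<in>?I. (\<lambda>(i, j). E i j) p [^] m p) = \<one>" and p: "p \<in> ?I"
  obtain i j where ij: "p = (i, j)" "i \<in> {1..k}" "j \<in> {1..t}" using p by auto
  have I: "finite ?I" "?I \<subseteq> {1..} \<times> UNIV" by auto
  have "(\<Otimes>p\<in>?I. (\<lambda>(i, j). E i j) p [^] m p) = w (\<lambda>i' j'. if (i', j') \<in> ?I then m (i', j') else 0)"
    unfolding E_prod[OF I(1)] sum_unit_vec[OF I] ..
  then have "w (\<lambda>i' j'. if (i', j') \<in> ?I then m (i', j') else 0) = \<one>" using eq by simp
  then obtain x where x: "\<And>l. l \<in> {0..t} \<Longrightarrow> (if (i, l) \<in> ?I then m (i, l) else 0) = x * int (s l)"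
    using ij(2) unfolding w_eq_one_iff by blast
  \<comment> \<open>The family leaves column 0 empty, whereas \<open>s 0\<close> is
    positive.\<close>
  have "x = 0" using x[of 0] s_pos[of 0] by auto
  then have "m (i, j) = 0" using x[of j] p ij by simp
  then show "(\<lambda>(i, j). E i j) p [^] m p = \<one>" by (simp add: ij(1))
qed simp

lemma independent_g: "independent_family C {1..k} (\<lambda>i. E i 0)"
proof (rule independent_familyI)
  fix i assume "i \<in> {1..k}"
  then show "E i 0 \<noteq> \<one>" using E_ne_one by simp
next
  fix m :: "nat \<Rightarrow> int" and i
  assume eq: "(\<Otimes>i\<in>{1..k}. E i 0 [^] m i) = \<one>" and i: "i \<in> {1..k}"
  have "(\<Otimes>i\<in>{1..k}. E i 0 [^] m i) = w (\<lambda>i' j'. \<Sum>i\<in>{1..k}. m i * unit_vec i 0 i' j')"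
    using w_finprod[of "{1..k}" "\<lambda>i i' j'. m i * unit_vec i 0 i' j'"] by (simp add: E_pow)
  also have "\<dots> = w (\<lambda>i' j'. if j' = 0 then m i' else 0)"
  proof (rule w_eqI)
    fix i' j' assume "i' \<in> {1..k}" "j' \<in> {0..t}"
    have "(\<Sum>i\<in>{1..k}. m i * unit_vec i 0 i' j') = (\<Sum>i\<in>{1..k}. if i = i' then if j' = 0 then m i else 0 else 0)"
      by (rule sum.cong) (auto simp: unit_vec_def)
    then show "(\<Sum>i\<in>{1..k}. m i * unit_vec i 0 i' j') = (if j' = 0 then m i' else 0)"
      using \<open>i' \<in> {1..k}\<close> by simp
  qed
  finally have "w (\<lambda>i' j'. if j' = 0 then m i' else 0) = \<one>" using eq by simp
  then obtain x where x: "\<And>l. l \<in> {0..t} \<Longrightarrow> (if l = 0 then m i else 0) = x * int (s l)"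
    using i unfolding w_eq_one_iff by blast
  \<comment> \<open>The exponent itself need not be 0: for \<open>t = 0\<close> it may be a multiple
    of \<open>s 0\<close>. The multiple of \<open>s\<close> found in row \<open>i\<close> already
    makes this single power trivial.\<close>
  show "E i 0 [^] m i = \<one>"
    unfolding E_pow w_eq_one_iff
  proof
    fix i' assume "i' \<in> {1..k}"
    have "m i * unit_vec i 0 i' l = (if i' = i then x else 0) * int (s l)" if "l \<in> {0..t}" for l
      using x[OF that] i by (auto simp: unit_vec_def)
    then show "\<exists>x. \<forall>l\<in>{0..t}. m i * unit_vec i 0 i' l = x * int (s l)" by blast
  qed
qed simp_all

lemma E_zero: "E 0 j = inv (\<Otimes>i\<in>{1..k}. E i j)"
proof -
  have "(\<Otimes>i\<in>{1..k}. E i j) = w (\<lambda>i' j'. \<Sum>i\<in>{1..k}. unit_vec i j i' j')"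
    by (simp add: E_def w_finprod)
  then have "inv (\<Otimes>i\<in>{1..k}. E i j) = w (\<lambda>i' j'. - (\<Sum>i\<in>{1..k}. unit_vec i j i' j'))"
    by (simp add: w_minus)
  also have "\<dots> = E 0 j"
    unfolding E_def
  proof (rule w_eqI)
    fix i' j' assume "i' \<in> {1..k}" "j' \<in> {0..t}"
    have "(\<Sum>i\<in>{1..k}. unit_vec i j i' j') = (\<Sum>i\<in>{1..k}. if i = i' then if j' = j then 1 else 0 else 0)"
      by (rule sum.cong) (auto simp: unit_vec_def)
    then show "- (\<Sum>i\<in>{1..k}. unit_vec i j i' j') = unit_vec 0 j i' j'"
      using \<open>i' \<in> {1..k}\<close> by (simp add: unit_vec_def)
  qed
  finally show ?thesis ..
qed

section \<open>Decomposition into rows\<close>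

definition row :: "nat \<Rightarrow> (nat \<Rightarrow> int) \<Rightarrow> nat \<Rightarrow> nat \<Rightarrow> int" where
  "row i m i' j' = (if i' = i then m j' else 0)"

lemma generate_row:
  assumes "i \<in> {1..k}" "J \<subseteq> {0..t}"
  shows "generate C (E i ` J) = range (\<lambda>m. w (row i (\<lambda>j. if j \<in> J then m j else 0)))"
proof -
  have fin: "finite J" using assms finite_subset by blast
  have "(\<Otimes>j\<in>J. E i j [^] (m j :: int)) = w (row i (\<lambda>j. if j \<in> J then m j else 0))" for m
  proof -
    have "(\<Otimes>j\<in>J. E i j [^] m j) = w (\<lambda>i' j'. \<Sum>j\<in>J. m j * unit_vec i j i' j')"
      using w_finprod[OF fin, of "\<lambda>j i' j'. m j * unit_vec i j i' j'"] by (simp add: E_pow)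
    also have "\<dots> = w (row i (\<lambda>j. if j \<in> J then m j else 0))"
    proof (rule w_eqI)
      fix i' j'
      have "(\<Sum>j\<in>J. m j * unit_vec i j i' j') = (\<Sum>j\<in>J. if j = j' then if i' = i then m j else 0 else 0)"
        by (rule sum.cong) (use assms in \<open>auto simp: unit_vec_def\<close>)
      then show "(\<Sum>j\<in>J. m j * unit_vec i j i' j') = row i (\<lambda>j. if j \<in> J then m j else 0) i' j'"
        using fin by (simp add: row_def)
    qed
    finally show ?thesis .
  qed
  moreover have "E i ` J \<subseteq> carrier C" by auto
  ultimately show ?thesis using generate_finite_family[OF fin, of "E i"] by (simp only:)
qed

lemma generate_full_row:
  assumes "i \<in> {1..k}"
  shows "generate C (E i ` {1..t} \<union> {E i 0}) = range (\<lambda>m. w (row i m))"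
proof -
  have eq: "E i ` {1..t} \<union> {E i 0} = E i ` {0..t}" by (auto simp: atLeastAtMost_insertL[symmetric, of 0 t] simp del: atLeastAtMost_insertL)
  have "w (row i (\<lambda>j. if j \<in> {0..t} then m j else 0)) = w (row i m)" for m
    by (rule w_eqI) (simp add: row_def)
  then show ?thesis unfolding eq generate_row[OF assms subset_refl] by simp
qed

text \<open>The multiples of \<open>s\<close> are divided out in each row separately, so a product
  of row classes is trivial only if every row class is.\<close>

lemma internal_direct_sum_rows:
  "internal_direct_sum C {1..k} (\<lambda>i. generate C (E i ` {1..t} \<union> {E i 0})) (carrier C)"
proof (rule internal_direct_sumI)
  fix i assume "i \<in> {1..k}"
  show "subgroup (generate C (E i ` {1..t} \<union> {E i 0})) C" by (rule generate_is_subgroup) auto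
next
  have eq: "(\<Otimes>i\<in>{1..k}. w (row i (m i))) = w m" for m
  proof -
    have "(\<Otimes>i\<in>{1..k}. w (row i (m i))) = w (\<lambda>i' j'. \<Sum>i\<in>{1..k}. row i (m i) i' j')"
      by (simp add: w_finprod)
    also have "\<dots> = w m" by (rule w_eqI) (simp add: row_def)
    finally show ?thesis .
  qed
  show "carrier C = (\<lambda>x. \<Otimes>i\<in>{1..k}. x i) ` (\<Pi>\<^sub>E i\<in>{1..k}. generate C (E i ` {1..t} \<union> {E i 0}))"
  proof (intro equalityI subsetI)
    fix c assume "c \<in> carrier C"
    then obtain m where "c = w m" using w_surj by blast
    then have "c = (\<Otimes>i\<in>{1..k}. (\<lambda>i\<in>{1..k}. w (row i (m i))) i)"
      using eq[of m] by (metis (mono_tags, lifting) finprod_cong' Pi_I restrict_apply' w_closed)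
    moreover have "(\<lambda>i\<in>{1..k}. w (row i (m i))) \<in> (\<Pi>\<^sub>E i\<in>{1..k}. generate C (E i ` {1..t} \<union> {E i 0}))"
      using generate_full_row by auto
    ultimately show "c \<in> (\<lambda>x. \<Otimes>i\<in>{1..k}. x i) ` (\<Pi>\<^sub>E i\<in>{1..k}. generate C (E i ` {1..t} \<union> {E i 0}))"
      by (rule image_eqI)
  next
    fix c assume "c \<in> (\<lambda>x. \<Otimes>i\<in>{1..k}. x i) ` (\<Pi>\<^sub>E i\<in>{1..k}. generate C (E i ` {1..t} \<union> {E i 0}))"
    then obtain x where x: "x \<in> (\<Pi>\<^sub>E i\<in>{1..k}. generate C (E i ` {1..t} \<union> {E i 0}))" "c = (\<Otimes>i\<in>{1..k}. x i)"
      by blast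
    have "x i \<in> carrier C" if "i \<in> {1..k}" for i
    proof -
      have "x i \<in> range (\<lambda>m. w (row i m))" using x(1) that generate_full_row[OF that] by blast
      then show ?thesis by auto
    qed
    then show "c \<in> carrier C" unfolding x(2) by (intro finprod_closed) auto
  qed
  fix x i assume x: "x \<in> (\<Pi> i\<in>{1..k}. generate C (E i ` {1..t} \<union> {E i 0}))"
    "(\<Otimes>i\<in>{1..k}. x i) = \<one>" and i: "i \<in> {1..k}"
  have "\<forall>i\<in>{1..k}. \<exists>m. x i = w (row i m)"
  proof
    fix i assume i: "i \<in> {1..k}"
    then have "x i \<in> range (\<lambda>m. w (row i m))" using x(1) generate_full_row[OF i] by blast
    then show "\<exists>m. x i = w (row i m)" by blast
  qed
  then obtain m where m: "\<And>i. i \<in> {1..k} \<Longrightarrow> x i = w (row i (m i))" by metis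
  have "(\<Otimes>i\<in>{1..k}. x i) = (\<Otimes>i\<in>{1..k}. w (row i (m i)))"
    by (rule finprod_cong') (use m in auto)
  then have "w m = \<one>" using x(2) eq by simp
  then obtain y where "\<And>j. j \<in> {0..t} \<Longrightarrow> m i j = y * int (s j)" using i unfolding w_eq_one_iff by blast
  then have "row i (m i) i' j = (if i' = i then y else 0) * int (s j)" if "j \<in> {0..t}" for i' j
    using that by (simp add: row_def)
  then have "w (row i (m i)) = \<one>" unfolding w_eq_one_iff by blast
  then show "x i = \<one>" using m i by simp
qed simp

lemma g_pow_relation:
  assumes "i \<in> {1..k}"
  shows "inv (E i 0 [^] s 0) = (\<Otimes>j\<in>{1..t}. E i j [^] s j)"
proof -
  have "(\<Otimes>j\<in>{1..t}. E i j [^] s j) = w (\<lambda>i' j'. \<Sum>j\<in>{1..t}. int (s j) * unit_vec i j i' j')"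
    using w_finprod[of "{1..t}" "\<lambda>j i' j'. int (s j) * unit_vec i j i' j'"] by (simp add: E_pow_nat)
  also have "\<dots> = w (\<lambda>i' j'. - (int (s 0) * unit_vec i 0 i' j'))"
    unfolding w_eq_iff
  proof
    fix i' assume "i' \<in> {1..k}"
    \<comment> \<open>The difference of the two sides is the vector \<open>s\<close> in row
      \<open>i\<close> and zero in the other rows.\<close>
    have "(\<Sum>j\<in>{1..t}. int (s j) * unit_vec i j i' j') - - (int (s 0) * unit_vec i 0 i' j') =
        (if i' = i then 1 else 0) * int (s j')" if "j' \<in> {0..t}" for j'
    proof -
      have "(\<Sum>j\<in>{1..t}. int (s j) * unit_vec i j i' j') =
          (\<Sum>j\<in>{1..t}. if j = j' then if i' = i then int (s j) else 0 else 0)"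
        by (rule sum.cong) (use assms in \<open>auto simp: unit_vec_def\<close>)
      then show ?thesis using that assms by (cases "j' = 0") (auto simp: unit_vec_def)
    qed
    then show "\<exists>x. \<forall>j'\<in>{0..t}. (\<Sum>j\<in>{1..t}. int (s j) * unit_vec i j i' j') -
        - (int (s 0) * unit_vec i 0 i' j') = x * int (s j')" by blast
  qed
  also have "\<dots> = inv (E i 0 [^] s 0)" by (simp only: w_minus E_pow_nat)
  finally show ?thesis ..
qed

text \<open>Column 0 decides: the subgroup vanishes there, so \<open>m\<close> must be a multiple of
  \<open>s 0\<close>; conversely, subtracting that multiple of \<open>s\<close> moves the entry into
  the other columns. This yields the minimality of \<open>s 0\<close>.\<close>

lemma g_pow_in_generate_iff:
  assumes "i \<in> {1..k}"
  shows "E i 0 [^] (m :: nat) \<in> generate C (E i ` {1..t}) \<longleftrightarrow> s 0 dvd m"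
proof -
  have "{1..t} \<subseteq> {0..t}" by auto
  note gen = generate_row[OF assms this]
  show ?thesis
  proof
    assume "E i 0 [^] m \<in> generate C (E i ` {1..t})"
    then obtain a where "w (\<lambda>i' j'. int m * unit_vec i 0 i' j') = w (row i (\<lambda>j. if j \<in> {1..t} then a j else 0))"
      unfolding gen E_pow_nat by blast
    then obtain x where "\<And>j. j \<in> {0..t} \<Longrightarrow>
        int m * unit_vec i 0 i j - row i (\<lambda>j. if j \<in> {1..t} then a j else 0) i j = x * int (s j)"
      using assms unfolding w_eq_iff by blast
    from this[of 0] have "int m = x * int (s 0)" using assms by (simp add: unit_vec_def row_def)
    then have "int (s 0) dvd int m" by simp
    then show "s 0 dvd m" by simp
  next
    assume "s 0 dvd m"
    then obtain x where x: "m = s 0 * x" by blast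
    have "E i 0 [^] m = w (row i (\<lambda>j. if j \<in> {1..t} then - int x * int (s j) else 0))"
      unfolding E_pow_nat w_eq_iff
    proof
      fix i' assume "i' \<in> {1..k}"
      have "int m * unit_vec i 0 i' j - row i (\<lambda>j. if j \<in> {1..t} then - int x * int (s j) else 0) i' j =
          (if i' = i then int x else 0) * int (s j)" if "j \<in> {0..t}" for j
        using that assms by (cases "j = 0") (auto simp: unit_vec_def row_def x)
      then show "\<exists>x'. \<forall>j\<in>{0..t}. int m * unit_vec i 0 i' j -
          row i (\<lambda>j. if j \<in> {1..t} then - int x * int (s j) else 0) i' j = x' * int (s j)" by blast
    qed
    then show "E i 0 [^] m \<in> generate C (E i ` {1..t})" unfolding gen
      by (rule range_eqI[of _ _ "\<lambda>j. - int x * int (s j)"])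
  qed
qed

text \<open>\<open>v\<close> and \<open>w\<close> are surjections from the same group of integer
  matrices with the same kernel, so their images are isomorphic; no presentation of the kernel is
  needed.\<close>

lemma isoI:
  fixes Q (structure)
  assumes "group Q" and add: "\<And>m m'. v (\<lambda>i j. m i j + m' i j) = v m \<otimes>\<^bsub>Q\<^esub> v m'"
    and surj: "range v = carrier Q" and one: "\<And>m. v m = \<one>\<^bsub>Q\<^esub> \<longleftrightarrow> w m = \<one>\<^bsub>C\<^esub>"
  shows "C \<cong> Q"
proof -
  interpret Q: group Q by fact
  have vc: "v m \<in> carrier Q" for m using surj by blast
  have eq: "v m = v m' \<longleftrightarrow> w m = w m'" for m m'
  proof -
    let ?d = "\<lambda>i j. m i j - m' i j"
    have "v m = v (\<lambda>i j. ?d i j + m' i j)" by simp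
    also have "\<dots> = v ?d \<otimes>\<^bsub>Q\<^esub> v m'" by (rule add)
    finally have "v m = v m' \<longleftrightarrow> v ?d = \<one>\<^bsub>Q\<^esub>" using vc by simp
    also have "\<dots> \<longleftrightarrow> w m = w m'" by (simp add: one w_eq_one_iff w_eq_iff)
    finally show ?thesis .
  qed
  define h where "h c = v (SOME m. w m = c)" for c
  have h: "h (w m) = v m" for m
  proof -
    have "w (SOME m'. w m' = w m) = w m" by (rule someI[of _ m]) (rule refl)
    then show ?thesis unfolding h_def eq .
  qed
  have "h \<in> hom C Q"
  proof (rule homI)
    fix c assume "c \<in> carrier C"
    then obtain m where "c = w m" using w_surj by blast
    then show "h c \<in> carrier Q" by (simp add: h vc)
  next
    fix c d assume "c \<in> carrier C" "d \<in> carrier C"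
    then obtain m m' where "c = w m" "d = w m'" using w_surj by blast
    then show "h (c \<otimes>\<^bsub>C\<^esub> d) = h c \<otimes>\<^bsub>Q\<^esub> h d" by (simp add: h add flip: w_add)
  qed
  moreover have "inj_on h (carrier C)"
  proof (rule inj_onI)
    fix c d assume "c \<in> carrier C" "d \<in> carrier C" "h c = h d"
    moreover from this obtain m m' where "c = w m" "d = w m'" using w_surj by blast
    ultimately show "c = d" by (simp add: h eq)
  qed
  moreover have "h ` carrier C = carrier Q"
    unfolding w_surj[symmetric] surj[symmetric] by (auto simp: h image_image)
  ultimately show ?thesis by (auto simp: is_iso_def iso_def bij_betw_def)
qed

text \<open>In the coordinates given by \<open>f\<close> the multiples of \<open>s\<close> are the
  multiples of the vector with first entry \<open>n\<close> and zeros elsewhere. Each row therefore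
  contributes coordinate 0 modulo \<open>n\<close> and \<open>t\<close> free coordinates.\<close>

lemma iso_product:
  "C \<cong> product_group {1..k} (\<lambda>_. product_group {1..t} (\<lambda>_. integer_group) \<times>\<times>
    integer_mod_group (Gcd (s ` {0..t})))"
proof -
  define n where "n = Gcd (s ` {0..t})"
  have "n dvd s 0" unfolding n_def by (rule Gcd_dvd) auto
  then have n: "n > 0" using s_pos[of 0] dvd_pos_nat[of "s 0" n] by simp
  obtain f where f: "unimodular_for s t f" using ex_unimodular[of s t] s_pos[of 0] by auto
  note fD = unimodular_forD[OF f]
  let ?Q = "product_group {1..t} (\<lambda>_. integer_group) \<times>\<times> integer_mod_group n"
  define v where "v m = (\<lambda>i\<in>{1..k}. (\<lambda>j\<in>{1..t}. f (m i) j, f (m i) 0 mod int n))" for m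
  have "C \<cong> product_group {1..k} (\<lambda>_. ?Q)"
  proof (rule isoI[of _ v])
    show "group (product_group {1..k} (\<lambda>_. ?Q))"
      by (intro product_group DirProd_group) auto
  next
    fix m m' :: "nat \<Rightarrow> nat \<Rightarrow> int"
    show "v (\<lambda>i j. m i j + m' i j) = v m \<otimes>\<^bsub>product_group {1..k} (\<lambda>_. ?Q)\<^esub> v m'"
      by (auto simp: v_def fD(1) fun_eq_iff mod_add_eq)
  next
    show "range v = carrier (product_group {1..k} (\<lambda>_. ?Q))"
    proof (intro equalityI subsetI)
      fix y assume "y \<in> range v"
      then show "y \<in> carrier (product_group {1..k} (\<lambda>_. ?Q))"
        using n by (auto simp: v_def carrier_integer_mod_group DirProd_def)
    next
      fix y assume "y \<in> carrier (product_group {1..k} (\<lambda>_. ?Q))"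
      then have y: "y \<in> (\<Pi>\<^sub>E i\<in>{1..k}. (\<Pi>\<^sub>E j\<in>{1..t}. UNIV) \<times> {0..<int n})"
        using n by (simp add: carrier_integer_mod_group DirProd_def)
      have ex: "\<exists>a. \<forall>j\<le>t. f a j = (if j = 0 then snd (y i) else fst (y i) j)" for i
        by (rule fD(5))
      define m where "m i = (SOME a. \<forall>j\<le>t. f a j = (if j = 0 then snd (y i) else fst (y i) j))" for i
      have m: "f (m i) j = (if j = 0 then snd (y i) else fst (y i) j)" if "j \<le> t" for i j
        using someI_ex[OF ex[of i]] that by (simp add: m_def)
      have "v m = y"
      proof (rule PiE_ext[OF _ y])
        show "v m \<in> (\<Pi>\<^sub>E i\<in>{1..k}. (\<Pi>\<^sub>E j\<in>{1..t}. UNIV) \<times> {0..<int n})"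
          using n by (auto simp: v_def)
      next
        fix i assume i: "i \<in> {1..k}"
        then have yi: "fst (y i) \<in> (\<Pi>\<^sub>E j\<in>{1..t}. UNIV)" "snd (y i) \<in> {0..<int n}"
          using y by (auto simp: PiE_iff mem_Times_iff)
        have "(\<lambda>j\<in>{1..t}. f (m i) j) = fst (y i)"
          by (rule PiE_ext[OF _ yi(1)]) (auto simp: m)
        moreover have "f (m i) 0 mod int n = snd (y i)" using yi(2) by (simp add: m)
        ultimately show "v m i = y i" using i by (simp add: v_def)
      qed
      then show "y \<in> range v" by blast
    qed
  next
    fix m :: "nat \<Rightarrow> nat \<Rightarrow> int"
    \<comment> \<open>From left to right, \<open>f\<close> kills the difference of \<open>a\<close>
      and a multiple of \<open>s\<close>, and \<open>f\<close> is injective.\<close>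
    have row: "(\<forall>j\<in>{1..t}. f a j = 0) \<and> f a 0 mod int n = 0 \<longleftrightarrow> (\<exists>x. \<forall>j\<in>{0..t}. a j = x * int (s j))" for a
    proof
      assume z: "(\<forall>j\<in>{1..t}. f a j = 0) \<and> f a 0 mod int n = 0"
      then obtain x where x: "f a 0 = int n * x" by (metis dvd_eq_mod_eq_0 dvdE)
      have sub: "f (\<lambda>j. a j + - x * int (s j)) j = f a j + - x * f (\<lambda>j. int (s j)) j" for j
        by (simp only: fD(1) fD(2))
      have "f (\<lambda>j. a j + - x * int (s j)) j = 0" if "j \<le> t" for j
      proof (cases "j = 0")
        case True
        then show ?thesis unfolding sub using x fD(6) by (simp add: n_def)
      next
        case False
        then show ?thesis unfolding sub using z that fD(7)[of j] by simp
      qed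
      then have "a j + - x * int (s j) = 0" if "j \<le> t" for j
        using fD(4)[of "\<lambda>j. a j + - x * int (s j)" j] that by blast
      then have "\<forall>j\<in>{0..t}. a j = x * int (s j)" by force
      then show "\<exists>x. \<forall>j\<in>{0..t}. a j = x * int (s j)" ..
    next
      assume "\<exists>x. \<forall>j\<in>{0..t}. a j = x * int (s j)"
      then obtain x where "\<forall>j\<in>{0..t}. a j = x * int (s j)" ..
      then have "f a j = x * f (\<lambda>j. int (s j)) j" if "j \<le> t" for j
        using fD(3)[of a "\<lambda>j. x * int (s j)" j] that by (simp add: fD(2))
      then show "(\<forall>j\<in>{1..t}. f a j = 0) \<and> f a 0 mod int n = 0"
        using fD(6,7) by (simp add: n_def)
    qed
    have "v m = \<one>\<^bsub>product_group {1..k} (\<lambda>_. ?Q)\<^esub> \<longleftrightarrow>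
        (\<forall>i\<in>{1..k}. (\<forall>j\<in>{1..t}. f (m i) j = 0) \<and> f (m i) 0 mod int n = 0)"
      by (simp add: v_def restrict_eq_iff)
    then show "v m = \<one>\<^bsub>product_group {1..k} (\<lambda>_. ?Q)\<^esub> \<longleftrightarrow> w m = \<one>"
      by (simp only: row w_eq_one_iff)
  qed
  then show ?thesis by (simp add: n_def)
qed

text \<open>Stated separately because the general form would keep an empty product as a trivial
  factor in every row. For \<open>t = 0\<close> no change of coordinates is needed.\<close>

lemma iso_product_torsion:
  assumes "t = 0"
  shows "C \<cong> product_group {1..k} (\<lambda>_. integer_mod_group (s 0))"
proof -
  define v where "v m = (\<lambda>i\<in>{1..k}. m i 0 mod int (s 0))" for m :: "nat \<Rightarrow> nat \<Rightarrow> int"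
  have n: "s 0 > 0" using s_pos[of 0] by simp
  show ?thesis
  proof (rule isoI[of _ v])
    show "group (product_group {1..k} (\<lambda>_. integer_mod_group (s 0)))" by (rule product_group) simp
  next
    fix m m' :: "nat \<Rightarrow> nat \<Rightarrow> int"
    show "v (\<lambda>i j. m i j + m' i j) = v m \<otimes>\<^bsub>product_group {1..k} (\<lambda>_. integer_mod_group (s 0))\<^esub> v m'"
      by (auto simp: v_def fun_eq_iff mod_add_eq)
  next
    show "range v = carrier (product_group {1..k} (\<lambda>_. integer_mod_group (s 0)))"
    proof (intro equalityI subsetI)
      fix y assume y: "y \<in> carrier (product_group {1..k} (\<lambda>_. integer_mod_group (s 0)))"
      have "v (\<lambda>i j. y i) = y"
        by (rule PiE_ext[of _ "{1..k}" "\<lambda>_. {0..<int (s 0)}"])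
          (use y n in \<open>auto simp: v_def carrier_integer_mod_group PiE_iff\<close>)
      then show "y \<in> range v" by (metis rangeI)
    qed (use n in \<open>auto simp: v_def carrier_integer_mod_group\<close>)
  next
    fix m :: "nat \<Rightarrow> nat \<Rightarrow> int"
    have "v m = \<one>\<^bsub>product_group {1..k} (\<lambda>_. integer_mod_group (s 0))\<^esub> \<longleftrightarrow>
        (\<forall>i\<in>{1..k}. int (s 0) dvd m i 0)"
      by (simp add: v_def restrict_eq_iff dvd_eq_mod_eq_0)
    then show "v m = \<one>\<^bsub>product_group {1..k} (\<lambda>_. integer_mod_group (s 0))\<^esub> \<longleftrightarrow> w m = \<one>"
      using assms by (auto simp: w_eq_one_iff dvd_def mult.commute)
  qed
qed

lemma torsion_iff: "torsion_group C \<longleftrightarrow> t = 0"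
proof
  assume tor: "torsion_group C"
  show "t = 0"
  proof (rule ccontr)
    assume "t \<noteq> 0"
    then have "ord (E 1 0) = 0" using k_pos by (intro E_ord_infinite) auto
    then show False using tor E_closed unfolding torsion_group_def by blast
  qed
next
  assume t: "t = 0"
  have "ord c \<noteq> 0" if c: "c \<in> carrier C" for c
  proof
    assume "ord c = 0"
    obtain m where m: "c = w m" using c w_surj by blast
    have "c [^] s 0 = \<one>"
      unfolding m w_nat_pow w_eq_one_iff
    proof
      fix i
      have "\<forall>j\<in>{0..t}. int (s 0) * m i j = m i 0 * int (s j)" using t by simp
      then show "\<exists>x. \<forall>j\<in>{0..t}. int (s 0) * m i j = x * int (s j)" by blast
    qed
    then have "s 0 = 0" using pow_eq_id[OF c, of "s 0"] \<open>ord c = 0\<close> by simp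
    then show False using s_pos[of 0] by simp
  qed
  then show "torsion_group C" by (simp add: torsion_group_def)
qed

end

section \<open>Reduced length-factorial monoids\<close>

text \<open>What is kept of \<open>red H\<close> once the relation is found. The submonoid generated
  by the atoms in the relation satisfies the same assumptions, and the empty relation, the factorial
  case, is included.\<close>

locale relation_monoid = reduced_monoid G for G (structure) +
  fixes A B
  assumes relation: "generating_relation G A B"
    and squarefree: "count A u \<le> 1"
    and generated: "atomically_generated G"
begin

lemma disjoint: "u \<in># A \<Longrightarrow> u \<notin># B"
  using relation by (auto simp: generating_relation_def disjunct_not_in)

lemma sides_atoms: "set_mset A \<subseteq> atoms G" "set_mset B \<subseteq> atoms G"
  using relation by (auto simp: generating_relation_def)

lemma prod_eq_iff:
  "\<lbrakk>set_mset z \<subseteq> atoms G; set_mset z' \<subseteq> atoms G\<rbrakk> \<Longrightarrow>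
    mset_prod G z = mset_prod G z' \<longleftrightarrow> (\<exists>m. multiple_diff A B z z' m)"
  using relation by (simp add: generating_relation_def)

lemma prod_sides_eq: "mset_prod G A = mset_prod G B"
  using prod_eq_iff[OF sides_atoms] by (auto simp: multiple_diff_def intro!: exI[of _ 1])

lemma ex_factorization:
  assumes "x \<in> carrier G"
  obtains z where "set_mset z \<subseteq> atoms G" "mset_prod G z = x"
  using generated assms by (auto simp: atomically_generated_def)

text \<open>Whether two factorizations have the same product depends only on their difference, and a
  common summand does not change it. This is the source of cancellation in
  \<open>red H\<close>.\<close>

lemma cancellative: "comm_monoid_cancel G"
proof (rule comm_monoid_cancelI)
  fix x y c assume "x \<in> carrier G" "y \<in> carrier G" "c \<in> carrier G" and eq: "x \<otimes> c = y \<otimes> c"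
  then obtain z z' w where *: "set_mset z \<subseteq> atoms G" "mset_prod G z = x"
    "set_mset z' \<subseteq> atoms G" "mset_prod G z' = y" "set_mset w \<subseteq> atoms G" "mset_prod G w = c"
    by (meson ex_factorization)
  then have "mset_prod G (z + w) = mset_prod G (z' + w)" using eq atoms_closed by simp
  then obtain m where "multiple_diff A B (z + w) (z' + w) m" using prod_eq_iff * by auto
  then have "mset_prod G z = mset_prod G z'" using prod_eq_iff * by auto
  then show "x = y" using * by simp
qed unfold_locales

lemma prime_divides_prod:
  assumes "p \<in> carrier G" "Divisibility.prime G p" "set_mset z \<subseteq> carrier G" "p divides mset_prod G z"
  shows "\<exists>u\<in>#z. p divides u"
  using assms(3,4)
proof (induction z)
  case empty
  then have "p \<in> Units G" using assms(1) by (auto simp: factor_def Units_def m_comm)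
  then show ?case using assms(2) by (simp add: prime_def)
next
  case (add u z)
  then have "p divides u \<or> p divides mset_prod G z"
    using assms(2) by (auto simp: prime_def)
  then show ?case using add by auto
qed

lemma divides_atom:
  assumes "p divides u" "u \<in> atoms G" "p \<in> carrier G" "p \<noteq> \<one>"
  shows "p = u"
proof -
  obtain c where "c \<in> carrier G" "u = p \<otimes> c" using assms(1) by (auto simp: factor_def)
  moreover from this have "c = \<one>" using atom_factor[of p c] assms by auto
  ultimately show ?thesis using assms by simp
qed

text \<open>A prime occurs in every factorization of what it divides, but an atom of one side of the
  relation divides the product of the other side without occurring there. An atom outside both sides
  has the same count in all factorizations of an element, which makes it prime.\<close>

lemma primes_eq: "primes G = atoms G - (set_mset A \<union> set_mset B)"
proof (intro equalityI subsetI)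
  fix p assume "p \<in> primes G"
  then have p: "p \<in> carrier G" "Divisibility.prime G p" by (auto simp: primes_def)
  have "p \<noteq> \<one>" using p by (auto simp: prime_def)
  have dv: "p \<in># z" if z: "set_mset z \<subseteq> atoms G" "p divides mset_prod G z" for z
  proof -
    obtain u where "u \<in># z" "p divides u"
      using prime_divides_prod[OF p atoms_closed[OF z(1)] z(2)] by blast
    then show ?thesis using divides_atom[of p u] z p \<open>p \<noteq> \<one>\<close> by auto
  qed
  obtain z where z: "set_mset z \<subseteq> atoms G" "mset_prod G z = p" using p(1) by (rule ex_factorization)
  then have "p \<in> atoms G" using dv[of z] p by auto
  moreover have pd: "p divides mset_prod G z" if z: "p \<in># z" "set_mset z \<subseteq> atoms G" for z
  proof -
    obtain w where "z = add_mset p w" using z by (meson mset_add)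
    then show ?thesis using z(2) atoms_closed[of w] p by auto
  qed
  moreover have "p \<notin># A" using pd[of A] dv[of B] sides_atoms prod_sides_eq disjoint by auto
  moreover have "p \<notin># B" using pd[of B] dv[of A] sides_atoms prod_sides_eq disjoint by auto
  ultimately show "p \<in> atoms G - (set_mset A \<union> set_mset B)" by blast
next
  fix u assume u: "u \<in> atoms G - (set_mset A \<union> set_mset B)"
  then have uc: "u \<in> carrier G" "u \<in> atoms G" using atom_closed by auto
  have "u divides x \<or> u divides y"
    if xy: "x \<in> carrier G" "y \<in> carrier G" "u divides (x \<otimes> y)" for x y
  proof -
    obtain c where c: "c \<in> carrier G" "x \<otimes> y = u \<otimes> c" using xy by (auto simp: factor_def)
    obtain z z' w where *: "set_mset z \<subseteq> atoms G" "mset_prod G z = x"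
      "set_mset z' \<subseteq> atoms G" "mset_prod G z' = y" "set_mset w \<subseteq> atoms G" "mset_prod G w = c"
      using xy c by (meson ex_factorization)
    then have "mset_prod G (z + z') = mset_prod G (add_mset u w)"
      using c uc atoms_closed by simp
    then obtain m where m: "multiple_diff A B (z + z') (add_mset u w) m"
      using prod_eq_iff[of "z + z'" "add_mset u w"] * uc by auto
    have "count A u = 0" "count B u = 0" using u by (auto simp: not_in_iff)
    then have "int (count (z + z') u) = 1 + int (count w u)"
      using m[unfolded multiple_diff_def, rule_format, of u] by simp
    then have "count (z + z') u \<noteq> 0" by linarith
    then have "u \<in># z + z'" by (meson count_eq_zero_iff)
    moreover have "u divides mset_prod G z" if uz: "u \<in># z" "set_mset z \<subseteq> atoms G" for z
    proof -
      obtain v where "z = add_mset u v" using uz by (meson mset_add)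
      then show ?thesis using uz(2) atoms_closed[of v] uc by auto
    qed
    ultimately show ?thesis using * by auto
  qed
  then have "Divisibility.prime G u"
    using atom_not_one uc by (auto simp: prime_def Units_eq)
  then show "u \<in> primes G" using uc by (simp add: primes_def)
qed

section \<open>The direct factor without primes\<close>

definition star :: "'a set" where
  "star = mset_prod G ` {z. set_mset z \<subseteq> set_mset A \<union> set_mset B}"

abbreviation "Gs \<equiv> G\<lparr>carrier := star\<rparr>"

lemma sides_closed: "set_mset z \<subseteq> set_mset A \<union> set_mset B \<Longrightarrow> set_mset z \<subseteq> carrier G"
  using sides_atoms atoms_closed[of z] by blast

lemma submonoid_star: "submonoid star G"
proof (rule submonoid.intro)
  show "star \<subseteq> carrier G" using sides_closed by (auto simp: star_def)
  show "\<one> \<in> star" unfolding star_def by (rule image_eqI[of _ _ "{#}"]) auto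
next
  fix x y assume "x \<in> star" "y \<in> star"
  then obtain z z' where z: "set_mset z \<subseteq> set_mset A \<union> set_mset B" "x = mset_prod G z"
    "set_mset z' \<subseteq> set_mset A \<union> set_mset B" "y = mset_prod G z'" by (auto simp: star_def)
  then show "x \<otimes> y \<in> star"
    unfolding star_def by (intro image_eqI[of _ _ "z + z'"]) (auto simp: sides_closed)
qed

lemma star_closed: "x \<in> star \<Longrightarrow> x \<in> carrier G"
  using submonoid.subset[OF submonoid_star] by blast

lemma comm_monoid_star: "comm_monoid Gs"
  by (rule submonoid_is_comm_monoid[OF submonoid_star])

lemma Units_star: "Units Gs = {\<one>}"
proof -
  interpret S: comm_monoid Gs by (rule comm_monoid_star)
  have "x = \<one>" if "x \<in> Units Gs" for x
    using that mult_eq_one star_closed by (auto simp: Units_def)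
  moreover have "\<one> \<in> Units Gs" using S.Units_one_closed by simp
  ultimately show ?thesis by blast
qed

lemma sides_in_star: "set_mset A \<union> set_mset B \<subseteq> star"
proof
  fix u assume u: "u \<in> set_mset A \<union> set_mset B"
  then have "u \<in> carrier G" using sides_atoms atom_closed by blast
  then show "u \<in> star" using u unfolding star_def by (intro image_eqI[of _ _ "{#u#}"]) auto
qed

lemma prod_star: "set_mset z \<subseteq> set_mset A \<union> set_mset B \<Longrightarrow> mset_prod Gs z = mset_prod G z"
  using mset_prod_submonoid[OF submonoid_star] sides_in_star by blast

lemma atoms_star: "atoms Gs = set_mset A \<union> set_mset B"
proof (intro equalityI subsetI)
  fix u assume "u \<in> atoms Gs"
  then have u: "u \<in> star" "u \<noteq> \<one>" "\<And>a b. \<lbrakk>a \<in> star; b \<in> star; u = a \<otimes> b\<rbrakk> \<Longrightarrow> a = \<one> \<or> b = \<one>"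
    by (auto simp: atoms_def Units_star)
  then obtain z where z: "set_mset z \<subseteq> set_mset A \<union> set_mset B" "u = mset_prod G z"
    by (auto simp: star_def)
  then obtain v w where vw: "z = add_mset v w" using u(2) by (cases z) auto
  then have wc: "set_mset w \<subseteq> carrier G" "v \<in> carrier G" using sides_closed[of z] z by auto
  have "v \<in> star" "mset_prod G w \<in> star" "u = v \<otimes> mset_prod G w"
    using z vw sides_in_star wc by (auto simp: star_def)
  moreover have "v \<noteq> \<one>" using z vw sides_atoms atom_not_one by auto
  ultimately have "mset_prod G w = \<one>" using u(3) by blast
  then have "u = v" using z(2) vw wc by simp
  then show "u \<in> set_mset A \<union> set_mset B" using z vw by auto
next
  fix u assume u: "u \<in> set_mset A \<union> set_mset B"
  then have ua: "u \<in> atoms G" using sides_atoms by blast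
  have "a = \<one> \<or> b = \<one>" if "a \<in> star" "b \<in> star" "u = a \<otimes> b" for a b
    using atom_factor[of a b] star_closed that ua by simp
  moreover have "u \<in> star" "u \<noteq> \<one>" using u sides_in_star atom_not_one[OF ua] by blast+
  ultimately show "u \<in> atoms Gs" unfolding atoms_def Units_star by simp
qed

lemma relation_monoid_star: "relation_monoid Gs A B"
proof -
  interpret S: comm_monoid Gs by (rule comm_monoid_star)
  show ?thesis
  proof unfold_locales
    show "generating_relation Gs A B"
      unfolding generating_relation_def atoms_star
    proof (intro conjI allI impI)
      fix z z' assume z: "set_mset z \<subseteq> set_mset A \<union> set_mset B \<and> set_mset z' \<subseteq> set_mset A \<union> set_mset B"
      then have "set_mset z \<subseteq> atoms G" "set_mset z' \<subseteq> atoms G" using sides_atoms by blast+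
      then show "(mset_prod Gs z = mset_prod Gs z') = (\<exists>m. multiple_diff A B z z' m)"
        using z prod_eq_iff by (simp add: prod_star)
    qed (use relation in \<open>auto simp: generating_relation_def\<close>)
    show "atomically_generated Gs"
      unfolding atomically_generated_def atoms_star
    proof
      fix x assume "x \<in> carrier Gs"
      then obtain z where "set_mset z \<subseteq> set_mset A \<union> set_mset B" "x = mset_prod G z"
        by (auto simp: star_def)
      then show "\<exists>z. set_mset z \<subseteq> set_mset A \<union> set_mset B \<and> mset_prod Gs z = x"
        using prod_star by auto
    qed
  qed (use Units_star squarefree in auto)
qed

text \<open>The relation does not involve primes, so the prime part of an element is the same in all
  its factorizations; the other factor is then determined by cancellation.\<close>

lemma iso_primes_star:
  "(\<lambda>(M, h). mset_prod G M \<otimes> h) \<in> iso (free_monoid (primes G) \<times>\<times> Gs) G"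
proof -
  interpret comm_monoid_cancel G by (rule cancellative)
  let ?f = "\<lambda>(M, h). mset_prod G M \<otimes> h"
  let ?D = "free_monoid (primes G) \<times>\<times> Gs"
  have carr: "carrier ?D = {M. set_mset M \<subseteq> primes G} \<times> star" by (simp add: DirProd_def)
  have pa: "set_mset M \<subseteq> atoms G" if "set_mset M \<subseteq> primes G" for M
    using that primes_eq by blast
  note pc = atoms_closed[OF pa]
  have "?f \<in> hom ?D G"
  proof (rule homI)
    fix x y assume "x \<in> carrier ?D" "y \<in> carrier ?D"
    then obtain M h N k where *: "x = (M, h)" "y = (N, k)" "set_mset M \<subseteq> primes G"
      "set_mset N \<subseteq> primes G" "h \<in> star" "k \<in> star" by (auto simp: carr)
    then show "?f (x \<otimes>\<^bsub>?D\<^esub> y) = ?f x \<otimes> ?f y"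
      using pc[of M] pc[of N] star_closed[of h] star_closed[of k] by (simp add: m_ac)
  qed (auto simp: carr pc star_closed)
  moreover have "inj_on ?f (carrier ?D)"
  proof (rule inj_onI)
    fix x y assume "x \<in> carrier ?D" "y \<in> carrier ?D" and eq: "?f x = ?f y"
    then obtain M h N k where *: "x = (M, h)" "y = (N, k)" "set_mset M \<subseteq> primes G"
      "set_mset N \<subseteq> primes G" "h \<in> star" "k \<in> star" by (auto simp: carr)
    then obtain z z' where z: "set_mset z \<subseteq> set_mset A \<union> set_mset B" "h = mset_prod G z"
      "set_mset z' \<subseteq> set_mset A \<union> set_mset B" "k = mset_prod G z'" by (auto simp: star_def)
    have "mset_prod G (M + z) = mset_prod G (N + z')"
      using eq * z pc sides_closed by simp
    moreover have "set_mset (M + z) \<subseteq> atoms G" "set_mset (N + z') \<subseteq> atoms G"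
      using * z pa[of M] pa[of N] sides_atoms by auto
    ultimately obtain m where m: "multiple_diff A B (M + z) (N + z') m" using prod_eq_iff by blast
    have "M = N"
    proof (rule multiset_eqI)
      fix u show "count M u = count N u"
      proof (cases "u \<in> primes G")
        case True
        then have "u \<notin># A" "u \<notin># B" "u \<notin># z" "u \<notin># z'" using primes_eq z by auto
        then show ?thesis using m[unfolded multiple_diff_def, rule_format, of u] by (simp add: not_in_iff)
      next
        case False
        then have "u \<notin># M" "u \<notin># N" using * by auto
        then show ?thesis by (simp add: not_in_iff)
      qed
    qed
    moreover have "h = k"
    proof (rule l_cancel)
      show "mset_prod G M \<otimes> h = mset_prod G M \<otimes> k" using eq * \<open>M = N\<close> by simp
    qed (use * pc star_closed in auto)
    ultimately show "x = y" using * by simp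
  qed
  moreover have "?f ` carrier ?D = carrier G"
  proof (intro equalityI subsetI)
    fix x assume "x \<in> carrier G"
    then obtain z where z: "set_mset z \<subseteq> atoms G" "mset_prod G z = x" by (rule ex_factorization)
    obtain M N where MN: "z = M + N" "set_mset M \<subseteq> primes G" "set_mset N \<subseteq> set_mset A \<union> set_mset B"
    proof
      show "z = filter_mset (\<lambda>u. u \<in> primes G) z + filter_mset (\<lambda>u. u \<notin> primes G) z" by simp
    qed (use z primes_eq in auto)
    then have "x = ?f (M, mset_prod G N)" using z(2) pc sides_closed by simp
    moreover have "(M, mset_prod G N) \<in> carrier ?D" using MN by (auto simp: carr star_def)
    ultimately show "x \<in> ?f ` carrier ?D" by (rule image_eqI)
  qed (use pc star_closed in \<open>auto simp: carr\<close>)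
  ultimately show ?thesis by (simp add: iso_def bij_betw_def)
qed

end

lemma ex_mset_count:
  assumes "finite S"
  obtains w where "set_mset w \<subseteq> S" "\<And>x. x \<in> S \<Longrightarrow> count w x = f x"
proof -
  define w where "w = (\<Sum>x\<in>S. replicate_mset (f x) x)"
  have c: "count w y = (if y \<in> S then f y else 0)" for y
    using assms by (simp add: w_def count_sum)
  then have "set_mset w \<subseteq> S" by (metis count_eq_zero_iff subsetI)
  with c show thesis by (intro that[of w]) auto
qed

section \<open>The monoid generated by the atoms of the generating relation\<close>

text \<open>The prime divisors are the pairs \<open>(u, v)\<close> with \<open>u\<close> in \<open>A\<close> and \<open>v\<close> in \<open>B\<close>: an atom \<open>u\<close> of \<open>A\<close>
  is divisible by \<open>(u, v)\<close> as often as \<open>v\<close> occurs in \<open>B\<close>, and an atom \<open>v\<close> of \<open>B\<close> is the product of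
  all \<open>(u, v)\<close>.\<close>

locale pure_relation_monoid = relation_monoid +
  assumes atoms_eq: "atoms G = set_mset A \<union> set_mset B"
begin

definition divisor_of_atom :: "'a \<Rightarrow> ('a \<times> 'a) multiset" where
  "divisor_of_atom x = (if x \<in># A then image_mset (Pair x) B else image_mset (\<lambda>u. (u, x)) A)"

definition divisor_of :: "'a multiset \<Rightarrow> ('a \<times> 'a) multiset" where
  "divisor_of z = (\<Sum>x\<in>#z. divisor_of_atom x)"

abbreviation "prime_divs \<equiv> set_mset A \<times> set_mset B"

lemma count_A: "u \<in># A \<Longrightarrow> count A u = 1"
  using squarefree[of u] count_greater_zero_iff[of A u] by linarith

text \<open>The matrix entry \<open>x_i s_j + y_j\<close>, with \<open>x\<close> the counts on
  \<open>A\<close> and \<open>y\<close> the counts on \<open>B\<close>. The divisor theory and the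
  class group are computed from it.\<close>

lemma count_divisor_of:
  assumes "set_mset z \<subseteq> atoms G" "u \<in># A" "v \<in># B"
  shows "count (divisor_of z) (u, v) = count z u * count B v + count z v"
  using assms(1)
proof (induction z)
  case empty
  then show ?case by (simp add: divisor_of_def)
next
  case (add x z)
  have "count (image_mset (Pair x) M) (u, v) = (if x = u then count M v else 0)" for M :: "'a multiset"
    by (induction M) auto
  moreover have "count (image_mset (\<lambda>u. (u, x)) M) (u, v) = (if x = v then count M u else 0)" for M :: "'a multiset"
    by (induction M) auto
  ultimately have "count (divisor_of_atom x) (u, v) = count {#x#} u * count B v + count {#x#} v"
    using add.prems assms(2,3) disjoint count_A[OF assms(2)]
    by (auto simp: divisor_of_atom_def atoms_eq)
  then show ?case using add by (simp add: divisor_of_def algebra_simps)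
qed

lemma divisor_of_closed: "set_mset z \<subseteq> atoms G \<Longrightarrow> set_mset (divisor_of z) \<subseteq> prime_divs"
  by (auto simp: divisor_of_def divisor_of_atom_def atoms_eq split: if_splits)

lemma divisor_of_union: "divisor_of (z + z') = divisor_of z + divisor_of z'"
  by (simp add: divisor_of_def)

text \<open>Applying the relation \<open>m\<close> times changes the count at \<open>u\<close> by
  \<open>m\<close> and the count at \<open>v\<close> by \<open>- m\<close> times the multiplicity of
  \<open>v\<close> in \<open>B\<close>. In the matrix entry these cancel, as \<open>u\<close> occurs
  exactly once in \<open>A\<close>.\<close>

lemma divisor_of_cong:
  assumes "set_mset z \<subseteq> atoms G" "set_mset z' \<subseteq> atoms G" "mset_prod G z = mset_prod G z'"
  shows "divisor_of z = divisor_of z'"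
proof (rule multiset_eqI)
  fix p :: "'a \<times> 'a"
  obtain u v where p: "p = (u, v)" by (cases p)
  show "count (divisor_of z) p = count (divisor_of z') p"
  proof (cases "p \<in> prime_divs")
    case True
    then have uv: "u \<in># A" "v \<in># B" using p by auto
    obtain m where m: "multiple_diff A B z z' m" using prod_eq_iff assms by blast
    have "count A v = 0" "count B u = 0" using disjoint[of v] disjoint[OF uv(1)] uv(2) not_in_iff by metis+
    then have "int (count z u) - int (count z' u) = m" "int (count z v) - int (count z' v) = - m * int (count B v)"
      using m[unfolded multiple_diff_def, rule_format, of u] m[unfolded multiple_diff_def, rule_format, of v]
        count_A[OF uv(1)] by auto
    then have "int (count z u) = int (count z' u) + m"
      "int (count z v) = int (count z' v) - m * int (count B v)" by auto
    then have "int (count z u * count B v + count z v) = int (count z' u * count B v + count z' v)"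
      by (simp add: algebra_simps)
    then show ?thesis unfolding p count_divisor_of[OF assms(1) uv] count_divisor_of[OF assms(2) uv]
      by (simp only: of_nat_eq_iff)
  next
    case False
    then have "p \<notin># divisor_of z" "p \<notin># divisor_of z'" using divisor_of_closed assms by blast+
    then show ?thesis by (simp add: not_in_iff)
  qed
qed

definition div_map :: "'a \<Rightarrow> ('a \<times> 'a) multiset" where
  "div_map x = divisor_of (SOME z. set_mset z \<subseteq> atoms G \<and> mset_prod G z = x)"

lemma div_map_prod:
  assumes "set_mset z \<subseteq> atoms G"
  shows "div_map (mset_prod G z) = divisor_of z"
proof -
  define w where "w = (SOME w. set_mset w \<subseteq> atoms G \<and> mset_prod G w = mset_prod G z)"
  have "set_mset w \<subseteq> atoms G \<and> mset_prod G w = mset_prod G z"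
    unfolding w_def by (rule someI[of _ z]) (use assms in simp)
  then show ?thesis using divisor_of_cong[of w z] assms by (simp add: div_map_def w_def)
qed

text \<open>The difference of the two factorizations may have negative counts, but a suitable
  multiple of the relation makes all of them nonnegative, which gives a factorization of the
  quotient.\<close>

lemma divides_if_divisor_subset:
  assumes z: "set_mset z \<subseteq> atoms G" "set_mset z' \<subseteq> atoms G"
    and sub: "divisor_of z \<subseteq># divisor_of z'"
  shows "mset_prod G z divides mset_prod G z'"
proof (cases "A = {#}")
  case True
  then have "mset_prod G B = \<one>" using prod_sides_eq by simp
  then have "B = {#}" using mset_prod_atoms_eq_one sides_atoms by blast
  then have "z = {#}" "z' = {#}" using True z by (auto simp: atoms_eq)
  then show ?thesis by simp
next
  case False
  define d where "d x = int (count z' x) - int (count z x)" for x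
  have d: "d u * int (count B v) + d v \<ge> 0" if "u \<in># A" "v \<in># B" for u v
  proof -
    have "count (divisor_of z) (u, v) \<le> count (divisor_of z') (u, v)"
      using sub by (rule mset_subset_eq_count)
    then have "count z u * count B v + count z v \<le> count z' u * count B v + count z' v"
      using count_divisor_of that z by simp
    then have "int (count z u * count B v + count z v) \<le> int (count z' u * count B v + count z' v)"
      by (simp only: of_nat_le_iff)
    then show ?thesis by (simp add: d_def algebra_simps)
  qed
  \<comment> \<open>Subtracting \<open>m (A - B)\<close> from \<open>d\<close> leaves
    \<open>d u - m\<close> on \<open>A\<close>, which is nonnegative for the minimum, and
    \<open>d v + m (count B v)\<close> on \<open>B\<close>, which is nonnegative because the minimum
    is attained at some \<open>u0\<close> and \<open>d\<close> satisfies the matrix inequality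
    there.\<close>
  define m where "m = Min (d ` set_mset A)"
  have "m \<in> d ` set_mset A" unfolding m_def using False by (intro Min_in) auto
  then obtain u0 where u0: "u0 \<in># A" "m = d u0" by auto
  have m: "m \<le> d u" if "u \<in># A" for u unfolding m_def using that by (intro Min_le) auto
  have dv: "d v + m * int (count B v) \<ge> 0" if "v \<in># B" for v using d[OF u0(1) that] u0(2) by simp
  obtain w where w: "set_mset w \<subseteq> set_mset A \<union> set_mset B" "\<And>x. x \<in> set_mset A \<union> set_mset B \<Longrightarrow>
      count w x = (if x \<in># A then nat (d x - m) else nat (d x + m * int (count B x)))"
    by (rule ex_mset_count[of "set_mset A \<union> set_mset B"
          "\<lambda>x. if x \<in># A then nat (d x - m) else nat (d x + m * int (count B x))"]) auto
  have "multiple_diff A B (z + w) z' (- m)"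
    unfolding multiple_diff_def
  proof
    fix x
    consider "x \<in># A" | "x \<in># B" | "x \<notin> atoms G" using atoms_eq by blast
    then show "int (count (z + w) x) - int (count z' x) = - m * (int (count A x) - int (count B x))"
    proof cases
      case 1
      then have "x \<notin># B" using disjoint by blast
      then have "count B x = 0" by (simp add: not_in_iff)
      moreover have "int (count w x) = d x - m" using 1 w m by simp
      ultimately show ?thesis using count_A[OF 1] by (simp add: d_def)
    next
      case 2
      then have "x \<notin># A" using disjoint by blast
      then have "count A x = 0" by (simp add: not_in_iff)
      moreover have "int (count w x) = d x + m * int (count B x)" using 2 w dv \<open>x \<notin># A\<close> by simp
      ultimately show ?thesis by (simp add: d_def)
    next
      case 3
      then have "x \<notin># z" "x \<notin># z'" "x \<notin># w" "x \<notin># A" "x \<notin># B" using z w(1) atoms_eq by auto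
      then show ?thesis by (simp add: not_in_iff)
    qed
  qed
  moreover have wa: "set_mset w \<subseteq> atoms G" using w(1) atoms_eq by simp
  ultimately have "mset_prod G z' = mset_prod G (z + w)"
    using prod_eq_iff[of "z + w" z'] z by auto
  also have "\<dots> = mset_prod G z \<otimes> mset_prod G w" using atoms_closed z wa by simp
  finally show ?thesis using atoms_closed[OF wa] by auto
qed

lemma divisor_monoid_div_map: "divisor_monoid G prime_divs div_map"
proof (rule divisor_monoidI)
  fix a assume "a \<in> carrier G"
  then obtain z where "set_mset z \<subseteq> atoms G" "mset_prod G z = a" by (rule ex_factorization)
  then show "set_mset (div_map a) \<subseteq> prime_divs" using div_map_prod divisor_of_closed by metis
next
  fix a b assume "a \<in> carrier G" "b \<in> carrier G"
  then obtain z z' where z: "set_mset z \<subseteq> atoms G" "mset_prod G z = a"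
    "set_mset z' \<subseteq> atoms G" "mset_prod G z' = b" by (meson ex_factorization)
  then have "a \<otimes> b = mset_prod G (z + z')" using atoms_closed by simp
  then show "div_map (a \<otimes> b) = div_map a + div_map b"
    using z div_map_prod[of "z + z'"] div_map_prod[of z] div_map_prod[of z'] by (simp add: divisor_of_union)
next
  show "div_map \<one> = {#}" using div_map_prod[of "{#}"] by (simp add: divisor_of_def)
next
  fix a b assume "a \<in> carrier G" "b \<in> carrier G" and sub: "div_map a \<subseteq># div_map b"
  then obtain z z' where z: "set_mset z \<subseteq> atoms G" "mset_prod G z = a"
    "set_mset z' \<subseteq> atoms G" "mset_prod G z' = b" by (meson ex_factorization)
  then show "a divides b" using divides_if_divisor_subset[of z z'] sub div_map_prod by metis
next
  fix p assume "p \<in> prime_divs"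
  then obtain u v where uv: "p = (u, v)" "u \<in># A" "v \<in># B" by auto
  then have c: "u \<in> carrier G" "v \<in> carrier G" "u \<in> atoms G" "v \<in> atoms G"
    using sides_atoms atom_closed by auto
  have div: "div_map x = divisor_of {#x#}" if "x \<in> atoms G" for x
    using div_map_prod[of "{#x#}"] that atom_closed by simp
  have ne: "u \<noteq> v" using uv disjoint by blast
  have cnt: "count (div_map u) (u', v') = (if u' = u then count B v' else 0)"
     "count (div_map v) (u', v') = (if v' = v then 1 else 0)" if "u' \<in># A" "v' \<in># B" for u' v'
    using that uv c disjoint div count_divisor_of[of "{#u#}" u' v'] count_divisor_of[of "{#v#}" u' v'] by auto
  have "count (div_map u) (u, v) > 0" "count (div_map v) (u, v) > 0" using cnt[OF uv(2,3)] uv by auto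
  then have "p \<in># div_map u" "p \<in># div_map v" using uv(1) by (auto simp flip: count_greater_zero_iff)
  \<comment> \<open>The divisor of \<open>u\<close> lives in row \<open>u\<close> only, and that of
    \<open>v\<close> is column \<open>v\<close> with all entries 1, so their minimum is the single
    prime divisor \<open>(u, v)\<close>.\<close>
  moreover have "\<exists>a\<in>{u, v}. count (div_map a) q = count {#p#} q" if qP: "q \<in> prime_divs" for q
  proof -
    obtain u' v' where q: "q = (u', v')" "u' \<in># A" "v' \<in># B" using qP by auto
    show ?thesis
    proof (cases "u' = u")
      case True
      then show ?thesis using cnt(2)[OF q(2,3)] q uv by (intro bexI[of _ v]) auto
    next
      case False
      then show ?thesis using cnt(1)[OF q(2,3)] q uv by (intro bexI[of _ u]) auto
    qed
  qed
  ultimately show "\<exists>S. finite S \<and> S \<noteq> {} \<and> S \<subseteq> carrier G \<and> (\<forall>a\<in>S. p \<in># div_map a) \<and>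
      (\<forall>q\<in>prime_divs. \<exists>a\<in>S. count (div_map a) q = count {#p#} q)"
    using c by (intro exI[of _ "{u, v}"]) auto
qed unfold_locales

end

text \<open>The prime divisors of an arbitrary divisor theory are matched with the pairs of atoms
  and numbered as a matrix. The conditions on \<open>k\<close> and \<open>s\<close> in
  \<open>row_quotient\<close> are the length conditions on the two sides of the relation.\<close>

lemma (in pure_relation_monoid) ex_coordinates:
  assumes nontrivial: "size A \<ge> 2" "size B \<ge> 2" "size A \<noteq> size B"
    and D: "divisor_monoid G Q \<psi>"
  obtains t k :: nat and s :: "nat \<Rightarrow> nat" and w and p :: "nat \<times> nat \<Rightarrow> 'q"
  where "row_quotient (class_group G Q \<psi>) w t k s"
    and "bij_betw p ({0..k} \<times> {0..t}) (Q :: 'q set)"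
    and "\<And>i j. \<lbrakk>i \<in> {0..k}; j \<in> {0..t}\<rbrakk> \<Longrightarrow>
      divisor_class G Q \<psi> (p (i, j)) = w (row_quotient.unit_vec i j)"
proof -
  interpret D: divisor_monoid G Q \<psi> by fact
  obtain \<beta> where \<beta>: "bij_betw \<beta> prime_divs Q"
    "\<And>h p. \<lbrakk>h \<in> carrier G; p \<in> prime_divs\<rbrakk> \<Longrightarrow> count (div_map h) p = count (\<psi> h) (\<beta> p)"
    by (rule divisor_theory_unique[OF divisor_monoid_div_map D]) (rule that)
  have "size A = (\<Sum>u\<in>set_mset A. count A u)" by (simp add: size_multiset_overloaded_eq)
  also have "\<dots> = (\<Sum>u\<in>set_mset A. 1)" by (rule sum.cong) (auto simp: count_A)
  finally have cardA: "card (set_mset A) = size A" by simp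
  have cardB: "card (set_mset B) > 0" using nontrivial(2) by (auto simp: card_gt_0_iff)
  \<comment> \<open>The rows are numbered 0 to \<open>k\<close> and the columns 0 to
    \<open>t\<close>. As \<open>A\<close> is squarefree, its size is its number of atoms; for
    \<open>B\<close> only the distinct atoms count here, their multiplicities become
    \<open>s\<close>.\<close>
  define k t where "k = size A - 1" and "t = card (set_mset B) - 1"
  have k: "k \<ge> 1" "k + 1 = size A" using nontrivial by (auto simp: k_def)
  have "{0..<card (set_mset A)} = {0..k}" "{0..<card (set_mset B)} = {0..t}"
    using cardA nontrivial(1) cardB by (auto simp: k_def t_def)
  then obtain V U where V: "bij_betw V {0..k} (set_mset A)" and U: "bij_betw U {0..t} (set_mset B)"
    using ex_bij_betw_nat_finite[of "set_mset A"] ex_bij_betw_nat_finite[of "set_mset B"] by auto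
  have VA: "V i \<in># A" if "i \<in> {0..k}" for i using V that by (auto simp: bij_betw_def)
  have UB: "U j \<in># B" if "j \<in> {0..t}" for j using U that by (auto simp: bij_betw_def)
  define s where "s j = count B (U j)" for j
  have s_pos: "s j \<ge> 1" if "j \<le> t" for j using UB[of j] that by (simp add: s_def Suc_le_eq)
  have "(\<Sum>j\<in>{0..t}. count B (U j)) = (\<Sum>v\<in>set_mset B. count B v)"
    by (rule sum.reindex_bij_betw[OF U])
  then have s_sum: "(\<Sum>j=0..t. s j) = size B" by (simp add: s_def size_multiset_overloaded_eq)
  define p where "p = (\<lambda>(i, j). \<beta> (V i, U j))"
  have "bij_betw (\<lambda>(i, j). (V i, U j)) ({0..k} \<times> {0..t}) prime_divs"
  proof -
    have "(\<lambda>(i, j). (V i, U j)) ` ({0..k} \<times> {0..t}) = V ` {0..k} \<times> U ` {0..t}" by auto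
    then show ?thesis using V U by (simp add: bij_betw_def inj_on_def)
  qed
  then have p: "bij_betw p ({0..k} \<times> {0..t}) Q"
    using bij_betw_trans[OF _ \<beta>(1)] unfolding p_def comp_def
    by (auto simp: case_prod_unfold)
  have pQ: "p (i, j) \<in> Q" if "i \<in> {0..k}" "j \<in> {0..t}" for i j
    using p that by (auto simp: bij_betw_def)
  have p_eq: "p (i, j) = p (i', j') \<longleftrightarrow> i = i' \<and> j = j'"
    if "i \<in> {0..k}" "j \<in> {0..t}" "i' \<in> {0..k}" "j' \<in> {0..t}" for i j i' j'
    using p that by (auto simp: bij_betw_def inj_on_def)
  have Q_cases: "\<exists>i\<in>{0..k}. \<exists>j\<in>{0..t}. q = p (i, j)" if "q \<in> Q" for q
    using p that by (auto simp: bij_betw_def)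
  have finQ: "finite Q" using p bij_betw_finite by blast
  have count_\<psi>: "count (\<psi> (mset_prod G z)) (p (i, j)) = count z (V i) * s j + count z (U j)"
    if "set_mset z \<subseteq> atoms G" "i \<in> {0..k}" "j \<in> {0..t}" for z i j
  proof -
    have "count (\<psi> (mset_prod G z)) (p (i, j)) = count (div_map (mset_prod G z)) (V i, U j)"
      using \<beta>(2)[of "mset_prod G z" "(V i, U j)"] VA UB atoms_closed that by (simp add: p_def)
    also have "\<dots> = count z (V i) * s j + count z (U j)"
      using that VA UB by (simp add: div_map_prod count_divisor_of s_def)
    finally show ?thesis .
  qed
  \<comment> \<open>The integers \<open>x i\<close> and \<open>y j\<close> are differences of counts
    at the atoms of \<open>A\<close> and of \<open>B\<close>; any integers occur, since both
    factorizations are free.\<close>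
  have principal: "c \<in> D.K \<longleftrightarrow> (\<exists>x y :: nat \<Rightarrow> int. \<forall>i\<in>{0..k}. \<forall>j\<in>{0..t}.
      Poly_Mapping.lookup c (p (i, j)) = x i * int (s j) + y j)"
    if c: "Poly_Mapping.keys c \<subseteq> Q" for c
  proof
    assume "c \<in> D.K"
    then obtain a b where ab: "a \<in> carrier G" "b \<in> carrier G"
      "\<And>q. Poly_Mapping.lookup c q = int (count (\<psi> a) q) - int (count (\<psi> b) q)"
      by (auto simp: D.principal_group_lookup_iff)
    obtain z z' where z: "set_mset z \<subseteq> atoms G" "mset_prod G z = a"
      "set_mset z' \<subseteq> atoms G" "mset_prod G z' = b" using ab by (meson ex_factorization)
    define x y where "x i = int (count z (V i)) - int (count z' (V i))"
      and "y j = int (count z (U j)) - int (count z' (U j))" for i j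
    have "Poly_Mapping.lookup c (p (i, j)) = x i * int (s j) + y j" if "i \<in> {0..k}" "j \<in> {0..t}" for i j
      using count_\<psi>[OF z(1) that] count_\<psi>[OF z(3) that] z
      by (simp add: ab(3) x_def y_def algebra_simps)
    then show "\<exists>x y :: nat \<Rightarrow> int. \<forall>i\<in>{0..k}. \<forall>j\<in>{0..t}.
      Poly_Mapping.lookup c (p (i, j)) = x i * int (s j) + y j"
      by (intro exI[of _ x] exI[of _ y]) simp
  next
    assume "\<exists>x y :: nat \<Rightarrow> int. \<forall>i\<in>{0..k}. \<forall>j\<in>{0..t}.
      Poly_Mapping.lookup c (p (i, j)) = x i * int (s j) + y j"
    then obtain x y :: "nat \<Rightarrow> int" where xy: "\<And>i j. \<lbrakk>i \<in> {0..k}; j \<in> {0..t}\<rbrakk> \<Longrightarrow>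
      Poly_Mapping.lookup c (p (i, j)) = x i * int (s j) + y j" by blast
    have "\<exists>z. set_mset z \<subseteq> atoms G \<and> (\<forall>i\<in>{0..k}. count z (V i) = f i) \<and> (\<forall>j\<in>{0..t}. count z (U j) = g j)"
      for f g :: "nat \<Rightarrow> nat"
    proof -
      let ?f = "\<lambda>e. if e \<in># A then f (inv_into {0..k} V e) else g (inv_into {0..t} U e)"
      obtain z where z: "set_mset z \<subseteq> atoms G" "\<And>e. e \<in> atoms G \<Longrightarrow> count z e = ?f e"
        by (rule ex_mset_count[of "atoms G" ?f]) (auto simp: atoms_eq)
      have "count z (V i) = f i" if "i \<in> {0..k}" for i
        using z(2)[of "V i"] VA[OF that] bij_betw_inv_into_left[OF V that] by (simp add: atoms_eq)
      moreover have "count z (U j) = g j" if "j \<in> {0..t}" for j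
        using z(2)[of "U j"] UB[OF that] disjoint bij_betw_inv_into_left[OF U that] by (auto simp: atoms_eq)
      ultimately show ?thesis using z(1) by blast
    qed
    note ex = this
    \<comment> \<open>The integers are split into positive parts, used for \<open>z\<close>, and
      negative parts, used for \<open>z'\<close>.\<close>
    obtain z where z: "set_mset z \<subseteq> atoms G" "\<forall>i\<in>{0..k}. count z (V i) = nat (x i)"
      "\<forall>j\<in>{0..t}. count z (U j) = nat (y j)" using ex[of "\<lambda>i. nat (x i)" "\<lambda>j. nat (y j)"] by blast
    obtain z' where z': "set_mset z' \<subseteq> atoms G" "\<forall>i\<in>{0..k}. count z' (V i) = nat (- x i)"
      "\<forall>j\<in>{0..t}. count z' (U j) = nat (- y j)" using ex[of "\<lambda>i. nat (- x i)" "\<lambda>j. nat (- y j)"] by blast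
    have zc: "mset_prod G z \<in> carrier G" "mset_prod G z' \<in> carrier G" using z z' atoms_closed by auto
    have "Poly_Mapping.lookup c q =
        int (count (\<psi> (mset_prod G z)) q) - int (count (\<psi> (mset_prod G z')) q)" for q
    proof (cases "q \<in> Q")
      case True
      then obtain i j where ij: "i \<in> {0..k}" "j \<in> {0..t}" "q = p (i, j)" using Q_cases by blast
      have "int (nat (x i)) = int (nat (- x i)) + x i" "int (nat (y j)) = int (nat (- y j)) + y j" by auto
      then show ?thesis
        using ij xy[OF ij(1,2)] count_\<psi>[OF z(1) ij(1,2)] count_\<psi>[OF z'(1) ij(1,2)] z z'
        by (simp add: algebra_simps)
    next
      case False
      then have "q \<notin># \<psi> (mset_prod G z)" "q \<notin># \<psi> (mset_prod G z')" "q \<notin> Poly_Mapping.keys c"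
        using D.map_closed zc c by blast+
      then show ?thesis by (simp add: not_in_iff in_keys_iff)
    qed
    then show "c \<in> D.K" unfolding D.principal_group_lookup_iff using zc by blast
  qed
  have principalI: "c \<in> D.K" if "Poly_Mapping.keys c \<subseteq> Q" "\<And>i j. \<lbrakk>i \<in> {0..k}; j \<in> {0..t}\<rbrakk> \<Longrightarrow>
      Poly_Mapping.lookup c (p (i, j)) = y j" for c y
    unfolding principal[OF that(1)] by (intro exI[of _ "\<lambda>_. 0"] exI[of _ y]) (simp add: that(2))
  define p' where "p' = inv_into ({0..k} \<times> {0..t}) p"
  have p': "p' (p (i, j)) = (i, j)" if "i \<in> {0..k}" "j \<in> {0..t}" for i j
    using bij_betw_inv_into_left[OF p, of "(i, j)"] that by (simp add: p'_def)
  \<comment> \<open>The matrix \<open>m\<close> is placed in the rows from 1 on, with zeros in row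
    0: modulo principal divisors every divisor has this shape.\<close>
  define W :: "(nat \<Rightarrow> nat \<Rightarrow> int) \<Rightarrow> 'q \<Rightarrow>\<^sub>0 int" where "W m = Abs_poly_mapping
    (\<lambda>q. if q \<in> Q \<and> fst (p' q) \<ge> 1 then m (fst (p' q)) (snd (p' q)) else 0)" for m
  have lW: "Poly_Mapping.lookup (W m) q = (if q \<in> Q \<and> fst (p' q) \<ge> 1 then m (fst (p' q)) (snd (p' q)) else 0)" for m q
  proof -
    have "finite {q. (if q \<in> Q \<and> fst (p' q) \<ge> 1 then m (fst (p' q)) (snd (p' q)) else 0) \<noteq> 0}"
      by (rule finite_subset[OF _ finQ]) (auto split: if_splits)
    then show ?thesis by (simp add: W_def lookup_Abs_poly_mapping)
  qed
  have lWp: "Poly_Mapping.lookup (W m) (p (i, j)) = (if i \<ge> 1 then m i j else 0)"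
    if "i \<in> {0..k}" "j \<in> {0..t}" for m i j using that by (simp add: lW p' pQ)
  have keysW: "Poly_Mapping.keys (W m) \<subseteq> Q" for m by (auto simp: in_keys_iff lW split: if_splits)
  have W_add: "W (\<lambda>i j. m i j + m' i j) = W m + W m'" for m m'
    by (rule poly_mapping_eqI) (simp add: lW lookup_add)
  define w where "w m = D.cl (W m)" for m
  interpret C: comm_group D.C by (rule D.comm_group_class_group)
  have RQ: "row_quotient D.C w t k s"
  proof
    fix m m' :: "nat \<Rightarrow> nat \<Rightarrow> int"
    show "w (\<lambda>i j. m i j + m' i j) = w m \<otimes>\<^bsub>D.C\<^esub> w m'"
      by (simp add: w_def D.cl_mult keysW W_add)
  next
    show "range w = carrier D.C"
    proof (intro equalityI subsetI)
      fix x assume "x \<in> carrier D.C"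
      then obtain c where c: "Poly_Mapping.keys c \<subseteq> Q" "x = D.cl c" by (auto simp: D.carrier_class_group)
      \<comment> \<open>Row 0 is subtracted from all rows; a matrix with constant columns is
        principal, being a combination of the divisors of the atoms of \<open>B\<close>.\<close>
      define m where "m i j = Poly_Mapping.lookup c (p (i, j)) - Poly_Mapping.lookup c (p (0, j))" for i j
      have "Poly_Mapping.lookup (c - W m) (p (i, j)) = Poly_Mapping.lookup c (p (0, j))"
        if "i \<in> {0..k}" "j \<in> {0..t}" for i j
        using lWp[OF that, of m] by (cases "i = 0") (auto simp: lookup_minus m_def)
      moreover have "Poly_Mapping.keys (c - W m) \<subseteq> Q" using keys_diff[of c "W m"] c keysW[of m] by blast
      ultimately have "c - W m \<in> D.K"
        by (intro principalI[of _ "\<lambda>j. Poly_Mapping.lookup c (p (0, j))"])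
      then have "x = w m" using D.cl_eq_iff c keysW by (simp add: w_def)
      then show "x \<in> range w" by blast
    qed (auto simp: w_def intro!: D.cl_closed keysW)
  next
    fix m :: "nat \<Rightarrow> nat \<Rightarrow> int"
    have "w m = \<one>\<^bsub>D.C\<^esub> \<longleftrightarrow> (\<exists>x y :: nat \<Rightarrow> int. \<forall>i\<in>{0..k}. \<forall>j\<in>{0..t}.
      (if i \<ge> 1 then m i j else 0) = x i * int (s j) + y j)"
      using principal[OF keysW[of m]] by (simp add: w_def D.cl_eq_one_iff keysW lWp)
    also have "\<dots> \<longleftrightarrow> (\<forall>i\<in>{1..k}. \<exists>x. \<forall>j\<in>{0..t}. m i j = x * int (s j))"
    proof
      assume "\<exists>x y :: nat \<Rightarrow> int. \<forall>i\<in>{0..k}. \<forall>j\<in>{0..t}.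
        (if i \<ge> 1 then m i j else 0) = x i * int (s j) + y j"
      then obtain x y :: "nat \<Rightarrow> int" where xy: "\<And>i j. \<lbrakk>i \<in> {0..k}; j \<in> {0..t}\<rbrakk> \<Longrightarrow>
        (if i \<ge> 1 then m i j else 0) = x i * int (s j) + y j" by blast
      show "\<forall>i\<in>{1..k}. \<exists>x. \<forall>j\<in>{0..t}. m i j = x * int (s j)"
      proof
        fix i assume i: "i \<in> {1..k}"
        \<comment> \<open>The zero row gives \<open>y j = - x 0 * int (s j)\<close>, so the column
          terms merge with the row terms.\<close>
        have "m i j = (x i - x 0) * int (s j)" if "j \<in> {0..t}" for j
          using xy[of i j] xy[of 0 j] i that by (simp add: algebra_simps)
        then show "\<exists>x. \<forall>j\<in>{0..t}. m i j = x * int (s j)" by blast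
      qed
    next
      assume "\<forall>i\<in>{1..k}. \<exists>x. \<forall>j\<in>{0..t}. m i j = x * int (s j)"
      then obtain x where x: "\<And>i j. \<lbrakk>i \<in> {1..k}; j \<in> {0..t}\<rbrakk> \<Longrightarrow> m i j = x i * int (s j)" by metis
      have "\<forall>i\<in>{0..k}. \<forall>j\<in>{0..t}. (if i \<ge> 1 then m i j else 0) =
          (if i \<ge> 1 then x i else 0) * int (s j) + (\<lambda>_. 0) j"
        using x by auto
      then show "\<exists>x y :: nat \<Rightarrow> int. \<forall>i\<in>{0..k}. \<forall>j\<in>{0..t}.
        (if i \<ge> 1 then m i j else 0) = x i * int (s j) + y j"
        by (intro exI[of _ "\<lambda>i. if i \<ge> 1 then x i else 0"] exI[of _ "\<lambda>_. 0"])
    qed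
    finally show "w m = \<one>\<^bsub>D.C\<^esub> \<longleftrightarrow> (\<forall>i\<in>{1..k}. \<exists>x. \<forall>j\<in>{0..t}. m i j = x * int (s j))" .
  qed (use k s_pos s_sum nontrivial in auto)
  interpret RQ: row_quotient D.C w t k s by (rule RQ)
  have "divisor_class G Q \<psi> (p (i, j)) = w (RQ.unit_vec i j)" if ij: "i \<in> {0..k}" "j \<in> {0..t}" for i j
  proof -
    let ?c = "frag_of (p (i, j)) - W (RQ.unit_vec i j)"
    have kc: "Poly_Mapping.keys (frag_of (p (i, j))) \<subseteq> Q" using pQ[OF ij] by simp
    \<comment> \<open>For \<open>i \<ge> 1\<close> the difference is 0. For \<open>i = 0\<close> the
      entries \<open>- 1\<close> of \<open>unit_vec 0 j\<close> complete the prime divisor to the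
      whole column \<open>j\<close>, which is principal.\<close>
    have "Poly_Mapping.lookup ?c (p (i', j')) =
        (if i = 0 \<and> j' = j then 1 else 0)" if "i' \<in> {0..k}" "j' \<in> {0..t}" for i' j'
      using lWp[OF that, of "RQ.unit_vec i j"] ij that
      by (auto simp: lookup_minus lookup_frag_of p_eq RQ.unit_vec_def)
    moreover have "Poly_Mapping.keys ?c \<subseteq> Q" using keys_diff[of "frag_of (p (i, j))"] kc keysW by blast
    ultimately have "?c \<in> D.K"
      by (intro principalI[of _ "\<lambda>j'. if i = 0 \<and> j' = j then 1 else 0"])
    then show ?thesis using D.cl_eq_iff kc keysW by (simp add: w_def D.divisor_class_eq)
  qed
  with RQ p show thesis by (rule that)
qed

lemma image_case_prod_Times: "(\<lambda>(i, j). f i j) ` (S \<times> T) = {f i j | i j. i \<in> S \<and> j \<in> T}"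
  by auto

text \<open>Columns 1 to \<open>t\<close> provide the elements \<open>e\<close> and column 0 the
  elements \<open>g\<close>; row 0 provides \<open>e 0 j\<close> and \<open>g 0\<close>. Which atom
  of \<open>B\<close> is numbered 0 is an arbitrary choice.\<close>

lemma (in pure_relation_monoid) class_group_description:
  assumes nontrivial: "size A \<ge> 2" "size B \<ge> 2" "size A \<noteq> size B"
    and D: "divisor_monoid G Q \<psi>"
  shows "(let C = class_group G Q \<psi>;
                 cls = divisor_class G Q \<psi>;
                 GP = cls ` Q
             in (\<forall>c\<in>GP. \<exists>!p. p \<in> Q \<and> cls p = c) \<and>
                G \<cong> zero_sum_monoid C GP \<and>
                (\<exists>(t::nat) (k::nat) (s :: nat \<Rightarrow> nat) e g.
                  k \<ge> 1 \<and> (\<forall>j\<in>{0..t}. s j \<ge> 1) \<and>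
                  k + 1 \<noteq> (\<Sum>j=0..t. s j) \<and> (\<Sum>j=0..t. s j) \<ge> 2 \<and>
                  independent_family C ({1..k} \<times> {1..t}) (\<lambda>(i, j). e i j) \<and>
                  (\<forall>i\<in>{1..k}. \<forall>j\<in>{1..t}. group.ord C (e i j) = 0) \<and>
                  independent_family C {1..k} g \<and>
                  (t > 0 \<longrightarrow> (\<forall>i\<in>{1..k}. group.ord C (g i) = 0)) \<and>
                  (t = 0 \<longrightarrow> (\<forall>i\<in>{1..k}. group.ord C (g i) \<noteq> 0)) \<and>
                  (\<forall>j\<in>{1..t}. e 0 j = inv\<^bsub>C\<^esub> (\<Otimes>\<^bsub>C\<^esub>i\<in>{1..k}. e i j)) \<and>
                  g 0 = inv\<^bsub>C\<^esub> (\<Otimes>\<^bsub>C\<^esub>i\<in>{1..k}. g i) \<and>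
                  GP = {e i j | i j. i \<in> {0..k} \<and> j \<in> {1..t}} \<union> g ` {0..k} \<and>
                  internal_direct_sum C {1..k}
                    (\<lambda>i. generate C (e i ` {1..t} \<union> {g i})) (carrier C) \<and>
                  (\<forall>i\<in>{1..k}.
                    g i [^]\<^bsub>C\<^esub> s 0 \<in> generate C (e i ` {1..t}) \<and>
                    (\<forall>m. 0 < m \<and> m < s 0 \<longrightarrow> g i [^]\<^bsub>C\<^esub> m \<notin> generate C (e i ` {1..t})) \<and>
                    inv\<^bsub>C\<^esub> (g i [^]\<^bsub>C\<^esub> s 0) = (\<Otimes>\<^bsub>C\<^esub>j\<in>{1..t}. e i j [^]\<^bsub>C\<^esub> s j)) \<and>
                  (let n = Gcd (s ` {0..t}) in
                    C \<cong> product_group {1..k} (\<lambda>_.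
                           product_group {1..t} (\<lambda>_. integer_group) \<times>\<times> integer_mod_group n) \<and>
                    (torsion_group C \<longleftrightarrow> t = 0) \<and>
                    (t = 0 \<longrightarrow>
                       C \<cong> product_group {1..k} (\<lambda>_. integer_mod_group n) \<and>
                       n \<ge> 2 \<and> k + 1 \<noteq> n \<and> (\<forall>i\<in>{1..k}. group.ord C (g i) = n)))))"
proof -
  interpret D: divisor_monoid G Q \<psi> by fact
  obtain t k :: nat and s :: "nat \<Rightarrow> nat" and w p where RQ: "row_quotient D.C w t k s"
    and p: "bij_betw p ({0..k} \<times> {0..t}) Q"
    and cls_p: "\<And>i j. \<lbrakk>i \<in> {0..k}; j \<in> {0..t}\<rbrakk> \<Longrightarrow>
      divisor_class G Q \<psi> (p (i, j)) = w (row_quotient.unit_vec i j)"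
    by (rule ex_coordinates[OF nontrivial D]) (rule that)
  interpret RQ: row_quotient D.C w t k s by (rule RQ)
  let ?cls = "divisor_class G Q \<psi>"
  have cls_E: "?cls (p (i, j)) = RQ.E i j" if "i \<in> {0..k}" "j \<in> {0..t}" for i j
    using cls_p[OF that] by (simp add: RQ.E_def)
  have pQ: "p ` ({0..k} \<times> {0..t}) = Q" using p by (simp add: bij_betw_def)
  have inj: "inj_on ?cls Q"
  proof (rule inj_onI)
    fix q q' assume "q \<in> Q" "q' \<in> Q" and eq: "?cls q = ?cls q'"
    then obtain i j i' j' where "i \<in> {0..k}" "j \<in> {0..t}" "q = p (i, j)"
      "i' \<in> {0..k}" "j' \<in> {0..t}" "q' = p (i', j')" unfolding pQ[symmetric] by auto
    then show "q = q'" using eq RQ.E_inj[of i i' j j'] by (simp add: cls_E)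
  qed
  have unique: "\<forall>c\<in>?cls ` Q. \<exists>!q. q \<in> Q \<and> ?cls q = c" using inj by (auto dest: inj_onD)
  have iso: "G \<cong> zero_sum_monoid D.C (?cls ` Q)"
    by (rule D.iso_zero_sum_monoid[OF cancellative Units_eq inj])
  have "?cls ` Q = ?cls ` p ` ({0..k} \<times> {0..t})" by (simp only: pQ)
  also have "\<dots> = (\<lambda>(i, j). RQ.E i j) ` ({0..k} \<times> {0..t})"
    unfolding image_image by (rule image_cong) (clarsimp simp: cls_E)+
  also have "\<dots> = {RQ.E i j | i j. i \<in> {0..k} \<and> j \<in> {1..t}} \<union> (\<lambda>i. RQ.E i 0) ` {0..k}"
  proof -
    have "{0..k} \<times> {0..t} = {0..k} \<times> {1..t} \<union> (\<lambda>i. (i, 0)) ` {0..k}" by auto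
    moreover have "(\<lambda>(i, j). RQ.E i j) ` ({0..k} \<times> {1..t}) =
        {RQ.E i j | i j. i \<in> {0..k} \<and> j \<in> {1..t}}" by (rule image_case_prod_Times)
    ultimately show ?thesis by (simp only: image_Un image_image prod.case)
  qed
  finally have GP: "?cls ` Q = {RQ.E i j | i j. i \<in> {0..k} \<and> j \<in> {1..t}} \<union> (\<lambda>i. RQ.E i 0) ` {0..k}" .
  have gen: "RQ.E i 0 [^]\<^bsub>D.C\<^esub> s 0 \<in> generate D.C (RQ.E i ` {1..t}) \<and>
      (\<forall>m. 0 < m \<and> m < s 0 \<longrightarrow> RQ.E i 0 [^]\<^bsub>D.C\<^esub> m \<notin> generate D.C (RQ.E i ` {1..t})) \<and>
      inv\<^bsub>D.C\<^esub> (RQ.E i 0 [^]\<^bsub>D.C\<^esub> s 0) = (\<Otimes>\<^bsub>D.C\<^esub>j\<in>{1..t}. RQ.E i j [^]\<^bsub>D.C\<^esub> s j)"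
    if "i \<in> {1..k}" for i
    unfolding RQ.g_pow_in_generate_iff[OF that] RQ.g_pow_relation[OF that]
    by (auto dest: dvd_imp_le)
  have s_sum: "t = 0 \<Longrightarrow> s 0 \<ge> 2 \<and> k + 1 \<noteq> s 0" using RQ.s_sum by auto
  show ?thesis
    unfolding Let_def
  proof (rule conjI[OF unique], rule conjI[OF iso], rule exI[of _ t], rule exI[of _ k],
      rule exI[of _ s], rule exI[of _ RQ.E], rule exI[of _ "\<lambda>i. RQ.E i 0"], intro conjI)
    show "k \<ge> 1" by (rule RQ.k_pos)
    show "\<forall>j\<in>{0..t}. s j \<ge> 1" using RQ.s_pos by simp
    show "k + 1 \<noteq> (\<Sum>j=0..t. s j)" "(\<Sum>j=0..t. s j) \<ge> 2" by (rule RQ.s_sum)+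
    show "independent_family D.C ({1..k} \<times> {1..t}) (\<lambda>(i, j). RQ.E i j)" by (rule RQ.independent_e)
    show "\<forall>i\<in>{1..k}. \<forall>j\<in>{1..t}. group.ord D.C (RQ.E i j) = 0" using RQ.E_ord_infinite by auto
    show "independent_family D.C {1..k} (\<lambda>i. RQ.E i 0)" by (rule RQ.independent_g)
    show "t > 0 \<longrightarrow> (\<forall>i\<in>{1..k}. group.ord D.C (RQ.E i 0) = 0)" using RQ.E_ord_infinite by auto
    show "t = 0 \<longrightarrow> (\<forall>i\<in>{1..k}. group.ord D.C (RQ.E i 0) \<noteq> 0)"
      using RQ.E_ord_finite s_sum by auto
    show "\<forall>j\<in>{1..t}. RQ.E 0 j = inv\<^bsub>D.C\<^esub> (\<Otimes>\<^bsub>D.C\<^esub>i\<in>{1..k}. RQ.E i j)" using RQ.E_zero by blast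
    show "RQ.E 0 0 = inv\<^bsub>D.C\<^esub> (\<Otimes>\<^bsub>D.C\<^esub>i\<in>{1..k}. RQ.E i 0)" by (rule RQ.E_zero)
    show "?cls ` Q = {RQ.E i j | i j. i \<in> {0..k} \<and> j \<in> {1..t}} \<union> (\<lambda>i. RQ.E i 0) ` {0..k}" by (rule GP)
    show "internal_direct_sum D.C {1..k} (\<lambda>i. generate D.C (RQ.E i ` {1..t} \<union> {RQ.E i 0})) (carrier D.C)"
      by (rule RQ.internal_direct_sum_rows)
    show "\<forall>i\<in>{1..k}. RQ.E i 0 [^]\<^bsub>D.C\<^esub> s 0 \<in> generate D.C (RQ.E i ` {1..t}) \<and>
      (\<forall>m. 0 < m \<and> m < s 0 \<longrightarrow> RQ.E i 0 [^]\<^bsub>D.C\<^esub> m \<notin> generate D.C (RQ.E i ` {1..t})) \<and>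
      inv\<^bsub>D.C\<^esub> (RQ.E i 0 [^]\<^bsub>D.C\<^esub> s 0) = (\<Otimes>\<^bsub>D.C\<^esub>j\<in>{1..t}. RQ.E i j [^]\<^bsub>D.C\<^esub> s j)"
      using gen by blast
    show "D.C \<cong> product_group {1..k} (\<lambda>_. product_group {1..t} (\<lambda>_. integer_group) \<times>\<times>
        integer_mod_group (Gcd (s ` {0..t})))" by (rule RQ.iso_product)
    show "torsion_group D.C \<longleftrightarrow> t = 0" by (rule RQ.torsion_iff)
    show "t = 0 \<longrightarrow> D.C \<cong> product_group {1..k} (\<lambda>_. integer_mod_group (Gcd (s ` {0..t}))) \<and>
        Gcd (s ` {0..t}) \<ge> 2 \<and> k + 1 \<noteq> Gcd (s ` {0..t}) \<and>
        (\<forall>i\<in>{1..k}. group.ord D.C (RQ.E i 0) = Gcd (s ` {0..t}))"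
      using RQ.iso_product_torsion RQ.E_ord_finite s_sum by auto
  qed
qed

section \<open>Transfer Krull monoids\<close>

text \<open>For the empty relation, factorizations with equal product have difference 0.\<close>

lemma factorial_if_trivial:
  assumes "comm_monoid H" and "relation_monoid (red H) {#} {#}"
  shows "factorial H"
  unfolding factorial_def
proof
  interpret H: comm_monoid H by fact
  interpret R: relation_monoid "red H" "{#}" "{#}" by fact
  fix a assume a: "a \<in> carrier H"
  then have "Units H #>\<^bsub>H\<^esub> a \<in> carrier (red H)" by simp
  then obtain z where z: "set_mset z \<subseteq> atoms (red H)" "mset_prod (red H) z = Units H #>\<^bsub>H\<^esub> a"
    by (rule R.ex_factorization)
  have unique: "z' = z" if "set_mset z' \<subseteq> atoms (red H)" "mset_prod (red H) z' = Units H #>\<^bsub>H\<^esub> a" for z'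
    using R.prod_eq_iff[OF that(1) z(1)] that z
    by (simp add: multiple_diff_def multiset_eq_iff)
  have fact: "factorizations H a =
      {z. set_mset z \<subseteq> atoms (red H) \<and> mset_prod (red H) z = Units H #>\<^bsub>H\<^esub> a}"
    using a by (auto simp: factorizations_def H.l_coset_Units)
  show "\<exists>!z. z \<in> factorizations H a"
  proof (rule ex1I[of _ z])
    show "z \<in> factorizations H a" using z by (simp add: fact)
    show "z' = z" if "z' \<in> factorizations H a" for z' using that unique[of z'] by (simp add: fact)
  qed
qed

theorem corollary1p5:
  fixes H :: "('a, 'm) monoid_scheme" and B :: "('b, 'n) monoid_scheme" and \<theta> :: "'a \<Rightarrow> 'b"
  assumes "uc_monoid H"
    and "krull_monoid B" and "transfer_hom H B \<theta>"
    and "length_factorial H"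
  shows "krull_monoid (red H) \<and>
    (\<exists>Hs. submonoid Hs (red H) \<and>
      (let P0 = primes (red H); Hstar = (red H)\<lparr>carrier := Hs\<rparr> in
        (\<lambda>(M, h). mset_prod (red H) M \<otimes>\<^bsub>red H\<^esub> h) \<in> iso (free_monoid P0 \<times>\<times> Hstar) (red H) \<and>
        reduced Hstar \<and> length_factorial Hstar \<and> krull_monoid Hstar \<and> primes Hstar = {} \<and>
        (\<forall>(P :: 'a set set set) \<phi> (Ps :: 'a set set set) \<phi>s.
           divisor_theory (red H) P \<phi> \<and> divisor_theory Hstar Ps \<phi>s \<longrightarrow>
           class_group (red H) P \<phi> \<cong> class_group Hstar Ps \<phi>s) \<and>
        (\<not> factorial H \<longrightarrow>
          (\<forall>(Ps :: 'a set set set) \<phi>s. divisor_theory Hstar Ps \<phi>s \<longrightarrow>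
            (let C = class_group Hstar Ps \<phi>s;
                 cls = divisor_class Hstar Ps \<phi>s;
                 GP = cls ` Ps
             in (\<forall>c\<in>GP. \<exists>!p. p \<in> Ps \<and> cls p = c) \<and>
                Hstar \<cong> zero_sum_monoid C GP \<and>
                (\<exists>(t::nat) (k::nat) (s :: nat \<Rightarrow> nat) e g.
                  k \<ge> 1 \<and> (\<forall>j\<in>{0..t}. s j \<ge> 1) \<and>
                  k + 1 \<noteq> (\<Sum>j=0..t. s j) \<and> (\<Sum>j=0..t. s j) \<ge> 2 \<and>
                  independent_family C ({1..k} \<times> {1..t}) (\<lambda>(i, j). e i j) \<and>
                  (\<forall>i\<in>{1..k}. \<forall>j\<in>{1..t}. group.ord C (e i j) = 0) \<and>
                  independent_family C {1..k} g \<and>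
                  (t > 0 \<longrightarrow> (\<forall>i\<in>{1..k}. group.ord C (g i) = 0)) \<and>
                  (t = 0 \<longrightarrow> (\<forall>i\<in>{1..k}. group.ord C (g i) \<noteq> 0)) \<and>
                  (\<forall>j\<in>{1..t}. e 0 j = inv\<^bsub>C\<^esub> (\<Otimes>\<^bsub>C\<^esub>i\<in>{1..k}. e i j)) \<and>
                  g 0 = inv\<^bsub>C\<^esub> (\<Otimes>\<^bsub>C\<^esub>i\<in>{1..k}. g i) \<and>
                  GP = {e i j | i j. i \<in> {0..k} \<and> j \<in> {1..t}} \<union> g ` {0..k} \<and>
                  internal_direct_sum C {1..k}
                    (\<lambda>i. generate C (e i ` {1..t} \<union> {g i})) (carrier C) \<and>
                  (\<forall>i\<in>{1..k}.
                    g i [^]\<^bsub>C\<^esub> s 0 \<in> generate C (e i ` {1..t}) \<and>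
                    (\<forall>m. 0 < m \<and> m < s 0 \<longrightarrow> g i [^]\<^bsub>C\<^esub> m \<notin> generate C (e i ` {1..t})) \<and>
                    inv\<^bsub>C\<^esub> (g i [^]\<^bsub>C\<^esub> s 0) = (\<Otimes>\<^bsub>C\<^esub>j\<in>{1..t}. e i j [^]\<^bsub>C\<^esub> s j)) \<and>
                  (let n = Gcd (s ` {0..t}) in
                    C \<cong> product_group {1..k} (\<lambda>_.
                           product_group {1..t} (\<lambda>_. integer_group) \<times>\<times> integer_mod_group n) \<and>
                    (torsion_group C \<longleftrightarrow> t = 0) \<and>
                    (t = 0 \<longrightarrow>
                       C \<cong> product_group {1..k} (\<lambda>_. integer_mod_group n) \<and>
                       n \<ge> 2 \<and> k + 1 \<noteq> n \<and> (\<forall>i\<in>{1..k}. group.ord C (g i) = n)))))))))"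
proof -
  interpret H: uc_monoid H by fact
  interpret R: comm_monoid "red H" by (rule H.comm_monoid_red)
  obtain A C where AC: "generating_relation (red H) A C" "\<And>u. count A u \<le> 1"
    "A = {#} \<and> C = {#} \<or> size A \<ge> 2 \<and> size C \<ge> 2 \<and> size A \<noteq> size C"
    by (rule ex_generating_relation_red[OF H.comm_monoid_axioms assms(2-4)]) (rule that)
  have sep: "size_separates (red H)" and gen: "atomically_generated (red H)"
    using assms(4) length_factorial_iff_red[OF H.comm_monoid_axioms]
    by (auto simp: size_separates_def atomically_generated_def)
  interpret R: relation_monoid "red H" A C
    by unfold_locales (use AC gen H.reduced_red in \<open>auto simp: reduced_def\<close>)
  define Hs where "Hs = (red H)\<lparr>carrier := R.star\<rparr>"
  interpret S: pure_relation_monoid Hs A C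
    unfolding Hs_def
    by (intro pure_relation_monoid.intro pure_relation_monoid_axioms.intro R.relation_monoid_star R.atoms_star)
  have red_S: "reduced Hs" using S.Units_eq by (simp add: reduced_def Hs_def)
  have lf_S: "length_factorial Hs"
  proof (rule S.length_factorial_reducedI[OF red_S])
    fix x assume "x \<in> carrier Hs"
    then show "\<exists>z. set_mset z \<subseteq> atoms Hs \<and> mset_prod Hs z = x" by (meson S.ex_factorization)
  next
    fix z z' assume z: "set_mset z \<subseteq> atoms Hs" "set_mset z' \<subseteq> atoms Hs"
      "mset_prod Hs z = mset_prod Hs z'" "size z = size z'"
    \<comment> \<open>Atoms and products in the factor are those of \<open>red H\<close>, so
      separation by length is inherited.\<close>
    then have "set_mset z \<subseteq> atoms (red H)" "set_mset z' \<subseteq> atoms (red H)"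
      "mset_prod (red H) z = mset_prod (red H) z'"
      using R.sides_atoms R.prod_star[of z] R.prod_star[of z'] by (auto simp: S.atoms_eq simp flip: Hs_def)
    then show "z = z'" using sep z(4) by (simp add: size_separates_def)
  qed
  have krull_S: "krull_monoid Hs"
    by (rule krull_monoidI[OF S.cancellative divisor_monoid.divisor_theory[OF S.divisor_monoid_div_map]])
  have primes_S: "primes Hs = {}" by (simp add: S.primes_eq S.atoms_eq)
  note iso = R.iso_primes_star
  have krull_R: "krull_monoid (red H)"
  proof -
    obtain \<phi> where "divisor_monoid (red H) (primes (red H) <+> S.prime_divs) \<phi>"
      by (rule divisor_monoid_free_times[OF S.divisor_monoid_div_map[unfolded Hs_def] R.comm_monoid_axioms iso])
    then show ?thesis using krull_monoidI[OF R.cancellative divisor_monoid.divisor_theory] by blast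
  qed
  have dm: "divisor_monoid K P \<phi>" if "comm_monoid K" "divisor_theory K P \<phi>"
    for K :: "('c, 'd) monoid_scheme" and P :: "'p set" and \<phi>
    using that by (simp add: divisor_monoid_def divisor_monoid_axioms_def)
  have class_groups: "class_group (red H) P \<phi> \<cong> class_group Hs Ps \<phi>s"
    if "divisor_theory (red H) P \<phi>" "divisor_theory Hs Ps \<phi>s"
    for P :: "'a set set set" and \<phi> and Ps :: "'a set set set" and \<phi>s
    using class_group_free_times[OF dm[OF R.comm_monoid_axioms that(1)]
        dm[OF S.comm_monoid_axioms that(2), unfolded Hs_def] iso]
    by (simp add: Hs_def)
  \<comment> \<open>The empty relation would make \<open>H\<close> factorial, so only the
    alternative with the length conditions is left.\<close>
  have nontrivial: "size A \<ge> 2" "size C \<ge> 2" "size A \<noteq> size C" if "\<not> factorial H"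
    using AC(3) factorial_if_trivial[OF H.comm_monoid_axioms] R.relation_monoid_axioms that by auto
  note descr = S.class_group_description[OF nontrivial dm[OF S.comm_monoid_axioms]]
  show ?thesis
    unfolding Let_def
  proof (rule conjI[OF krull_R], rule exI[of _ R.star], fold Hs_def, intro conjI)
    show "submonoid R.star (red H)" by (rule R.submonoid_star)
    show "(\<lambda>(M, h). mset_prod (red H) M \<otimes>\<^bsub>red H\<^esub> h) \<in> iso (free_monoid (primes (red H)) \<times>\<times> Hs) (red H)"
      using iso by (simp add: Hs_def)
    show "reduced Hs" "length_factorial Hs" "krull_monoid Hs" "primes Hs = {}"
      by (rule red_S lf_S krull_S primes_S)+
    show "\<forall>(P :: 'a set set set) \<phi> (Ps :: 'a set set set) \<phi>s.
        divisor_theory (red H) P \<phi> \<and> divisor_theory Hs Ps \<phi>s \<longrightarrow>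
        class_group (red H) P \<phi> \<cong> class_group Hs Ps \<phi>s"
      using class_groups by blast
  qed (intro impI allI, rule descr[unfolded Let_def], assumption+)
qed

end
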